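(* Denoting by $K_m$ a finite clique of size $m\geq 3$, we have: (1) the $K_m$-free random graph $R(K_m)$ satisfies $\mathrm{Out}(\mathrm{Aut}(R(K_m)))\cong\{e\}$; (2) the $k$-colored random graph $R_k$ ($k\geq 2$) satisfies $\mathrm{Out}(\mathrm{Aut}(R_k))\cong\mathrm{Sym}(k)$.
   Context: For a group $G$, $\mathrm{Out}(G)=\mathrm{Aut}(G)/\mathrm{Inn}(G)$. The $K_m$-free random graph $R(K_m)$ is the Fraïssé limit of the class of finite graphs not containing a clique of size $m$. The $k$-colored random graph $R_k$ is the Fraïssé limit of the class of finite complete graphs whose edges are colored with $k$ colors, viewed as structures with $k$ symmetric irreflexive binary predicates $C_1,\dots,C_k$ (one for each color), exactly one of which holds on each pair of distinct vertices; automorphisms preserve each color. *)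

theory Defs
  imports "HOL-Algebra.Algebra"
begin

section \<open>Binary relational structures and Fraisse limits\<close>

text \<open>
  A structure whose symbols are all binary. The language is a set \<open>L\<close> of symbols passed as a
  separate argument. Interpretations are total predicates on the element type; only their
  restriction to the universe, and only the symbols in \<open>L\<close>, are ever inspected.
\<close>

record ('s, 'a) binstr =
  univ :: "'a set"
  rel :: "'s \<Rightarrow> 'a \<Rightarrow> 'a \<Rightarrow> bool"

definition substr :: "('s, 'a) binstr \<Rightarrow> 'a set \<Rightarrow> ('s, 'a) binstr" where
  "substr M S = M\<lparr>univ := S\<rparr>"

definition str_embedding ::
    "'s set \<Rightarrow> ('s, 'a) binstr \<Rightarrow> ('s, 'b) binstr \<Rightarrow> ('a \<Rightarrow> 'b) \<Rightarrow> bool" where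
  "str_embedding L A B f \<longleftrightarrow>
     inj_on f (univ A) \<and> f ` univ A \<subseteq> univ B \<and>
     (\<forall>s\<in>L. \<forall>x\<in>univ A. \<forall>y\<in>univ A. rel A s x y \<longleftrightarrow> rel B s (f x) (f y))"

definition str_iso ::
    "'s set \<Rightarrow> ('s, 'a) binstr \<Rightarrow> ('s, 'b) binstr \<Rightarrow> ('a \<Rightarrow> 'b) \<Rightarrow> bool" where
  "str_iso L A B f \<longleftrightarrow> str_embedding L A B f \<and> bij_betw f (univ A) (univ B)"

definition ultrahomogeneous :: "'s set \<Rightarrow> ('s, 'a) binstr \<Rightarrow> bool" where
  "ultrahomogeneous L M \<longleftrightarrow>
     (\<forall>S T f. finite S \<and> S \<subseteq> univ M \<and> finite T \<and> T \<subseteq> univ M \<and>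
              str_iso L (substr M S) (substr M T) f \<longrightarrow>
              (\<exists>g. str_iso L M M g \<and> (\<forall>x\<in>S. g x = f x)))"

text \<open>
  A class of finite structures is represented by its members with universe a finite set of
  natural numbers; for an isomorphism-closed class this loses nothing. The age of a structure
  is represented in the same way.
\<close>

definition age :: "'s set \<Rightarrow> ('s, 'a) binstr \<Rightarrow> ('s, nat) binstr set" where
  "age L M = {A. finite (univ A) \<and> (\<exists>f. str_embedding L A M f)}"

definition fraisse_limit ::
    "'s set \<Rightarrow> ('s, nat) binstr set \<Rightarrow> ('s, 'a) binstr \<Rightarrow> bool" where
  "fraisse_limit L K M \<longleftrightarrow> countable (univ M) \<and> ultrahomogeneous L M \<and> age L M = K"

section \<open>The two random structures\<close>

definition is_graph :: "(unit, 'a) binstr \<Rightarrow> bool" where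
  "is_graph A \<longleftrightarrow> symp_on (univ A) (rel A ()) \<and> irreflp_on (univ A) (rel A ())"

definition has_clique :: "nat \<Rightarrow> (unit, 'a) binstr \<Rightarrow> bool" where
  "has_clique m A \<longleftrightarrow>
     (\<exists>S. S \<subseteq> univ A \<and> finite S \<and> card S = m \<and> pairwise (rel A ()) S)"

definition clique_free_graphs :: "nat \<Rightarrow> (unit, nat) binstr set" where
  "clique_free_graphs m = {A. finite (univ A) \<and> is_graph A \<and> \<not> has_clique m A}"

definition clique_free_random_graph :: "nat \<Rightarrow> (unit, 'a) binstr \<Rightarrow> bool" where
  "clique_free_random_graph m R \<longleftrightarrow> fraisse_limit {()} (clique_free_graphs m) R"

text \<open>The colors are \<open>1, \<dots>, k\<close>.\<close>

definition is_colored_graph :: "nat \<Rightarrow> (nat, 'a) binstr \<Rightarrow> bool" where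
  "is_colored_graph k A \<longleftrightarrow>
     (\<forall>i\<in>{1..k}. symp_on (univ A) (rel A i) \<and> irreflp_on (univ A) (rel A i)) \<and>
     (\<forall>x\<in>univ A. \<forall>y\<in>univ A. x \<noteq> y \<longrightarrow> (\<exists>!i. i \<in> {1..k} \<and> rel A i x y))"

definition colored_graphs :: "nat \<Rightarrow> (nat, nat) binstr set" where
  "colored_graphs k = {A. finite (univ A) \<and> is_colored_graph k A}"

definition colored_random_graph :: "nat \<Rightarrow> (nat, 'a) binstr \<Rightarrow> bool" where
  "colored_random_graph k R \<longleftrightarrow> fraisse_limit {1..k} (colored_graphs k) R"

section \<open>Automorphism groups and outer automorphism groups\<close>

definition Aut_str :: "'s set \<Rightarrow> ('s, 'a) binstr \<Rightarrow> ('a \<Rightarrow> 'a) monoid" where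
  "Aut_str L M = BijGroup (univ M)\<lparr>carrier := {f \<in> Bij (univ M). str_iso L M M f}\<rparr>"

definition Inn :: "('a, 'b) monoid_scheme \<Rightarrow> ('a \<Rightarrow> 'a) set" where
  "Inn G = (\<lambda>g. \<lambda>x\<in>carrier G. g \<otimes>\<^bsub>G\<^esub> x \<otimes>\<^bsub>G\<^esub> inv\<^bsub>G\<^esub> g) ` carrier G"

definition Out :: "('a, 'b) monoid_scheme \<Rightarrow> ('a \<Rightarrow> 'a) set monoid" where
  "Out G = AutoGroup G Mod Inn G"

end

theory Submission
  imports Defs
begin

text \<open>Let \<open>G\<close> be the automorphism group of one of the two structures and let \<open>\<phi>\<close> be an automorphism
  of the abstract group \<open>G\<close>. The point is to see that \<open>\<phi>\<close> permutes the point stabilizers. Consider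
  the involutions \<open>a \<in> G\<close> that fix \<open>x\<close>, move every other point, and give all pairs \<open>{y, a y}\<close> the same
  color (non-adjacency). Any two of them are conjugate, and commuting ones have the same fixed point.
  Conversely a back-and-forth construction joins any two with fixed point \<open>x\<close> by a chain
  of pairwise commuting ones. Hence the stabilizer of \<open>x\<close> is the set of ends \<open>h\<close> of chains
  \<open>1 = v_0, \<dots>, v_n = h\<close> in which consecutive conjugates of \<open>a\<close> by \<open>v_i\<close> and \<open>v_(i+1)\<close> commute. Its image
  under \<open>\<phi>\<close> has the same form with \<open>\<phi> a\<close> in place of \<open>a\<close>, so it is an analytic subgroup of
  countable index, and therefore open by the Baire category theorem. Free amalgamation
  shows that an open subgroup has a least finite support, and
  comparing the supports for \<open>\<phi>\<close> and its inverse identifies the image as a point stabilizer.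

  So \<open>\<phi>\<close> is conjugation by a permutation \<open>f\<close> of the points that normalizes \<open>G\<close>; such \<open>f\<close>
  permute the orbits of \<open>G\<close> on pairs. In the clique-free graph adjacency cannot be exchanged
  with non-adjacency, whereas in the colored graph every permutation of the colors occurs.\<close>

text \<open>The obstacle is that \<phi> is not assumed continuous, so the topology of
  \<open>G\<close> has to be recovered from its multiplication. What is to be followed through
  \<phi> is therefore written with equations between conjugates of one parameter \<open>a\<close>;
  applying \<phi> only replaces the parameter. Such equations survive limits in which both the
  permutations and their inverses converge pointwise, and the quantifier over the intermediate
  \<open>v_i\<close> makes the image a projection of a closed set.

  Two involutions \<open>u\<close>, \<open>w\<close> with the same fixed point can be too entangled
  for a direct construction. A path \<open>u\<close>, \<open>v\<close>, \<open>v'\<close>,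
  \<open>w\<close> is built when they are in general position: every type of a new point over a
  finite set has a realization \<open>y\<close> for which \<open>{u y, w y}\<close> has color
  \<open>1\<close>. Any two are joined through a third one in general position to both, so six links
  suffice.

  The centralizer of \<open>G\<close> among all permutations is trivial. Hence \<open>f\<close> is
  unique, and the outer automorphism group is the normalizer of \<open>G\<close> modulo
  \<open>G\<close>, which acts faithfully on the colors.\<close>

definition col_aut :: "(nat \<Rightarrow> nat \<Rightarrow> nat) \<Rightarrow> (nat \<Rightarrow> nat) set" where
  "col_aut c = {g. bij g \<and> (\<forall>x y. c (g x) (g y) = c x y)}"

text \<open>The common shape of the constructions by finite stages: \<open>P\<close> holds of the
  approximations, \<open>E\<close> is extension, and \<open>T n\<close> is the requirement met at
  stage \<open>Suc n\<close>. That a requirement persists later is left to \<open>E\<close>.\<close>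

lemma descending_sequence:
  assumes "P p" and "\<And>p n. P p \<Longrightarrow> \<exists>q. P q \<and> E p q \<and> T n q"
  obtains s :: "nat \<Rightarrow> 'p" where "s 0 = p" "\<And>n. P (s n)" "\<And>n. E (s n) (s (Suc n))" "\<And>n. T n (s (Suc n))"
proof -
  have "\<exists>s. \<forall>n. (P (s n) \<and> (n = 0 \<longrightarrow> s n = p)) \<and> (E (s n) (s (Suc n)) \<and> T n (s (Suc n)))"
    by (rule dependent_nat_choice) (use assms in auto)
  then show ?thesis using that by metis
qed

lemma limit_fun:
  fixes F :: "nat \<Rightarrow> nat set"
  assumes F: "\<And>n. F n \<subseteq> F (Suc n)" and agree: "\<And>n y. y \<in> F n \<Longrightarrow> g (Suc n) y = g n y"
  obtains h where "\<And>n y. y \<in> F n \<Longrightarrow> h y = g n y"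
proof -
  have mono: "F m \<subseteq> F n" if "m \<le> n" for m n
    using lift_Suc_mono_le[of F] F that by blast
  have agree': "g n y = g m y" if "m \<le> n" "y \<in> F m" for m n y
    using that(1)
  proof (induction n rule: dec_induct)
    case (step n) then show ?case using agree[of y n] mono[of m n] that(2) by auto
  qed simp
  define h where "h y = g (LEAST n. y \<in> F n) y" for y
  have "h y = g n y" if "y \<in> F n" for n y
    unfolding h_def by (rule agree'[symmetric], rule Least_le, rule that, rule LeastI, rule that)
  then show ?thesis by (rule that)
qed

text \<open>The isomorphism type of a pair of elements is coded by a natural number: \<open>0\<close> is the diagonal,
  so that preserving \<open>c\<close> entails injectivity, and \<open>1\<close> is the color with which free amalgamation
  fills in undetermined pairs.\<close>

locale free_homogeneous =
  fixes c :: "nat \<Rightarrow> nat \<Rightarrow> nat"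
  assumes c_sym: "c x y = c y x"
    and c_zero [simp]: "c x y = 0 \<longleftrightarrow> x = y"
    and homogeneous: "finite F \<Longrightarrow> (\<And>x y. x \<in> F \<Longrightarrow> y \<in> F \<Longrightarrow> c (f x) (f y) = c x y) \<Longrightarrow>
          \<exists>g\<in>col_aut c. \<forall>x\<in>F. g x = f x"
    and free_extension: "finite F \<Longrightarrow> finite N \<Longrightarrow> y \<notin> F \<Longrightarrow>
          \<exists>y'. (\<forall>z\<in>F. c y' z = c y z) \<and> (\<forall>z\<in>N - F. c y' z = 1)"
begin

abbreviation G :: "(nat \<Rightarrow> nat) set" where "G \<equiv> col_aut c"

lemma G_bij: "g \<in> G \<Longrightarrow> bij g"
  and G_c: "g \<in> G \<Longrightarrow> c (g x) (g y) = c x y"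
  by (auto simp: col_aut_def)

lemma G_eq_iff: "g \<in> G \<Longrightarrow> g x = g y \<longleftrightarrow> x = y"
  by (metis G_c c_zero)

lemma G_inv_f: "g \<in> G \<Longrightarrow> inv' g (g x) = x"
  and G_f_inv: "g \<in> G \<Longrightarrow> g (inv' g x) = x"
  by (auto simp: G_bij bij_is_inj bij_is_surj surj_f_inv_f)

lemma G_id [simp]: "id \<in> G" "(\<lambda>x. x) \<in> G"
  by (auto simp: col_aut_def id_def[symmetric])

lemma G_comp: "g \<in> G \<Longrightarrow> h \<in> G \<Longrightarrow> g \<circ> h \<in> G"
  by (auto simp: col_aut_def bij_comp)

lemmas G_simps = G_c G_eq_iff G_inv_f G_f_inv

lemma G_inv: "g \<in> G \<Longrightarrow> inv' g \<in> G"
  unfolding col_aut_def by (auto simp: bij_imp_bij_inv) (metis bij_inv_eq_iff)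

lemma one_neq: "c x y = 1 \<Longrightarrow> x \<noteq> y"
  by (metis c_zero one_neq_zero)

lemma G_comp_inv: "g \<in> G \<Longrightarrow> g \<circ> inv' g = id" "g \<in> G \<Longrightarrow> inv' g \<circ> g = id"
  by (auto simp: fun_eq_iff G_simps)

text \<open>Preservation of \<open>c\<close> passes to the limit, and the value \<open>0\<close> on
  the diagonal gives injectivity. Surjectivity is not automatic, hence the condition that every
  point enters the image of some \<open>F n\<close>.\<close>

lemma limit:
  assumes g: "\<And>n. g n \<in> G" and F: "\<And>n. F n \<subseteq> F (Suc n)"
    and agree: "\<And>n y. y \<in> F n \<Longrightarrow> g (Suc n) y = g n y"
    and dom: "\<And>y. \<exists>n. y \<in> F n" and ran: "\<And>y. \<exists>n. y \<in> g n ` F n"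
  obtains h where "h \<in> G" "\<And>n y. y \<in> F n \<Longrightarrow> h y = g n y"
proof -
  obtain h where h: "\<And>n y. y \<in> F n \<Longrightarrow> h y = g n y"
    by (rule limit_fun[of F g, OF F agree]) (assumption, rule that)
  have mono: "F m \<subseteq> F n" if "m \<le> n" for m n
    using lift_Suc_mono_le[of F] F that by blast
  have hc: "c (h x) (h y) = c x y" for x y
  proof -
    obtain m n where "x \<in> F m" "y \<in> F n" using dom by metis
    then have "x \<in> F (max m n)" "y \<in> F (max m n)" using mono[of m "max m n"] mono[of n "max m n"] by auto
    then show ?thesis using h G_c[OF g] by simp
  qed
  have "inj h" by (rule injI) (metis hc c_zero)
  moreover have "surj h" unfolding surj_def by (metis ran h imageE)
  ultimately have "h \<in> G" using hc by (auto simp: col_aut_def bij_def)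
  then show ?thesis using h that by blast
qed

section \<open>Involutions with a single fixed point\<close>

text \<open>Color \<open>1\<close> on \<open>{u y, y}\<close> already forbids
  \<open>u y = y\<close>, since \<open>c\<close> is \<open>0\<close> on the diagonal; so
  \<open>x\<close> is the only fixed point.\<close>

definition Invol :: "nat \<Rightarrow> (nat \<Rightarrow> nat) set" where
  "Invol x = {u \<in> G. (\<forall>y. u (u y) = y) \<and> u x = x \<and> (\<forall>y. y \<noteq> x \<longrightarrow> c (u y) y = 1)}"

text \<open>The rule \<open>c (u y) z = c y (u z)\<close> combines invariance of \<open>c\<close>
  with \<open>u (u z) = z\<close>. It turns a condition on \<open>u y\<close> into one on
  \<open>y\<close>.\<close>

lemma InvolD:
  assumes "u \<in> Invol x"
  shows "u \<in> G" "u (u y) = y" "u x = x" "y \<noteq> x \<Longrightarrow> c (u y) y = 1" "c (u y) z = c y (u z)"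
    "u y = x \<longleftrightarrow> y = x" "u y = y \<longleftrightarrow> y = x"
proof -
  show u: "u \<in> G" "u (u y) = y" "u x = x" "y \<noteq> x \<Longrightarrow> c (u y) y = 1"
    using assms unfolding Invol_def by blast+
  have "u (u z) = z" using assms unfolding Invol_def by blast
  then show "c (u y) z = c y (u z)" using u by (metis G_c)
  show "u y = x \<longleftrightarrow> y = x" using u by metis
  then show "u y = y \<longleftrightarrow> y = x"
    using u(3,4) one_neq by metis
qed

text \<open>No genericity of \<open>u\<close> and \<open>w\<close> is needed, because the color of every pair \<open>{y, u y}\<close> is \<open>1\<close>:
  a finite partial conjugation \<open>g\<close> extends to \<open>y\<close> and \<open>u y\<close> by homogeneity of \<open>c\<close> alone.\<close>

lemma Invol_conj:
  assumes u: "u \<in> Invol x" and w: "w \<in> Invol x"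
  obtains g where "g \<in> G" "g x = x" "\<And>y. g (u y) = w (g y)"
proof -
  note U = InvolD[OF u] note W = InvolD[OF w]
  define P where "P = (\<lambda>(g, F). g \<in> G \<and> finite F \<and> x \<in> F \<and> g x = x \<and>
    (\<forall>y\<in>F. u y \<in> F \<and> g (u y) = w (g y)))"
  define E where "E = (\<lambda>(g::nat\<Rightarrow>nat, F) (g', F'). F \<subseteq> F' \<and> (\<forall>y\<in>F. g' y = g y))"
  have step: "\<exists>g' F'. P (g', F') \<and> E (g, F) (g', F') \<and> y \<in> F' \<and> g' y = g y" if p: "P (g, F)" for g F y
  proof -
    have gF: "g \<in> G" "finite F" "x \<in> F" "g x = x" "\<And>y. y\<in>F \<Longrightarrow> u y \<in> F" "\<And>y. y\<in>F \<Longrightarrow> g (u y) = w (g y)"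
      using p unfolding P_def by auto
    show ?thesis
    proof (cases "y \<in> F")
      case True then show ?thesis using p by (auto simp: E_def)
    next
      case False
      \<comment> \<open>The value at \<open>y\<close> is kept and only \<open>u y\<close> is
        redirected.\<close>
      define f where "f = g(u y := w (g y))"
      note [simp] = G_simps[OF gF(1)]
      have uy: "u y \<notin> F" using False gF(5) U(2) by metis
      have yx: "y \<noteq> x" using False gF by auto
      have uyy: "u y \<noteq> y" using U(7) yx by blast
      have A: "c (w (g y)) (g d) = c (u y) d" if "d \<in> F" for d
      proof -
        have "c (w (g y)) (g d) = c (g y) (g (u d))" using W(5) gF(6)[OF that] by simp
        then show ?thesis using U(5) by simp
      qed
      have B: "c (w (g y)) (g y) = c (u y) y"
        using W(4)[of "g y"] U(4)[OF yx] yx gF(4) by (metis gF(1) G_eq_iff)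
      have "\<exists>g'\<in>G. \<forall>z\<in>insert y (insert (u y) F). g' z = f z"
      proof (rule homogeneous)
        fix a b assume ab: "a \<in> insert y (insert (u y) F)" "b \<in> insert y (insert (u y) F)"
        have fy: "f y = g y" "f (u y) = w (g y)" "\<And>z. z \<in> F \<Longrightarrow> f z = g z"
          using uy uyy by (auto simp: f_def)
        have "c (f a) (f b) = c a b" if "a = u y" "b \<noteq> u y" 
          using A B ab that fy by auto
        moreover have "c (f a) (f b) = c a b" if "b = u y" "a \<noteq> u y" 
          using A B ab that fy c_sym by (metis insertE)
        moreover have "c (f a) (f b) = c a b" if "b \<noteq> u y" "a \<noteq> u y" 
          using that by (simp add: f_def)
        ultimately show "c (f a) (f b) = c a b" using c_zero by metis
      qed (use gF in auto)
      then obtain g' where g': "g' \<in> G" "\<And>z. z\<in>insert y (insert (u y) F) \<Longrightarrow> g' z = f z" by blast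
      have g1: "g' y = g y" "g' (u y) = w (g y)" "\<And>z. z \<in> F \<Longrightarrow> g' z = g z"
        using g' uyy uy by (auto simp: f_def)
      have "P (g', insert y (insert (u y) F))"
        unfolding P_def using g'(1) gF(2-) g1 U(2)[of y] W(2)[of "g y"] by simp
      moreover have "E (g, F) (g', insert y (insert (u y) F))" using g1 by (auto simp: E_def)
      ultimately show ?thesis using g1(1) by blast
    qed
  qed
  have step2: "\<exists>q. P q \<and> E p q \<and> n \<in> snd q \<and> n \<in> fst q ` snd q" if p: "P p" for p n
  proof -
    obtain g F where g: "p = (g, F)" by force
    obtain g' F' where q: "P (g', F')" "E (g, F) (g', F')" "n \<in> F'" using step p g by blast
    \<comment> \<open>\<open>step\<close> keeps the value at the point it adds, so adding the
      preimage of \<open>n\<close> puts \<open>n\<close> into the range.\<close>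
    obtain h H where r: "P (h, H)" "E (g', F') (h, H)" "inv' g' n \<in> H" "h (inv' g' n) = g' (inv' g' n)"
      using step[OF q(1)] by blast
    have "g' \<in> G" using q by (auto simp: P_def)
    then have "h (inv' g' n) = n" using r G_f_inv by simp
    then have "n \<in> h ` H" using r by (metis imageI)
    moreover have "E (g, F) (h, H)" "n \<in> H" using q r by (auto simp: E_def)
    ultimately show ?thesis using r g by auto
  qed
  have "P (id, {x})" using U(3) W(3) by (simp add: P_def)
  then obtain s where s: "s 0 = (id, {x})" "\<And>n. P (s n)" "\<And>n. E (s n) (s (Suc n))"
    "\<And>n. n \<in> snd (s (Suc n)) \<and> n \<in> fst (s (Suc n)) ` snd (s (Suc n))"
    using descending_sequence[of P "(id, {x})" E "\<lambda>n q. n \<in> snd q \<and> n \<in> fst q ` snd q", OF _ step2]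
    by blast
  have PS: "fst (s n) \<in> G" "x \<in> snd (s n)" "fst (s n) x = x" "y \<in> snd (s n) \<Longrightarrow> u y \<in> snd (s n)"
    "y \<in> snd (s n) \<Longrightarrow> fst (s n) (u y) = w (fst (s n) y)" for n y
    using s(2)[of n] by (auto simp: P_def split: prod.splits)
  obtain h where h: "h \<in> G" "\<And>n y. y \<in> snd (s n) \<Longrightarrow> h y = fst (s n) y"
  proof (rule limit[of "\<lambda>n. fst (s n)" "\<lambda>n. snd (s n)"])
    show "snd (s n) \<subseteq> snd (s (Suc n))" for n using s(3)[of n] by (auto simp: E_def split: prod.splits)
    show "fst (s (Suc n)) y = fst (s n) y" if "y \<in> snd (s n)" for n y 
      using s(3)[of n] that by (auto simp: E_def split: prod.splits)
    show "\<exists>n. y \<in> snd (s n)" "\<exists>n. y \<in> fst (s n) ` snd (s n)" for y using s(4)[of y] by blast+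
  qed (blast intro: PS(1))+
  have "h (u y) = w (h y)" for y
    using h(2) PS s(4)[of y] by metis
  moreover have "h x = x" using h(2) PS by metis
  ultimately show ?thesis using h(1) that by blast
qed

text \<open>The color of \<open>{u y', w y'}\<close> is what \<open>free_extension\<close> cannot
  prescribe, since both ends depend on \<open>y'\<close>.\<close>

definition gen_pos :: "(nat \<Rightarrow> nat) \<Rightarrow> (nat \<Rightarrow> nat) \<Rightarrow> bool" where
  "gen_pos u w \<longleftrightarrow> (\<forall>F y. finite F \<longrightarrow> y \<notin> F \<longrightarrow> (\<exists>y'. (\<forall>z\<in>F. c y' z = c y z) \<and> c (u y') (w y') = 1))"

text \<open>\<open>gen_pos\<close> controls only the colors towards \<open>F\<close>. A point
  \<open>y1\<close> free from \<open>N - F\<close> is taken first, and general position is then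
  applied to the type of \<open>y1\<close> over \<open>F \<union> N\<close>.\<close>

lemma gen_pos_fresh:
  assumes "gen_pos u w" "finite F" "finite N" "y \<notin> F"
  obtains y' where "\<And>z. z \<in> F \<Longrightarrow> c y' z = c y z" "\<And>z. z \<in> N - F \<Longrightarrow> c y' z = 1" "c (u y') (w y') = 1"
proof -
  obtain y1 where y1: "\<forall>z\<in>F. c y1 z = c y z" "\<forall>z\<in>N - F. c y1 z = 1"
    using free_extension[OF assms(2-4)] by blast
  have "y1 \<notin> F \<union> N"
  proof
    assume "y1 \<in> F \<union> N"
    then have "c y y1 = 0 \<or> (0::nat) = 1" using y1 c_zero[of y1 y1] c_sym by (metis DiffI UnE one_neq)
    then show False using y1 \<open>y1 \<in> F \<union> N\<close> assms(4) c_zero one_neq by (metis DiffI UnE zero_neq_one)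
  qed
  then obtain y' where "\<forall>z\<in>F \<union> N. c y' z = c y1 z" "c (u y') (w y') = 1"
    using assms(1-3) unfolding gen_pos_def by (metis finite_UnI)
  then show ?thesis using y1 by (intro that[of y']) auto
qed

text \<open>A finite piece of a member of \<open>Invol x\<close>. Carrying a global
  \<open>p \<in> G\<close> gives meaning to \<open>p y\<close> for \<open>y\<close> outside
  \<open>D\<close>, where it shows the type that a partner of \<open>y\<close> must have over
  \<open>D\<close>.\<close>

definition pinv :: "nat \<Rightarrow> (nat \<Rightarrow> nat) \<Rightarrow> nat set \<Rightarrow> bool" where
  "pinv x p D \<longleftrightarrow> p \<in> G \<and> finite D \<and> x \<in> D \<and> p x = x \<and>
     (\<forall>y\<in>D. p y \<in> D \<and> p (p y) = y \<and> (y \<noteq> x \<longrightarrow> c (p y) y = 1))"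

lemma pinvD:
  assumes "pinv x p D"
  shows "p \<in> G" "finite D" "x \<in> D" "p x = x" "y \<in> D \<Longrightarrow> p y \<in> D" "y \<in> D \<Longrightarrow> p (p y) = y"
    "y \<in> D \<Longrightarrow> y \<noteq> x \<Longrightarrow> c (p y) y = 1" "p y \<in> D \<longleftrightarrow> y \<in> D"
proof -
  show *: "p \<in> G" "finite D" "x \<in> D" "p x = x" "y \<in> D \<Longrightarrow> p y \<in> D" "y \<in> D \<Longrightarrow> p (p y) = y"
    "y \<in> D \<Longrightarrow> y \<noteq> x \<Longrightarrow> c (p y) y = 1" for y
    using assms unfolding pinv_def by blast+
  have "y \<in> D" if "p y \<in> D"
    using *(5)[OF that] *(6)[OF that] G_eq_iff[OF *(1)] by simp
  then show "p y \<in> D \<longleftrightarrow> y \<in> D" using *(5) by blast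
qed

definition agree_on :: "(nat \<Rightarrow> nat) \<Rightarrow> nat set \<Rightarrow> (nat \<Rightarrow> nat) \<Rightarrow> nat set \<Rightarrow> bool" where
  "agree_on p D q D' \<longleftrightarrow> D \<subseteq> D' \<and> (\<forall>d\<in>D. q d = p d)"

lemma agree_on_refl: "agree_on p D p D" and agree_on_trans: "agree_on p D q D' \<Longrightarrow> agree_on q D' r D'' \<Longrightarrow> agree_on p D r D''"
  by (auto simp: agree_on_def)

text \<open>The point \<open>p y\<close> has the right type over \<open>D\<close>, but
  \<open>p\<close> need not send it back to \<open>y\<close>, nor need the pair have color
  \<open>1\<close>. The partner \<open>y1\<close> is a copy of \<open>p y\<close> over
  \<open>D\<close> that is free from \<open>y\<close> and \<open>N\<close>. Exchanging
  \<open>y\<close> and \<open>y1\<close> preserves colors because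
  \<open>c y1 d = c y (p d)\<close>.\<close>

lemma pinv_add:
  assumes p: "pinv x p D" and N: "finite N"
  obtains q D' where "pinv x q D'" "agree_on p D q D'" "y \<in> D'" "\<And>n. y \<notin> D \<Longrightarrow> n \<in> N - D \<Longrightarrow> c (q y) n = 1"
proof (cases "y \<in> D")
  case True
  show ?thesis by (rule that[of p D]) (use True p agree_on_refl in auto)
next
  case False
  note p' = pinvD[OF p]
  have "p y \<notin> D" using False p'(8) by blast
  then obtain y1 where y1: "\<And>z. z \<in> D \<Longrightarrow> c y1 z = c (p y) z" "\<And>z. z \<in> insert y N - D \<Longrightarrow> c y1 z = 1"
    using free_extension[of D "insert y N" "p y"] N p'(2) by blast
  have y1y: "c y1 y = 1" using y1 False by blast
  have "y1 \<noteq> y" using y1y one_neq by blast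
  have "y1 \<notin> D" using y1(1)[of y1] \<open>p y \<notin> D\<close> c_zero by metis
  define f where "f = p(y := y1, y1 := y)"
  have f: "f y = y1" "f y1 = y" "d \<in> D \<Longrightarrow> f d = p d" for d
    using \<open>y1 \<noteq> y\<close> \<open>y1 \<notin> D\<close> False by (auto simp: f_def)
  have A: "c (f y) (f d) = c y d" "c (f y1) (f d) = c y1 d" if "d \<in> D" for d
  proof -
    show "c (f y) (f d) = c y d" using f that y1(1)[of "p d"] p' G_c by metis
    show "c (f y1) (f d) = c y1 d" using f that y1(1)[OF that] p' G_c by metis
  qed
  let ?D = "insert y (insert y1 D)"
  have "\<exists>g\<in>G. \<forall>z\<in>?D. g z = f z"
  proof (rule homogeneous)
    fix a b assume ab: "a \<in> ?D" "b \<in> ?D"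
    have "c (f a) (f b) = c a b" if "a \<in> D" "b \<in> D" using that f p'(1) G_c by metis
    moreover have "c (f a) (f b) = c a b" if "a \<in> D" "b \<notin> D" using that f A c_sym ab(2) by (metis insertE)
    moreover have "c (f a) (f b) = c a b" if "a \<notin> D" "b \<in> D" using that f A ab(1) by (metis insertE)
    moreover have "c (f a) (f b) = c a b" if "a \<notin> D" "b \<notin> D"
      using that f c_sym ab c_zero by (metis insertE)
    ultimately show "c (f a) (f b) = c a b" by blast
  qed (use p' in auto)
  then obtain q where q: "q \<in> G" "\<And>z. z \<in> ?D \<Longrightarrow> q z = f z" by blast
  have q': "q y = y1" "q y1 = y" "d \<in> D \<Longrightarrow> q d = p d" for d using q f by auto
  have "pinv x q ?D" unfolding pinv_def
    using q(1) q' p' y1y c_sym[of y y1] by auto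
  moreover have "agree_on p D q ?D" using q' by (auto simp: agree_on_def)
  ultimately show ?thesis using y1(2) q'(1) that by auto
qed

text \<open>A realization \<open>y\<close> of the type of \<open>y0\<close> over \<open>F\<close> is
  chosen with \<open>y\<close> and \<open>u y\<close> outside \<open>D\<close>. Its partner is then
  still undecided and can be made free from \<open>u y\<close>.\<close>

lemma pinv_gen_pos:
  assumes p: "pinv x p D" and u: "u \<in> G" and F: "finite F" "y0 \<notin> F"
  obtains q D' y where "pinv x q D'" "agree_on p D q D'" "y \<in> D'" "\<And>z. z \<in> F \<Longrightarrow> c y z = c y0 z" "c (u y) (q y) = 1"
proof -
  note p' = pinvD[OF p]
  have "finite (D \<union> inv' u ` D)" using p' by auto
  then obtain y where y: "\<And>z. z \<in> F \<Longrightarrow> c y z = c y0 z" "\<And>z. z \<in> D \<union> inv' u ` D - F \<Longrightarrow> c y z = 1"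
    using free_extension[OF F(1) \<open>finite (D \<union> inv' u ` D)\<close> F(2)] by auto
  have yn: "y \<notin> D \<union> inv' u ` D"
    using y F(2) c_zero one_neq by (metis DiffI)
  then have yD: "y \<notin> D" "u y \<notin> D" using u G_inv_f by (auto, metis image_eqI)
  obtain q D' where q: "pinv x q D'" "agree_on p D q D'" "y \<in> D'" "c (q y) (u y) = 1"
    by (rule pinv_add[OF p, of "{u y}" y]) (use yD in auto)
  then show ?thesis using y(1) that c_sym by metis
qed

text \<open>Two permutations are treated at once because two given involutions are to be joined
  through a third; with \<open>id\<close> for both, this yields the existence of a member of
  \<open>Invol x\<close>.\<close>

lemma ex_Invol_gen_pos:
  assumes u: "u \<in> G" and w: "w \<in> G"
  obtains v where "v \<in> Invol x" "gen_pos u v" "gen_pos w v"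
proof -
  define P where "P = (\<lambda>(p, D). pinv x p D)"
  define E where "E = (\<lambda>(p, D) (q, D'). agree_on p D q D')"
  \<comment> \<open>Requirement \<open>n\<close> decodes to a type over a finite set, given by a
    list and a point \<open>y0\<close>. Its witness lies in \<open>D\<close>, where the values of
    \<open>p\<close> are final, so extensions keep it.\<close>
  define R where "R t n = (\<lambda>(p, D). case from_nat n :: nat list \<times> nat of (l, y0) \<Rightarrow> y0 \<notin> set l \<longrightarrow>
    (\<exists>y\<in>D. (\<forall>z\<in>set l. c y z = c y0 z) \<and> c (t y) (p y) = 1))" for t :: "nat \<Rightarrow> nat" and n
  have RE: "R t n q" if "R t n p" "E p q" for t n p q
    using that unfolding R_def E_def agree_on_def by (fastforce split: prod.splits)
  have step: "\<exists>q. P q \<and> E p q \<and> R t n q" if t: "t \<in> G" and p: "P p" for t n p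
  proof -
    obtain g D where gD: "p = (g, D)" "pinv x g D" using p by (auto simp: P_def)
    obtain l y0 where l: "(from_nat n :: nat list \<times> nat) = (l, y0)" by force
    show ?thesis
    proof (cases "y0 \<in> set l")
      case True then show ?thesis using p l agree_on_refl by (auto simp: gD E_def R_def)
    next
      case False
      obtain q D' y where "pinv x q D'" "agree_on g D q D'" "y \<in> D'" "\<And>z. z \<in> set l \<Longrightarrow> c y z = c y0 z" "c (t y) (q y) = 1"
        using pinv_gen_pos[OF gD(2) t finite_set False] by metis
      then show ?thesis using l by (intro exI[of _ "(q, D')"]) (auto simp: P_def E_def R_def gD)
    qed
  qed
  have step2: "\<exists>q. P q \<and> E p q \<and> n \<in> snd q \<and> R u n q \<and> R w n q" if p: "P p" for p n
  proof -
    obtain g D where gD: "p = (g, D)" "pinv x g D" using p by (auto simp: P_def)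
    obtain q D' where q: "pinv x q D'" "agree_on g D q D'" "n \<in> D'"
      by (rule pinv_add[OF gD(2) finite.emptyI, of n])
    have "P (q, D')" using q by (auto simp: P_def)
    obtain r where r: "P r" "E (q, D') r" "R u n r" using step[OF u \<open>P (q, D')\<close>] by blast
    obtain s where s: "P s" "E r s" "R w n s" using step[OF w r(1)] by blast
    have "E p s" using q(2) r(2) s(2) unfolding gD E_def by (auto intro: agree_on_trans split: prod.splits)
    moreover have "n \<in> snd s" using q(3) r(2) s(2) unfolding E_def agree_on_def by (auto split: prod.splits)
    ultimately show ?thesis using s RE[OF r(3) s(2)] by blast
  qed
  have "P (id, {x})" by (simp add: P_def pinv_def)
  then obtain s where s: "s 0 = (id, {x})" "\<And>n. P (s n)" "\<And>n. E (s n) (s (Suc n))"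
    "\<And>n. n \<in> snd (s (Suc n)) \<and> R u n (s (Suc n)) \<and> R w n (s (Suc n))"
    using descending_sequence[of P "(id, {x})" E "\<lambda>n q. n \<in> snd q \<and> R u n q \<and> R w n q", OF _ step2]
    by blast
  have PS: "pinv x (fst (s n)) (snd (s n))" for n
    using s(2)[of n] by (auto simp: P_def split: prod.splits)
  obtain v where v: "v \<in> G" "\<And>n y. y \<in> snd (s n) \<Longrightarrow> v y = fst (s n) y"
  proof (rule limit[of "\<lambda>n. fst (s n)" "\<lambda>n. snd (s n)"])
    show "fst (s n) \<in> G" for n using PS pinvD(1) by blast
    show "snd (s n) \<subseteq> snd (s (Suc n))" for n using s(3)[of n] by (auto simp: E_def agree_on_def split: prod.splits)
    show "fst (s (Suc n)) y = fst (s n) y" if "y \<in> snd (s n)" for n y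
      using s(3)[of n] that by (auto simp: E_def agree_on_def split: prod.splits)
    show "\<exists>n. y \<in> snd (s n)" for y using s(4) by blast
    show "\<exists>n. y \<in> fst (s n) ` snd (s n)" for y
      using s(4)[of y] pinvD(5,6)[OF PS[of "Suc y"], of y] by (metis imageI)
  qed blast
  have "v \<in> Invol x" unfolding Invol_def
  proof (intro CollectI conjI allI impI)
    fix y
    have y: "y \<in> snd (s (Suc y))" using s(4) by blast
    note S = pinvD[OF PS[of "Suc y"]]
    show "v (v y) = y" using v(2) S(5,6) y by metis
    show "c (v y) y = 1" if "y \<noteq> x" using v(2) S(7) y that by metis
    show "v x = x" using v(2) S(3,4) by metis
  qed (rule v)
  moreover have "gen_pos t v" if t: "\<And>n. R t n (s (Suc n))" for t
    unfolding gen_pos_def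
  proof (intro allI impI)
    fix F and y0 :: nat assume "finite F" "y0 \<notin> F"
    then obtain l where l: "set l = F" using finite_list by blast
    define n where "n = to_nat (l, y0)"
    have "(from_nat n :: nat list \<times> nat) = (l, y0)" by (simp add: n_def)
    then obtain y where "y \<in> snd (s (Suc n))" "\<forall>z\<in>F. c y z = c y0 z" "c (t y) (fst (s (Suc n)) y) = 1"
      using t[of n] \<open>y0 \<notin> F\<close> l by (auto simp: R_def split: prod.splits)
    then show "\<exists>y. (\<forall>z\<in>F. c y z = c y0 z) \<and> c (t y) (v y) = 1" using v(2) by metis
  qed
  ultimately show ?thesis using s(4) by (intro that[of v]) blast+
qed

text \<open>The copy \<sigma> is twisted by \<open>p\<close>: since
  \<open>c (\<sigma> s) (p d) = c s d\<close>, the map that is \<open>p\<close> on \<open>D\<close>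
  and \<sigma> on \<open>S\<close> is a partial isomorphism. Color \<open>1\<close> between the copy
  and its image under \<open>w\<close> will allow a second map, commuting with \<open>w\<close>, to
  be prescribed on the copy. The induction adds one orbit \<open>{s, u s}\<close> of
  \<open>u\<close> at a time.\<close>

lemma free_copy_Invol:
  assumes u: "u \<in> Invol x" and w: "w \<in> Invol x" and uw: "gen_pos u w"
    and p: "p \<in> G" and D: "finite D" "x \<in> D" "\<And>d. d \<in> D \<Longrightarrow> u d \<in> D" "\<And>d. d \<in> D \<Longrightarrow> p d \<in> D"
    "\<And>d. d \<in> D \<Longrightarrow> p (u d) = u (p d)" "\<And>d. d \<in> D \<Longrightarrow> p (p d) = d"
    and N: "finite N" "w ` D \<subseteq> N"
    and S: "finite S" "\<And>s. s \<in> S \<Longrightarrow> u s \<in> S" "S \<inter> D = {}"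
  shows "\<exists>\<sigma>. (\<forall>s\<in>S. \<sigma> (u s) = u (\<sigma> s)) \<and> (\<forall>s\<in>S. \<forall>d\<in>D. c (\<sigma> s) (p d) = c s d) \<and>
     (\<forall>s\<in>S. \<forall>t\<in>S. c (\<sigma> s) (\<sigma> t) = c s t) \<and> (\<forall>s\<in>S. \<forall>n\<in>N - D. c (\<sigma> s) n = 1) \<and>
     (\<forall>s\<in>S. \<forall>t\<in>S. c (\<sigma> s) (w (\<sigma> t)) = 1)"
  using S
proof (induction S rule: finite_psubset_induct)
  case (psubset S)
  note U = InvolD[OF u] note W = InvolD[OF w]
  show ?case
  proof (cases "S = {}")
    case True then show ?thesis by simp
  next
    case False
    then obtain s where s: "s \<in> S" by blast
    define S1 where "S1 = S - {s, u s}"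
    have us: "u s \<in> S" using psubset.prems s by blast
    have sx: "s \<noteq> x" using s psubset.prems(2) D(2) by blast
    have sus: "u s \<noteq> s" using sx U(7) by blast
    have S1: "S = insert s (insert (u s) S1)" "s \<notin> S1" "u s \<notin> S1" using s us by (auto simp: S1_def)
    have S1u: "u t \<in> S1" if "t \<in> S1" for t
      using that psubset.prems(1) U(2) unfolding S1_def by (metis DiffD1 DiffD2 DiffI insertE insertI1 insertI2 singletonD)
    have S1D: "S1 \<inter> D = {}" using psubset.prems(2) by (auto simp: S1_def)
    have S1f: "finite S1" using psubset.hyps by (simp add: S1_def)
    have "S1 \<subset> S" using s by (auto simp: S1_def)
    from psubset.IH[OF this S1u S1D] obtain \<sigma> where
      c1: "\<And>t. t \<in> S1 \<Longrightarrow> \<sigma> (u t) = u (\<sigma> t)" and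
      c2: "\<And>t d. t \<in> S1 \<Longrightarrow> d \<in> D \<Longrightarrow> c (\<sigma> t) (p d) = c t d" and
      c3: "\<And>t t'. t \<in> S1 \<Longrightarrow> t' \<in> S1 \<Longrightarrow> c (\<sigma> t) (\<sigma> t') = c t t'" and
      c4: "\<And>t n. t \<in> S1 \<Longrightarrow> n \<in> N - D \<Longrightarrow> c (\<sigma> t) n = 1" and
      c5: "\<And>t t'. t \<in> S1 \<Longrightarrow> t' \<in> S1 \<Longrightarrow> c (\<sigma> t) (w (\<sigma> t')) = 1" by blast
    have sD: "\<sigma> t \<notin> D" if "t \<in> S1" for t
    proof
      assume "\<sigma> t \<in> D"
      then have "p (\<sigma> t) \<in> D" "p (p (\<sigma> t)) = \<sigma> t" using D by auto
      then have "c t (p (\<sigma> t)) = 0" using c2[OF that, of "p (\<sigma> t)"] c_zero by metis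
      then have "t = p (\<sigma> t)" by simp
      then show False using \<open>p (\<sigma> t) \<in> D\<close> that S1D by auto
    qed
    have sN: "\<sigma> t \<notin> N" if "t \<in> S1" for t
      using c4[OF that, of "\<sigma> t"] sD[OF that] one_neq by blast
    have wsD: "w (\<sigma> t) \<notin> D" if "t \<in> S1" for t
      using sN[OF that] N(2) W(2) by (metis image_subset_iff)
    have wsS: "w (\<sigma> t) \<noteq> \<sigma> t'" if "t \<in> S1" "t' \<in> S1" for t t'
      using c5[OF that(2,1)] one_neq by metis
    define f where "f z = (if z \<in> D then p z else \<sigma> z)" for z
    have fs: "f z = \<sigma> z" if "z \<in> S1" for z using that S1D by (auto simp: f_def)
    have fD: "f z = p z" if "z \<in> D" for z using that by (auto simp: f_def)
    have "\<exists>g\<in>G. \<forall>z\<in>D \<union> S1. g z = f z"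
    proof (rule homogeneous)
      fix a b assume "a \<in> D \<union> S1" "b \<in> D \<union> S1"
      then consider "a \<in> D" "b \<in> D" | "a \<in> D" "b \<in> S1" | "a \<in> S1" "b \<in> D" | "a \<in> S1" "b \<in> S1" by blast
      then show "c (f a) (f b) = c a b"
      proof cases
        case 1 then show ?thesis using fD G_c[OF p] by simp
      next
        case 2 then show ?thesis using fD fs c2 c_sym by metis
      next
        case 3 then show ?thesis using fD fs c2 by simp
      next
        case 4 then show ?thesis using fs c3 by simp
      qed
    qed (use D S1f in simp)
    then obtain g where g: "g \<in> G" "\<And>z. z \<in> D \<Longrightarrow> g z = p z" "\<And>z. z \<in> S1 \<Longrightarrow> g z = \<sigma> z"
      using fs fD by (metis UnCI)
    have gs: "g s \<notin> D \<union> \<sigma> ` S1"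
    proof
      assume "g s \<in> D \<union> \<sigma> ` S1"
      then consider "g s \<in> D" | t where "t \<in> S1" "g s = \<sigma> t" by auto
      then show False
      proof cases
        case 1
        then have "g s = g (p (g s))" using g(2) D by metis
        then have "s \<in> D" using G_eq_iff[OF g(1)] D 1 by metis
        then show False using s psubset.prems(2) by blast
      next
        case 2
        then show False using g(3) G_eq_iff[OF g(1)] S1(2) by metis
      qed
    qed
    \<comment> \<open>Colors from \<open>u s'\<close> to \<open>n\<close> are colors from
      \<open>s'\<close> to \<open>u n\<close>, so the images under \<open>u\<close> of the sets to
      be avoided are included.\<close>
    define N' where "N' = N \<union> u ` N \<union> w ` \<sigma> ` S1 \<union> u ` w ` \<sigma> ` S1"
    obtain s' where s': "\<And>z. z \<in> D \<union> \<sigma> ` S1 \<Longrightarrow> c s' z = c (g s) z" "\<And>z. z \<in> N' - (D \<union> \<sigma> ` S1) \<Longrightarrow> c s' z = 1"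
       "c (u s') (w s') = 1"
      using gen_pos_fresh[OF uw, of "D \<union> \<sigma> ` S1" N' "g s"] gs D(1) S1f N(1) unfolding N'_def by blast
    have d1: "c s' (p d) = c s d" if "d \<in> D" for d
      using s'(1)[of "p d"] D(4)[OF that] g(2)[OF that] G_c[OF g(1), of s d] by simp
    have d2: "c s' (\<sigma> t) = c s t" if "t \<in> S1" for t
      using s'(1)[of "\<sigma> t"] g(3)[OF that] that G_c[OF g(1), of s t] by simp
    have d3: "c s' n = 1" if "n \<in> N - D" for n
      using s'(2)[of n] sN that unfolding N'_def by auto
    have d4: "c s' (w (\<sigma> t)) = 1" if "t \<in> S1" for t
      using s'(2)[of "w (\<sigma> t)"] wsD[OF that] wsS[OF that] that unfolding N'_def by auto
    have e1: "c (u s') (p d) = c (u s) d" if "d \<in> D" for d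
      using d1[of "u d"] D(3,5)[OF that] U(5)[of s'] U(5)[of s] by simp
    have e2: "c (u s') (\<sigma> t) = c (u s) t" if "t \<in> S1" for t
      using d2[of "u t"] S1u[OF that] c1[OF that] U(5)[of s'] U(5)[of s] by simp
    have e3: "c (u s') n = 1" if "n \<in> N - D" for n
    proof -
      have "u n \<notin> D" using that D(3) U(2) by (metis DiffE)
      moreover have "u n \<notin> \<sigma> ` S1" using sN S1u c1 U(2) that by (metis DiffE imageE)
      ultimately have "c s' (u n) = 1" using s'(2)[of "u n"] that unfolding N'_def by auto
      then show ?thesis using U(5) by simp
    qed
    have e4: "c (u s') (w (\<sigma> t)) = 1" if "t \<in> S1" for t
    proof -
      have "u (w (\<sigma> t)) \<notin> D" using wsD[OF that] D(3) U(2) by metis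
      moreover have "u (w (\<sigma> t)) \<notin> \<sigma> ` S1" using wsS[OF that] S1u c1 U(2) by (metis imageE)
      ultimately have "c s' (u (w (\<sigma> t))) = 1" using s'(2)[of "u (w (\<sigma> t))"] that unfolding N'_def by auto
      then show ?thesis using U(5) by simp
    qed
    have s'x: "s' \<noteq> x"
    proof
      assume "s' = x"
      then have "c s' (p (p s')) = 0" using D(2,6) c_zero by metis
      then have "c s (p s') = 0" using d1[of "p s'"] D(2,4) \<open>s' = x\<close> by metis
      then have "s \<in> D" using D(2,4) \<open>s' = x\<close> by auto
      then show False using s psubset.prems(2) by blast
    qed
    have f1: "c s' (u s') = 1" "c s (u s) = 1" "c s' (w s') = 1" "c (u s') (w (u s')) = 1"
      using U(4)[OF s'x] U(4)[OF sx] W(4)[OF s'x] W(4)[of "u s'"] U(6) s'x c_sym by metis+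
    \<comment> \<open>General position is spent here:
      \<open>c s' (w (u s')) = c (w s') (u s')\<close>, a pair whose ends both depend on
      \<open>s'\<close>.\<close>
    have f2: "c s' (w (u s')) = 1" using s'(3) W(5) c_sym by metis
    define \<tau> where "\<tau> z = (if z \<in> S1 then \<sigma> z else if z = s then s' else u s')" for z
    have t: "\<tau> s = s'" "\<tau> (u s) = u s'" "\<And>z. z \<in> S1 \<Longrightarrow> \<tau> z = \<sigma> z"
      using S1 sus by (auto simp: \<tau>_def)
    have sy: "c (\<sigma> t) z = c z (\<sigma> t)" "c (\<sigma> t) (w z) = c z (w (\<sigma> t))" for z t
      using c_sym W(5) by metis+
    have "(\<forall>s\<in>S. \<tau> (u s) = u (\<tau> s))" using t S1u c1 U(2) by (simp add: S1(1))
    moreover have "\<forall>s\<in>S. \<forall>d\<in>D. c (\<tau> s) (p d) = c s d" using d1 e1 c2 t by (simp add: S1(1))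
    moreover have "\<forall>s\<in>S. \<forall>n\<in>N - D. c (\<tau> s) n = 1" using d3 e3 c4 t by (simp add: S1(1))
    moreover have "\<forall>a\<in>S. \<forall>b\<in>S. c (\<tau> a) (\<tau> b) = c a b"
    proof -
      have "c (\<tau> a) (\<tau> b) = c a b" if "a \<in> S1" "b \<in> S1" for a b using that c3 t by simp
      moreover have "c (\<tau> s) (\<tau> b) = c s b" "c (\<tau> b) (\<tau> s) = c b s" if "b \<in> S1" for b
        using that d2 t c_sym by metis+
      moreover have "c (\<tau> (u s)) (\<tau> b) = c (u s) b" "c (\<tau> b) (\<tau> (u s)) = c b (u s)" if "b \<in> S1" for b
        using that e2 t c_sym by metis+
      moreover have "c (\<tau> s) (\<tau> (u s)) = c s (u s)" "c (\<tau> (u s)) (\<tau> s) = c (u s) s" "c (\<tau> s) (\<tau> s) = c s s"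
         "c (\<tau> (u s)) (\<tau> (u s)) = c (u s) (u s)"
        using f1 t c_sym c_zero by metis+
      ultimately show ?thesis by (simp add: S1(1))
    qed
    moreover have "\<forall>a\<in>S. \<forall>b\<in>S. c (\<tau> a) (w (\<tau> b)) = 1"
    proof -
      have "c (\<tau> a) (w (\<tau> b)) = 1" if "a \<in> S1" "b \<in> S1" for a b using that c5 t by simp
      moreover have "c (\<tau> s) (w (\<tau> b)) = 1" "c (\<tau> b) (w (\<tau> s)) = 1" if "b \<in> S1" for b
        using that d4 t sy by metis+
      moreover have "c (\<tau> (u s)) (w (\<tau> b)) = 1" "c (\<tau> b) (w (\<tau> (u s))) = 1" if "b \<in> S1" for b
        using that e4 t sy by metis+
      moreover have "c (\<tau> s) (w (\<tau> (u s))) = 1" "c (\<tau> (u s)) (w (\<tau> s)) = 1" "c (\<tau> s) (w (\<tau> s)) = 1"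
         "c (\<tau> (u s)) (w (\<tau> (u s))) = 1"
        using f1 f2 t s'(3) by metis+
      ultimately show ?thesis by (simp add: S1(1))
    qed
    ultimately show ?thesis by blast
  qed
qed

section \<open>Paths of commuting involutions between two in general position\<close>

definition pcomm :: "(nat \<Rightarrow> nat) \<Rightarrow> nat \<Rightarrow> (nat \<Rightarrow> nat) \<Rightarrow> nat set \<Rightarrow> bool" where
  "pcomm u x p D \<longleftrightarrow> pinv x p D \<and> (\<forall>d\<in>D. u d \<in> D \<and> p (u d) = u (p d))"

text \<open>For maps that satisfy \<open>pinv\<close>, the overlap \<open>D \<inter> E\<close> is
  invariant under both, and they commute there. Points outside carry no condition, but every point
  reaches the overlap at a late stage.\<close>

definition square :: "(nat \<Rightarrow> nat) \<Rightarrow> nat set \<Rightarrow> (nat \<Rightarrow> nat) \<Rightarrow> nat set \<Rightarrow> bool" where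
  "square p D q E \<longleftrightarrow> (\<forall>y\<in>D \<inter> E. p y \<in> E \<and> q y \<in> D \<and> p (q y) = q (p y))"

lemma square_sym: "square p D q E \<Longrightarrow> square q E p D"
  by (auto simp: square_def)

lemma gen_pos_sym: "gen_pos u w \<Longrightarrow> gen_pos w u"
  unfolding gen_pos_def using c_sym by metis

lemma partial_isoI:
  assumes "finite A" "finite B" "finite C"
    and "\<And>a b. a \<in> A \<Longrightarrow> b \<in> A \<Longrightarrow> c (f a) (f b) = c a b"
    and "\<And>a b. a \<in> A \<Longrightarrow> b \<in> B \<Longrightarrow> c (f a) (f b) = c a b"
    and "\<And>a b. a \<in> A \<Longrightarrow> b \<in> C \<Longrightarrow> c (f a) (f b) = c a b"
    and "\<And>a b. a \<in> B \<Longrightarrow> b \<in> B \<Longrightarrow> c (f a) (f b) = c a b"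
    and "\<And>a b. a \<in> B \<Longrightarrow> b \<in> C \<Longrightarrow> c (f a) (f b) = c a b"
    and "\<And>a b. a \<in> C \<Longrightarrow> b \<in> C \<Longrightarrow> c (f a) (f b) = c a b"
  obtains g where "g \<in> G" "\<And>z. z \<in> A \<union> B \<union> C \<Longrightarrow> g z = f z"
proof -
  have "\<exists>g\<in>G. \<forall>z\<in>A \<union> B \<union> C. g z = f z"
  proof (rule homogeneous)
    show "c (f a) (f b) = c a b" if "a \<in> A \<union> B \<union> C" "b \<in> A \<union> B \<union> C" for a b
      using that assms(4-9)[of a b] assms(4-9)[of b a] c_sym[of a b] c_sym[of "f a" "f b"] by auto
  qed (use assms in simp)
  then show ?thesis using that by blast
qed

text \<open>To add \<open>y\<close> to \<open>D\<close>, all of \<open>E\<close> is added with it. The set \<open>S\<close> of new points is sent by the new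
  \<open>p'\<close> to a free copy \<open>\<sigma> S\<close>, and \<open>q'\<close> is transported along \<open>\<sigma>\<close> to the copy \<open>T\<close> of \<open>E - D\<close>
  and to \<open>w T\<close>.\<close>

lemma square_add:
  assumes u: "u \<in> Invol x" and w: "w \<in> Invol x" and uw: "gen_pos u w"
    and pD: "pcomm u x p D" and qE: "pcomm w x q E" and sq: "square p D q E"
  obtains p' D' q' E' where "pcomm u x p' D'" "pcomm w x q' E'" "square p' D' q' E'"
    "agree_on p D p' D'" "agree_on q E q' E'" "y \<in> D'"
proof -
  note U = InvolD[OF u] note W = InvolD[OF w]
  have P: "p \<in> G" "finite D" "x \<in> D" "p x = x" "\<And>y. y \<in> D \<Longrightarrow> p y \<in> D" "\<And>y. y \<in> D \<Longrightarrow> p (p y) = y"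
    "\<And>y. y \<in> D \<Longrightarrow> y \<noteq> x \<Longrightarrow> c (p y) y = 1" "\<And>y. p y \<in> D \<longleftrightarrow> y \<in> D"
    "\<And>d. d \<in> D \<Longrightarrow> u d \<in> D" "\<And>d. d \<in> D \<Longrightarrow> p (u d) = u (p d)"
    using pD pinvD[of x p D] unfolding pcomm_def by blast+
  have Q: "q \<in> G" "finite E" "x \<in> E" "q x = x" "\<And>y. y \<in> E \<Longrightarrow> q y \<in> E" "\<And>y. y \<in> E \<Longrightarrow> q (q y) = y"
    "\<And>y. y \<in> E \<Longrightarrow> y \<noteq> x \<Longrightarrow> c (q y) y = 1" "\<And>y. q y \<in> E \<longleftrightarrow> y \<in> E"
    "\<And>d. d \<in> E \<Longrightarrow> w d \<in> E" "\<And>d. d \<in> E \<Longrightarrow> q (w d) = w (q d)"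
    using qE pinvD[of x q E] unfolding pcomm_def by blast+
  have SQ: "p e \<in> E" "q e \<in> D" "p (q e) = q (p e)" if "e \<in> D" "e \<in> E" for e
    using sq that unfolding square_def by blast+
  have qED: "q e \<in> E - D" if "e \<in> E - D" for e
  proof -
    have "q e \<in> E" "q (q e) = e" using that Q by auto
    then show ?thesis using SQ(2)[of "q e"] that by auto
  qed
  \<comment> \<open>Including all of \<open>E\<close> means that \<open>p'\<close> is decided on
    every old point of \<open>E\<close>, so that the new overlap \<open>D' \<inter> E'\<close> is
    exactly \<open>E \<union> T\<close>.\<close>
  define S where "S = (E \<union> u ` E \<union> {y, u y}) - D"
  define N where "N = D \<union> E \<union> S \<union> w ` (D \<union> E \<union> S)"
  have Sf: "finite S" using Q(2) by (simp add: S_def)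
  have Su: "u s \<in> S" if "s \<in> S" for s
  proof -
    have "u s \<notin> D" using that P(9)[of "u s"] U(2)[of s] by (auto simp: S_def)
    then show ?thesis using that U(2) by (auto simp: S_def)
  qed
  have SD: "S \<inter> D = {}" and ES: "E - D \<subseteq> S" and ES': "\<And>e. e \<in> E \<Longrightarrow> e \<notin> D \<Longrightarrow> e \<in> S"
    by (auto simp: S_def)
  have Nf: "finite N" "w ` D \<subseteq> N" using Sf P(2) Q(2) by (auto simp: N_def)
  obtain \<sigma> where k1: "\<And>s. s \<in> S \<Longrightarrow> \<sigma> (u s) = u (\<sigma> s)" and
    k2: "\<And>s d. s \<in> S \<Longrightarrow> d \<in> D \<Longrightarrow> c (\<sigma> s) (p d) = c s d" and
    k3: "\<And>s t. s \<in> S \<Longrightarrow> t \<in> S \<Longrightarrow> c (\<sigma> s) (\<sigma> t) = c s t" and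
    k4: "\<And>s n. s \<in> S \<Longrightarrow> n \<in> N - D \<Longrightarrow> c (\<sigma> s) n = 1" and
    k5: "\<And>s t. s \<in> S \<Longrightarrow> t \<in> S \<Longrightarrow> c (\<sigma> s) (w (\<sigma> t)) = 1"
    using free_copy_Invol[OF u w uw P(1-3) P(9) P(5) P(10) P(6) Nf Sf Su SD] by blast
  have k2': "c (\<sigma> s) d = c s (p d)" if "s \<in> S" "d \<in> D" for s d
    using k2[OF that(1) P(5)[OF that(2)]] P(6)[OF that(2)] by simp
  have sD: "\<sigma> s \<notin> D" if "s \<in> S" for s
  proof
    assume *: "\<sigma> s \<in> D"
    then have "c s (p (\<sigma> s)) = 0" using k2'[OF that *] c_zero by metis
    then show False using P(5)[OF *] that SD by auto
  qed
  have sN: "\<sigma> s \<notin> N" if "s \<in> S" for s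
    using k4[OF that, of "\<sigma> s"] sD[OF that] one_neq by blast
  have wsD: "w (\<sigma> s) \<notin> D \<union> E \<union> S" if "s \<in> S" for s
    using sN[OF that] W(2) unfolding N_def by (metis UnI2 image_eqI)
  have wss: "w (\<sigma> s) \<noteq> \<sigma> t" if "s \<in> S" "t \<in> S" for s t
    using k5[OF that(2,1)] one_neq by metis
  have sinj: "s = t" if "\<sigma> s = \<sigma> t" "s \<in> S" "t \<in> S" for s t
    using k3[OF that(2,3)] that(1) c_zero by metis
  define \<tau> where "\<tau> = inv_into S \<sigma>"
  have \<tau>: "\<tau> (\<sigma> s) = s" if "s \<in> S" for s
    using that sinj unfolding \<tau>_def by (intro inv_into_f_f inj_onI) auto
  have sE: "\<sigma> s \<notin> E" "\<sigma> s \<notin> S" if "s \<in> S" for s using sN[OF that] by (auto simp: N_def)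
  have sx: "s \<noteq> x" if "s \<in> S" for s using that SD P(3) by blast
  have kS: "c (\<sigma> s) t = 1" if "s \<in> S" "t \<in> S" for s t
    using k4[OF that(1), of t] that(2) SD by (auto simp: N_def)

  \<comment> \<open>\<open>p'\<close> exchanges \<open>S\<close> with its copy. All pairs between
    the two sets have color \<open>1\<close>, which gives the involution condition and also the
    invariance of these colors.\<close>
  define f where "f z = (if z \<in> D then p z else if z \<in> S then \<sigma> z else \<tau> z)" for z
  have fD: "f z = p z" if "z \<in> D" for z using that by (simp add: f_def)
  have fS: "f z = \<sigma> z" if "z \<in> S" for z using that SD by (auto simp: f_def)
  have fs: "f (\<sigma> z) = z" if "z \<in> S" for z using that sD sE \<tau> by (simp add: f_def)
  obtain p' where p': "p' \<in> G" "\<And>z. z \<in> D \<union> S \<union> \<sigma> ` S \<Longrightarrow> p' z = f z"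
  proof (rule partial_isoI[of D S "\<sigma> ` S" f])
    show "c (f a) (f b) = c a b" if "a \<in> D" "b \<in> D" for a b using that fD G_c[OF P(1)] by simp
    show "c (f a) (f b) = c a b" if "a \<in> D" "b \<in> S" for a b using that fD fS k2 c_sym by metis
    show "c (f a) (f b) = c a b" if ab: "a \<in> D" "b \<in> \<sigma> ` S" for a b
    proof -
      obtain s where "b = \<sigma> s" "s \<in> S" using ab(2) by blast
      then show ?thesis using ab(1) fD fs k2' c_sym by metis
    qed
    show "c (f a) (f b) = c a b" if "a \<in> S" "b \<in> S" for a b using that fS k3 by simp
    show "c (f a) (f b) = c a b" if ab: "a \<in> S" "b \<in> \<sigma> ` S" for a b
    proof -
      obtain s where "b = \<sigma> s" "s \<in> S" using ab(2) by blast
      then show ?thesis using ab(1) fS fs kS c_sym by metis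
    qed
    show "c (f a) (f b) = c a b" if "a \<in> \<sigma> ` S" "b \<in> \<sigma> ` S" for a b using that fs k3 by auto
  qed (use P(2) Sf in auto)
  define D' where "D' = D \<union> S \<union> \<sigma> ` S"
  have p'D: "p' z = p z" if "z \<in> D" for z using that p' fD by simp
  have p'S: "p' z = \<sigma> z" if "z \<in> S" for z using that p' fS by simp
  have p's: "p' (\<sigma> z) = z" if "z \<in> S" for z using that p' fs by simp
  have "pcomm u x p' D'"
    unfolding pcomm_def pinv_def
  proof (intro conjI ballI)
    show "p' \<in> G" "finite D'" "x \<in> D'" using p' P Sf by (auto simp: D'_def)
    show "p' x = x" using p'D P by simp
    fix d assume "d \<in> D'"
    then consider "d \<in> D" | "d \<in> S" | s where "s \<in> S" "d = \<sigma> s" unfolding D'_def by blast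
    then have "p' d \<in> D' \<and> p' (p' d) = d \<and> (d \<noteq> x \<longrightarrow> c (p' d) d = 1) \<and> u d \<in> D' \<and> p' (u d) = u (p' d)"
    proof cases
      case 1 then show ?thesis using p'D P(5-7,9,10) by (simp add: D'_def)
    next
      case 2 then show ?thesis using p'S p's Su k1 kS by (simp add: D'_def)
    next
      case 3 
      have "u (\<sigma> s) \<in> \<sigma> ` S" using k1[OF 3(1)] Su[OF 3(1)] by (metis imageI)
      moreover have "p' (u (\<sigma> s)) = u s" using p's[OF Su[OF 3(1)]] k1[OF 3(1)] by simp
      moreover have "c s (\<sigma> s) = 1" using kS[OF 3(1) 3(1)] c_sym by metis
      ultimately show ?thesis using 3 p'S p's by (simp add: D'_def)
    qed
    then show "p' d \<in> D'" "p' (p' d) = d" "d \<noteq> x \<longrightarrow> c (p' d) d = 1" "u d \<in> D'" "p' (u d) = u (p' d)"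
      by blast+
  qed
  define T where "T = \<sigma> ` (E - D)"
  have TE: "t \<notin> E" "w t \<notin> E" "w t \<notin> T" if "t \<in> T" for t
    using that sE wsD wss ES unfolding T_def by blast+
  define h where "h z = (if z \<in> E then q z else if z \<in> T then \<sigma> (q (\<tau> z)) else w (\<sigma> (q (\<tau> (w z)))))" for z
  have hE: "h z = q z" if "z \<in> E" for z using that by (simp add: h_def)
  have hT: "h (\<sigma> z) = \<sigma> (q z)" if "z \<in> E - D" for z
    using that TE(1)[of "\<sigma> z"] \<tau>[of z] ES by (auto simp: h_def T_def)
  have hwT: "h (w (\<sigma> z)) = w (\<sigma> (q z))" if "z \<in> E - D" for z
  proof -
    have "\<sigma> z \<in> T" using that by (simp add: T_def)
    then show ?thesis using TE(2,3)[of "\<sigma> z"] \<tau>[of z] ES W(2) that by (auto simp: h_def)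
  qed
  \<comment> \<open>For \<open>e\<close> in \<open>D\<close>, the colors of \<sigma> are governed by
    \<open>p\<close>, and the square relation moves \<open>q\<close> past \<open>p\<close>. For
    \<open>e\<close> outside \<open>D\<close>, both colors are \<open>1\<close>.\<close>
  have TEc: "c (\<sigma> (q s)) (q e) = c (\<sigma> s) e" if s: "s \<in> E - D" and e: "e \<in> E" for s e
  proof (cases "e \<in> D")
    case True
    have "c (\<sigma> (q s)) (q e) = c (q s) (p (q e))" using k2'[of "q s" "q e"] SQ(2)[OF True e] qED[OF s] by (simp add: ES')
    also have "\<dots> = c s (p e)" using SQ(3)[OF True e] G_c[OF Q(1)] by simp
    also have "\<dots> = c (\<sigma> s) e" using k2'[of s e] True s by (simp add: ES')
    finally show ?thesis .
  next
    case False
    then show ?thesis using kS[of s e] kS[of "q s" "q e"] s e qED[of s] qED[of e] by (simp add: ES')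
  qed
  obtain q' where q': "q' \<in> G" "\<And>z. z \<in> E \<union> T \<union> w ` T \<Longrightarrow> q' z = h z"
  proof (rule partial_isoI[of E T "w ` T" h])
    show "c (h a) (h b) = c a b" if ab: "a \<in> E" "b \<in> E" for a b using that hE G_c[OF Q(1)] by simp
    show "c (h a) (h b) = c a b" if ab: "a \<in> E" "b \<in> T" for a b 
    proof -
      obtain s where s: "b = \<sigma> s" "s \<in> E - D" using ab by (auto simp: T_def)
      then show ?thesis using ab(1) hE hT TEc c_sym by metis
    qed
    show "c (h a) (h b) = c a b" if ab: "a \<in> E" "b \<in> w ` T" for a b
    proof -
      obtain s where s: "b = w (\<sigma> s)" "s \<in> E - D" using ab by (auto simp: T_def)
      have "c (w (\<sigma> (q s))) (q a) = c (\<sigma> (q s)) (q (w a))" using W(5) Q(10)[OF ab(1)] by simp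
      also have "\<dots> = c (\<sigma> s) (w a)" using TEc[OF s(2)] Q(9) ab(1) by simp
      finally show ?thesis using s hE[OF ab(1)] hwT[OF s(2)] W(5) c_sym by metis
    qed
    have TT: "c (h a) (h b) = c a b" if ab: "a \<in> T" "b \<in> T" for a b
    proof -
      obtain s t where s: "a = \<sigma> s" "s \<in> E - D" "b = \<sigma> t" "t \<in> E - D" using ab by (auto simp: T_def)
      have "c (\<sigma> (q s)) (\<sigma> (q t)) = c (q s) (q t)" "c (\<sigma> s) (\<sigma> t) = c s t"
        using k3[of "q s" "q t"] k3[of s t] s(2,4) qED[of s] qED[of t] by (simp_all add: ES')
      then show ?thesis using s hT G_c[OF Q(1)] by simp
    qed
    then show "c (h a) (h b) = c a b" if ab: "a \<in> T" "b \<in> T" for a b using that by simp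
    show "c (h a) (h b) = c a b" if ab: "a \<in> T" "b \<in> w ` T" for a b
    proof -
      obtain s t where s: "a = \<sigma> s" "s \<in> E - D" "b = w (\<sigma> t)" "t \<in> E - D" using ab by (auto simp: T_def)
      have "c (\<sigma> (q s)) (w (\<sigma> (q t))) = 1" "c (\<sigma> s) (w (\<sigma> t)) = 1"
        using k5[of "q s" "q t"] k5[of s t] s(2,4) qED[of s] qED[of t] by (simp_all add: ES')
      then show ?thesis using s hT hwT by simp
    qed
    show "c (h a) (h b) = c a b" if ab: "a \<in> w ` T" "b \<in> w ` T" for a b
    proof -
      obtain s t where s: "a = w (\<sigma> s)" "s \<in> E - D" "b = w (\<sigma> t)" "t \<in> E - D" using ab by (auto simp: T_def)
      have "h a = w (h (\<sigma> s))" "h b = w (h (\<sigma> t))" using s hT hwT by simp_all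
      then show ?thesis using s TT[of "\<sigma> s" "\<sigma> t"] G_c[OF W(1)] by (simp add: T_def)
    qed
  qed (use Q(2) in \<open>auto simp: T_def\<close>)
  define E' where "E' = E \<union> T \<union> w ` T"
  have q'E: "q' z = q z" if "z \<in> E" for z using that q' hE by simp
  have q'T: "q' (\<sigma> z) = \<sigma> (q z)" if "z \<in> E - D" for z using that q' hT by (simp add: T_def)
  have q'wT: "q' (w (\<sigma> z)) = w (\<sigma> (q z))" if "z \<in> E - D" for z using that q' hwT by (simp add: T_def)
  have "pcomm w x q' E'"
    unfolding pcomm_def pinv_def
  proof (intro conjI ballI)
    show "q' \<in> G" "finite E'" "x \<in> E'" using q' Q by (auto simp: E'_def T_def)
    show "q' x = x" using q'E Q by simp
    fix e assume "e \<in> E'"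
    then consider "e \<in> E" | s where "s \<in> E - D" "e = \<sigma> s" | s where "s \<in> E - D" "e = w (\<sigma> s)"
      unfolding E'_def T_def by blast
    then have "q' e \<in> E' \<and> q' (q' e) = e \<and> (e \<noteq> x \<longrightarrow> c (q' e) e = 1) \<and> w e \<in> E' \<and> q' (w e) = w (q' e)"
    proof cases
      case 1 then show ?thesis using q'E Q(5-7,9,10) by (simp add: E'_def)
    next
      case (2 s) 
      have s: "s \<in> S" "q s \<in> S" "q (q s) = s" using 2 ES qED[OF 2(1)] Q(6) by blast+
      have "c (\<sigma> (q s)) (\<sigma> s) = 1" using k3[OF s(2,1)] Q(7) 2 sx[OF s(1)] by simp
      then show ?thesis using 2 s(3) qED[OF 2(1)] q'T q'wT by (auto simp: E'_def T_def)
    next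
      case (3 s)
      have s: "s \<in> S" "q s \<in> S" "q (q s) = s" using 3 ES qED[OF 3(1)] Q(6) by blast+
      have "c (w (\<sigma> (q s))) (w (\<sigma> s)) = 1" using k3[OF s(2,1)] Q(7) 3 sx[OF s(1)] G_c[OF W(1)] by simp
      then show ?thesis using 3 s(3) qED[OF 3(1)] q'T q'wT W(2) by (auto simp: E'_def T_def)
    qed
    then show "q' e \<in> E'" "q' (q' e) = e" "e \<noteq> x \<longrightarrow> c (q' e) e = 1" "w e \<in> E'" "q' (w e) = w (q' e)"
      by blast+
  qed
  moreover have "square p' D' q' E'" unfolding square_def
  proof (rule ballI)
    fix z assume "z \<in> D' \<inter> E'"
    \<comment> \<open>No square relation has been arranged on the image of \<open>T\<close> under
      \<open>w\<close>, so this set must miss \<open>D'\<close>.\<close>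
    moreover have "w t \<notin> D'" if "t \<in> T" for t
      using that wsD wss ES unfolding T_def D'_def by blast
    ultimately have "z \<in> E \<union> T" unfolding E'_def by blast
    then consider "z \<in> D" "z \<in> E" | "z \<in> E - D" | s where "s \<in> E - D" "z = \<sigma> s"
      unfolding T_def by blast
    then show "p' z \<in> E' \<and> q' z \<in> D' \<and> p' (q' z) = q' (p' z)"
    proof cases
      case 1 then show ?thesis using p'D q'E SQ by (simp add: D'_def E'_def)
    next
      case 2
      have s: "z \<in> S" "q z \<in> S" "q z \<in> E - D" using 2 ES qED[OF 2] by blast+
      show ?thesis using 2 s p'S q'E q'T by (auto simp: D'_def E'_def T_def)
    next
      case (3 s)
      have s: "s \<in> S" "q s \<in> S" "q s \<in> E - D" using 3 ES qED[OF 3(1)] by blast+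
      show ?thesis using 3 s p's q'E q'T by (auto simp: D'_def E'_def T_def)
    qed
  qed
  moreover have "agree_on p D p' D'" "agree_on q E q' E'" using p'D q'E by (auto simp: agree_on_def D'_def E'_def)
  moreover have "y \<in> D'" by (auto simp: D'_def S_def)
  ultimately show ?thesis using that \<open>pcomm u x p' D'\<close> by blast
qed

text \<open>Each stage uses \<open>square_add\<close> twice, the second time with
  \<open>(u, p, D)\<close> and \<open>(w, q, E)\<close> exchanged; general position and the square
  relation are symmetric. As both domains exhaust all points, the square relation becomes
  commutation of \<open>v\<close> and \<open>v'\<close>.\<close>

lemma ex_commuting_Invol:
  assumes u: "u \<in> Invol x" and w: "w \<in> Invol x" and uw: "gen_pos u w"
  obtains v v' where "v \<in> Invol x" "v' \<in> Invol x" "\<And>y. v (u y) = u (v y)" "\<And>y. v (v' y) = v' (v y)"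
    "\<And>y. v' (w y) = w (v' y)"
proof -
  define P where "P = (\<lambda>((p, D), (q, E)). pcomm u x p D \<and> pcomm w x q E \<and> square p D q E)"
  define R where "R = (\<lambda>((p, D), (q, E)) ((p', D'), (q', E')). agree_on p D p' D' \<and> agree_on q E q' E')"
  have step: "\<exists>r. P r \<and> R s r \<and> (n \<in> snd (fst r) \<and> n \<in> snd (snd r))" if "P s" for s n
  proof -
    obtain p D q E where s: "s = ((p, D), (q, E))" by (metis surj_pair)
    then have 1: "pcomm u x p D" "pcomm w x q E" "square p D q E" using that by (auto simp: P_def)
    obtain p' D' q' E' where 2: "pcomm u x p' D'" "pcomm w x q' E'" "square p' D' q' E'"
      "agree_on p D p' D'" "agree_on q E q' E'" "n \<in> D'" by (rule square_add[OF u w uw 1])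
    obtain q2 E2 p2 D2 where 3: "pcomm w x q2 E2" "pcomm u x p2 D2" "square q2 E2 p2 D2"
      "agree_on q' E' q2 E2" "agree_on p' D' p2 D2" "n \<in> E2"
      by (rule square_add[OF w u gen_pos_sym[OF uw] 2(2,1) square_sym[OF 2(3)]])
    have "R s ((p2, D2), (q2, E2))" using 2(4,5) 3(4,5) agree_on_trans unfolding R_def s by auto
    moreover have "n \<in> D2" using 2(6) 3(5) by (auto simp: agree_on_def)
    ultimately show ?thesis using 3 square_sym by (intro exI[of _ "((p2, D2), (q2, E2))"]) (auto simp: P_def)
  qed
  have "P ((id, {x}), (id, {x}))"
    using InvolD(3)[OF u] InvolD(3)[OF w] by (simp add: P_def pcomm_def pinv_def square_def)
  then obtain s where s0: "s 0 = ((id, {x}), (id, {x}))" and s: "\<And>n. P (s n)" "\<And>n. R (s n) (s (Suc n))"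
    "\<And>n. n \<in> snd (fst (s (Suc n))) \<and> n \<in> snd (snd (s (Suc n)))"
    by (rule descending_sequence[of P "((id, {x}), (id, {x}))" R "\<lambda>n r. n \<in> snd (fst r) \<and> n \<in> snd (snd r)"])
      (erule step | rule that)+
  define p D q E where "p n = fst (fst (s n))" and "D n = snd (fst (s n))"
    and "q n = fst (snd (s n))" and "E n = snd (snd (s n))" for n
  have PS: "pcomm u x (p n) (D n)" "pcomm w x (q n) (E n)" "square (p n) (D n) (q n) (E n)" for n
    using s(1)[of n] by (auto simp: P_def p_def q_def D_def E_def split: prod.splits)
  have RS: "agree_on (p n) (D n) (p (Suc n)) (D (Suc n))" "agree_on (q n) (E n) (q (Suc n)) (E (Suc n))" for n
    using s(2)[of n] by (auto simp: R_def p_def q_def D_def E_def split: prod.splits)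
  have DE: "n \<in> D (Suc n)" "n \<in> E (Suc n)" for n using s(3) by (auto simp: D_def E_def)
  have mono: "D n \<subseteq> D (Suc n)" "E n \<subseteq> E (Suc n)" for n using RS[of n] by (auto simp: agree_on_def)
  have lim: "\<exists>v\<in>Invol x. (\<forall>y. v (t y) = t (v y)) \<and> (\<forall>n. \<forall>y\<in>F n. v y = g n y)"
    if g: "\<And>n. pcomm t x (g n) (F n)" and e: "\<And>n. agree_on (g n) (F n) (g (Suc n)) (F (Suc n))"
      and f: "\<And>n. n \<in> F (Suc n)" for t g F
  proof -
    have pv: "pinv x (g n) (F n)" for n using g by (auto simp: pcomm_def)
    note S = pinvD[OF pv]
    obtain v where v: "v \<in> G" "\<And>n y. y \<in> F n \<Longrightarrow> v y = g n y"
    proof (rule limit[of g F])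
      show "F n \<subseteq> F (Suc n)" for n using e by (auto simp: agree_on_def)
      show "g (Suc n) y = g n y" if "y \<in> F n" for n y using e that by (auto simp: agree_on_def)
      show "\<exists>n. y \<in> F n" for y using f by blast
      show "\<exists>n. y \<in> g n ` F n" for y using f[of y] S(5,6)[of y "Suc y"] by (metis imageI)
    qed (use S in blast)+
    have "v \<in> Invol x" unfolding Invol_def
    proof (intro CollectI conjI allI impI)
      fix y
      have y: "y \<in> F (Suc y)" using f by blast
      show "v (v y) = y" using v(2) S(5,6) y by metis
      show "c (v y) y = 1" if "y \<noteq> x" using v(2) S(7) y that by metis
      show "v x = x" using v(2) S(3,4) by metis
    qed (rule v)
    moreover have "v (t y) = t (v y)" for y
      using g[of "Suc y"] f[of y] v(2) unfolding pcomm_def by metis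
    ultimately show ?thesis using v(2) by blast
  qed
  obtain v where v: "v \<in> Invol x" "\<And>y. v (u y) = u (v y)" "\<And>n y. y \<in> D n \<Longrightarrow> v y = p n y"
    using lim[of u p D, OF PS(1) RS(1) DE(1)] by blast
  obtain v' where v': "v' \<in> Invol x" "\<And>y. v' (w y) = w (v' y)" "\<And>n y. y \<in> E n \<Longrightarrow> v' y = q n y"
    using lim[of w q E, OF PS(2) RS(2) DE(2)] by blast
  have "v (v' y) = v' (v y)" for y
    using PS(3)[of "Suc y"] DE[of y] v(3) v'(3) unfolding square_def by (metis IntI)
  then show ?thesis using that v v' by blast
qed

section \<open>Chains of commuting conjugates\<close>

definition conjug :: "(nat \<Rightarrow> nat) \<Rightarrow> (nat \<Rightarrow> nat) \<Rightarrow> nat \<Rightarrow> nat" where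
  "conjug g b = g \<circ> b \<circ> inv' g"

text \<open>A relation on \<open>G\<close> rather than on involutions. It mentions only the
  multiplication and \<open>b\<close>, so a group automorphism carries the relation for
  \<open>b\<close> to the one for the image of \<open>b\<close>, whatever that image looks like as a
  permutation.\<close>

definition link :: "(nat \<Rightarrow> nat) \<Rightarrow> ((nat \<Rightarrow> nat) \<times> (nat \<Rightarrow> nat)) set" where
  "link b = {(g, h). g \<in> G \<and> h \<in> G \<and> conjug g b \<circ> conjug h b = conjug h b \<circ> conjug g b}"

lemma conjug_Invol:
  assumes a: "a \<in> Invol x" and g: "g \<in> G"
  shows "conjug g a \<in> Invol (g x)"
proof -
  note A = InvolD[OF a] note [simp] = G_inv_f[OF g] G_f_inv[OF g] A(2,3)
  have "conjug g a \<in> G" using G_comp G_inv g A(1) by (simp add: conjug_def)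
  moreover have "c (g (a (inv' g y))) y = 1" if "y \<noteq> g x" for y
  proof -
    have "inv' g y \<noteq> x" using that by auto
    then have "c (a (inv' g y)) (inv' g y) = 1" by (rule A(4))
    then show ?thesis using G_c[OF g, of "a (inv' g y)" "inv' g y"] by simp
  qed
  ultimately show ?thesis unfolding Invol_def by (simp add: conjug_def)
qed

text \<open>\<open>u\<close> fixes \<open>w x\<close>, because
  \<open>u (w x) = w (u x) = w x\<close>; uniqueness of fixed points, for \<open>u\<close> and then
  for \<open>w\<close>, gives the claim.\<close>

lemma Invol_commute_fix:
  assumes "u \<in> Invol x" "w \<in> Invol y" "u \<circ> w = w \<circ> u"
  shows "x = y"
proof -
  have "u (w x) = w (u x)" using assms(3) by (metis comp_apply)
  then have "w x = x" using InvolD[OF assms(1)] by metis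
  then show ?thesis using InvolD(7)[OF assms(2)] by blast
qed

lemma link_fix:
  assumes a: "a \<in> Invol x" and "(g, h) \<in> (link a)\<^sup>*" "g \<in> G"
  shows "h \<in> G \<and> h x = g x"
  using assms(2)
proof (induction rule: rtrancl_induct)
  case base then show ?case using assms(3) by simp
next
  case (step h k)
  then have "h \<in> G" "k \<in> G" "conjug h a \<circ> conjug k a = conjug k a \<circ> conjug h a" by (auto simp: link_def)
  then show ?case using step.IH Invol_commute_fix conjug_Invol[OF a] by metis
qed

lemma Invol_ex_conj:
  assumes a: "a \<in> Invol x" and u: "u \<in> Invol x"
  obtains g where "g \<in> G" "conjug g a = u"
proof -
  obtain g where g: "g \<in> G" "\<And>y. g (a y) = u (g y)" by (rule Invol_conj[OF a u]) (rule that)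
  then have "conjug g a = u" using G_f_inv[OF g(1)] by (auto simp: conjug_def fun_eq_iff)
  then show ?thesis using g that by blast
qed

lemma link_gen_pos:
  assumes a: "a \<in> Invol x" and g: "g \<in> G" "conjug g a \<in> Invol x" and h: "h \<in> G" "conjug h a \<in> Invol x"
    and gp: "gen_pos (conjug g a) (conjug h a)"
  shows "(g, h) \<in> (link a)\<^sup>*"
proof -
  obtain v v' where v: "v \<in> Invol x" "v' \<in> Invol x" "\<And>y. v (conjug g a y) = conjug g a (v y)"
    "\<And>y. v (v' y) = v' (v y)" "\<And>y. v' (conjug h a y) = conjug h a (v' y)"
    by (rule ex_commuting_Invol[OF g(2) h(2) gp]) (rule that)
  obtain k where k: "k \<in> G" "conjug k a = v" by (rule Invol_ex_conj[OF a v(1)])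
  obtain k' where k': "k' \<in> G" "conjug k' a = v'" by (rule Invol_ex_conj[OF a v(2)])
  have "(g, k) \<in> link a" using g(1) k v(3) by (auto simp: link_def fun_eq_iff)
  moreover have "(k, k') \<in> link a" using k k' v(4) by (auto simp: link_def fun_eq_iff)
  moreover have "(k', h) \<in> link a" using h(1) k' v(5) by (auto simp: link_def fun_eq_iff)
  ultimately show ?thesis by (meson rtrancl.simps)
qed

text \<open>This describes the stabilizer of \<open>x\<close> by equations with parameter \<open>a\<close> under an existential
  quantifier, so that its image under an abstract automorphism is analytic.\<close>

lemma stabilizer_eq_link:
  assumes a: "a \<in> Invol x"
  shows "{g \<in> G. g x = x} = {h. (id, h) \<in> (link a)\<^sup>*}"
proof (intro equalityI subsetI)
  fix h assume "h \<in> {h. (id, h) \<in> (link a)\<^sup>*}"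
  then show "h \<in> {g \<in> G. g x = x}" using link_fix[OF a, of id h] by simp
next
  fix h assume "h \<in> {g \<in> G. g x = x}"
  then have h: "h \<in> G" "h x = x" by auto
  have h': "conjug h a \<in> Invol x" using conjug_Invol[OF a h(1)] h(2) by simp
  have id': "conjug id a = a" by (simp add: conjug_def)
  obtain v where v: "v \<in> Invol x" "gen_pos a v" "gen_pos (conjug h a) v"
    by (rule ex_Invol_gen_pos[OF InvolD(1)[OF a] InvolD(1)[OF h']]) (rule that)
  obtain k where k: "k \<in> G" "conjug k a = v" by (rule Invol_ex_conj[OF a v(1)])
  have "(id, k) \<in> (link a)\<^sup>*" using link_gen_pos[OF a, of id k] a k v id' by simp
  moreover have "(k, h) \<in> (link a)\<^sup>*" using link_gen_pos[OF a, of k h] h h' k v gen_pos_sym by simp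
  ultimately show "h \<in> {h. (id, h) \<in> (link a)\<^sup>*}" by simp
qed

section \<open>Category in the automorphism group\<close>

text \<open>For \<open>g \<in> G\<close> these are the basic neighbourhoods of \<open>g\<close> in
  the topology of pointwise convergence.\<close>

definition cyl :: "(nat \<Rightarrow> nat) \<Rightarrow> nat \<Rightarrow> (nat \<Rightarrow> nat) set" where
  "cyl g n = {h \<in> G. \<forall>x<n. h x = g x}"

lemma cyl_self: "g \<in> G \<Longrightarrow> g \<in> cyl g n"
  by (simp add: cyl_def)

lemma cyl_mono: "h \<in> cyl g n \<Longrightarrow> n \<le> m \<Longrightarrow> cyl h m \<subseteq> cyl g n"
  by (auto simp: cyl_def)

definition nowhere_dense :: "(nat \<Rightarrow> nat) set \<Rightarrow> bool" where
  "nowhere_dense A \<longleftrightarrow> (\<forall>g\<in>G. \<forall>n. \<exists>g'\<in>G. \<exists>n'. cyl g' n' \<subseteq> cyl g n \<and> cyl g' n' \<inter> A = {})"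

definition meagre :: "(nat \<Rightarrow> nat) set \<Rightarrow> bool" where
  "meagre A \<longleftrightarrow> (\<exists>B :: nat \<Rightarrow> (nat \<Rightarrow> nat) set. A \<subseteq> (\<Union>n. B n) \<and> (\<forall>n. nowhere_dense (B n)))"

lemma nowhere_dense_meagre: "nowhere_dense A \<Longrightarrow> meagre A"
  unfolding meagre_def by (rule exI[of _ "\<lambda>_. A"]) simp

lemma meagre_subset: "meagre B \<Longrightarrow> A \<subseteq> B \<Longrightarrow> meagre A"
  unfolding meagre_def by (meson subset_trans)

lemma meagre_empty: "meagre {}"
  by (rule nowhere_dense_meagre) (auto simp: nowhere_dense_def)

lemma meagre_UN:
  assumes "\<And>i :: 'i :: countable. meagre (A i)"
  shows "meagre (\<Union>i. A i)"
proof -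
  obtain B :: "'i \<Rightarrow> nat \<Rightarrow> (nat \<Rightarrow> nat) set" where
    B: "\<And>i. A i \<subseteq> (\<Union>n. B i n)" "\<And>i n. nowhere_dense (B i n)"
    using assms unfolding meagre_def by metis
  have nd: "nowhere_dense {}" by (auto simp: nowhere_dense_def)
  define C where "C n = (case prod_decode n of (k, m) \<Rightarrow> if \<exists>i::'i. to_nat i = k then B (from_nat k) m else {})" for n
  have "nowhere_dense (C n)" for n using B(2) nd by (auto simp: C_def split: prod.split)
  moreover have "h \<in> (\<Union>n. C n)" if "h \<in> A i" for h i
  proof -
    have "h \<in> (\<Union>m. B i m)" using B(1)[of i] that by (rule subsetD)
    then obtain m where "h \<in> B i m" by auto
    then have "h \<in> C (prod_encode (to_nat i, m))" by (auto simp: C_def)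
    then show ?thesis by (rule UN_I[OF UNIV_I])
  qed
  then have "(\<Union>i. A i) \<subseteq> (\<Union>n. C n)" by (intro subsetI) (auto simp del: UN_iff elim!: UN_E)
  ultimately show ?thesis unfolding meagre_def by blast
qed

lemma meagre_Un:
  assumes "meagre A" "meagre B"
  shows "meagre (A \<union> B)"
proof -
  have "meagre (\<Union>b. if b then A else B)" by (rule meagre_UN) (use assms in auto)
  then show ?thesis by (rule meagre_subset) force
qed

text \<open>Left translation by \<open>k\<close> maps the cylinder of \<open>g\<close> onto the
  cylinder of \<open>k \<circ> g\<close> of the same length, so it preserves being nowhere
  dense.\<close>

lemma meagre_translate:
  assumes "meagre A" "k \<in> G"
  shows "meagre ((\<circ>) k ` A)"
proof -
  have cy: "(\<circ>) k ` cyl g n = cyl (k \<circ> g) n" if "k \<in> G" for k g n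
  proof (intro equalityI subsetI)
    fix h assume "h \<in> cyl (k \<circ> g) n"
    then have "inv' k \<circ> h \<in> cyl g n" "k \<circ> (inv' k \<circ> h) = h"
      using that G_comp G_inv G_inv_f G_f_inv by (auto simp: cyl_def fun_eq_iff)
    then show "h \<in> (\<circ>) k ` cyl g n" by (metis imageI)
  qed (use that G_comp in \<open>auto simp: cyl_def\<close>)
  have nd: "nowhere_dense ((\<circ>) k ` B)" if B: "nowhere_dense B" for B
    unfolding nowhere_dense_def
  proof (intro ballI allI)
    fix g n assume g: "g \<in> G"
    have g': "inv' k \<circ> g \<in> G" using g assms(2) G_comp G_inv by blast
    then obtain h m where h: "h \<in> G" "cyl h m \<subseteq> cyl (inv' k \<circ> g) n" "cyl h m \<inter> B = {}"
      using B unfolding nowhere_dense_def by blast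
    have kk: "k \<circ> (inv' k \<circ> g) = g" using assms(2) by (simp add: fun_eq_iff G_f_inv)
    have "cyl (k \<circ> h) m \<subseteq> cyl g n" using h(2) cy[OF assms(2)] kk by (metis image_mono)
    moreover have "inj ((\<circ>) k)" using G_eq_iff[OF assms(2)] by (auto intro!: injI simp: fun_eq_iff)
    then have "cyl (k \<circ> h) m \<inter> (\<circ>) k ` B = {}"
      using h(3) unfolding cy[OF assms(2), symmetric] by (metis image_Int image_empty)
    ultimately show "\<exists>g'\<in>G. \<exists>n'. cyl g' n' \<subseteq> cyl g n \<and> cyl g' n' \<inter> (\<circ>) k ` B = {}"
      using G_comp[OF assms(2) h(1)] by blast
  qed
  obtain B where "A \<subseteq> (\<Union>n. B n)" "\<forall>n::nat. nowhere_dense (B n)" using assms(1) unfolding meagre_def by blast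
  then have "(\<circ>) k ` A \<subseteq> (\<Union>n. (\<circ>) k ` B n)" "\<forall>n. nowhere_dense ((\<circ>) k ` B n)"
    using nd unfolding image_UN[symmetric] by (simp_all add: image_mono)
  then show ?thesis unfolding meagre_def by (intro exI[of _ "\<lambda>n. (\<circ>) k ` B n"]) simp
qed

text \<open>A pointwise limit of permutations need not be surjective. Each stage therefore avoids
  \<open>B i\<close> and also makes \<open>i\<close> a value attained on the segment already fixed,
  which keeps the limit in \<open>G\<close>.\<close>

lemma Baire:
  assumes g: "g \<in> G"
  shows "\<not> meagre (cyl g n)"
proof
  assume "meagre (cyl g n)"
  then obtain B where B: "cyl g n \<subseteq> (\<Union>i. B i)" "\<And>i::nat. nowhere_dense (B i)" unfolding meagre_def by blast
  define P where "P = (\<lambda>(h, m::nat). h \<in> G)"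
  define E where "E = (\<lambda>(h, m) (h', m'). m \<le> m' \<and> h' \<in> cyl h m)"
  define T where "T i = (\<lambda>(h, m). i < m \<and> i \<in> h ` {..<m} \<and> cyl h m \<inter> B i = {})" for i
  have step: "\<exists>q. P q \<and> E p q \<and> T i q" if p: "P p" for p i
  proof -
    obtain h m where hm: "p = (h, m)" "h \<in> G" using p by (auto simp: P_def)
    obtain h' m' where h': "h' \<in> G" "cyl h' m' \<subseteq> cyl h m" "cyl h' m' \<inter> B i = {}"
      using B(2)[of i] hm(2) unfolding nowhere_dense_def by blast
    define M where "M = Max {m, m', Suc i, Suc (inv' h' i)}"
    have M: "m \<le> M" "m' \<le> M" "i < M" "inv' h' i < M" by (auto simp: M_def less_eq_Suc_le)
    have "i \<in> h' ` {..<M}" using M(4) G_f_inv[OF h'(1), of i] by (metis imageI lessThan_iff)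
    moreover have "cyl h' M \<inter> B i = {}" using h'(3) cyl_mono[OF cyl_self[OF h'(1)] M(2)] by blast
    moreover have "h' \<in> cyl h m" using h'(2) cyl_self[OF h'(1)] by blast
    ultimately show ?thesis using h' M by (intro exI[of _ "(h', M)"]) (auto simp: P_def E_def T_def hm)
  qed
  have "P (g, n)" using g by (simp add: P_def)
  then obtain s where s0: "s 0 = (g, n)" and s: "\<And>i. P (s i)" "\<And>i. E (s i) (s (Suc i))" "\<And>i. T i (s (Suc i))"
    by (rule descending_sequence[of P "(g, n)" E T]) (erule step | rule that)+
  define h m where "h i = fst (s i)" and "m i = snd (s i)" for i
  have hm: "h i \<in> G" "m i \<le> m (Suc i)" "h (Suc i) \<in> cyl (h i) (m i)" "i < m (Suc i)"
    "i \<in> h (Suc i) ` {..<m (Suc i)}" "cyl (h (Suc i)) (m (Suc i)) \<inter> B i = {}" for i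
    using s(1)[of i] s(2)[of i] s(3)[of i] by (auto simp: P_def E_def T_def h_def m_def split: prod.splits)
  obtain f where f: "f \<in> G" "\<And>i y. y \<in> {..<m i} \<Longrightarrow> f y = h i y"
  proof (rule limit[of h "\<lambda>i. {..<m i}"])
    show "{..<m i} \<subseteq> {..<m (Suc i)}" for i using hm(2)[of i] by auto
    show "h (Suc i) y = h i y" if "y \<in> {..<m i}" for i y using hm(3)[of i] that by (simp add: cyl_def)
    show "\<exists>i. y \<in> {..<m i}" for y using hm(4)[of y] by blast
    show "\<exists>i. y \<in> h i ` {..<m i}" for y using hm(5)[of y] by blast
  qed (use hm(1) in blast)+
  have fc: "f \<in> cyl (h i) (m i)" for i using f by (simp add: cyl_def)
  have "f \<in> cyl g n" using fc[of 0] by (simp add: h_def m_def s0)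
  then obtain i where "f \<in> B i" using B(1) by blast
  then show False using hm(6)[of i] fc[of "Suc i"] by blast
qed

text \<open>Asking for a nonmeagre trace on every smaller cylinder makes the notion pass to
  subcylinders.\<close>

definition thick :: "(nat \<Rightarrow> nat) set \<Rightarrow> (nat \<Rightarrow> nat) \<Rightarrow> nat \<Rightarrow> bool" where
  "thick A g n \<longleftrightarrow> g \<in> G \<and> (\<forall>g'\<in>G. \<forall>n'. cyl g' n' \<subseteq> cyl g n \<longrightarrow> \<not> meagre (A \<inter> cyl g' n'))"

lemma thick_mono: "thick A g n \<Longrightarrow> A \<subseteq> B \<Longrightarrow> h \<in> cyl g n \<Longrightarrow> n \<le> m \<Longrightarrow> thick B h m"
  unfolding thick_def using cyl_mono[of h g n m] 
  by (smt (verit) Int_mono cyl_def dual_order.refl meagre_subset mem_Collect_eq subset_trans)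

lemma thickD: "thick A g n \<Longrightarrow> \<not> meagre (A \<inter> cyl g n)"
  by (auto simp: thick_def)

text \<open>There are countably many cylinders, indexed by lists of values, so the union
  \<open>W\<close> of the meagre traces of \<open>A\<close> on them is meagre. If \<open>A\<close>
  were thick nowhere, \<open>A - W\<close> would be nowhere dense and \<open>A\<close>
  meagre.\<close>

lemma ex_thick:
  assumes "\<not> meagre A"
  obtains g n where "thick A g n"
proof (rule ccontr)
  assume "\<not> thesis"
  then have no: "\<not> thick A g n" for g n using that by blast
  define C where "C l = {h \<in> G. map h [0..<length l] = l}" for l :: "nat list"
  have C: "cyl g n = C (map g [0..<n])" for g n
    by (auto simp: cyl_def C_def)
  define W where "W = (\<Union>l. if meagre (A \<inter> C l) then A \<inter> C l else {})"
  have "meagre W" unfolding W_def by (rule meagre_UN) (simp add: meagre_empty)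
  moreover have "nowhere_dense (A - W)"
    unfolding nowhere_dense_def
  proof (intro ballI allI)
    fix g n assume "g \<in> G"
    then obtain g' n' where g': "g' \<in> G" "cyl g' n' \<subseteq> cyl g n" "meagre (A \<inter> cyl g' n')"
      using no[of g n] by (auto simp: thick_def)
    have "A \<inter> cyl g' n' \<subseteq> W" using g'(3) unfolding C W_def by (auto intro!: exI[of _ "map g' [0..<n']"])
    then show "\<exists>g'\<in>G. \<exists>n'. cyl g' n' \<subseteq> cyl g n \<and> cyl g' n' \<inter> (A - W) = {}" using g' by blast
  qed
  ultimately have "meagre (W \<union> (A - W))" using meagre_Un nowhere_dense_meagre by blast
  then show False using assms meagre_subset by blast
qed

text \<open>This is the Baire property of analytic sets. The set \<open>A []\<close> is the result of the Suslin operation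
  applied to \<open>A\<close>; second-category behaviour descends along some branch through every point outside
  the nowhere dense sets \<open>D \<sigma>\<close>.\<close>

lemma Nikodym:
  assumes sub: "\<And>\<sigma>. A \<sigma> \<subseteq> (\<Union>i::nat. A (\<sigma> @ [i]))"
    and closed: "\<And>h \<beta>. h \<in> G \<Longrightarrow> (\<And>n. \<exists>a\<in>A (map \<beta> [0..<n]). \<forall>x<n. a x = h x) \<Longrightarrow> h \<in> A []"
    and th: "thick (A []) g n"
  shows "meagre (cyl g n - A [])"
proof -
  \<comment> \<open>\<open>U \<sigma>\<close> is the open set covered by the cylinders in which
    \<open>A \<sigma>\<close> is thick; \<open>D \<sigma>\<close> is the part where no immediate
    successor of \<sigma> inherits this.\<close>
  define U where "U \<sigma> = {h. \<exists>g n. h \<in> cyl g n \<and> thick (A \<sigma>) g n}" for \<sigma>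
  define D where "D \<sigma> = U \<sigma> - (\<Union>i. U (\<sigma> @ [i]))" for \<sigma>
  have Ucyl: "cyl h m \<subseteq> U \<sigma>" if "thick (A \<sigma>) h m" for h m \<sigma> using that by (auto simp: U_def)
  have nd: "nowhere_dense (D \<sigma>)" for \<sigma>
    unfolding nowhere_dense_def
  proof (intro ballI allI)
    fix g n assume g: "g \<in> G"
    show "\<exists>g'\<in>G. \<exists>n'. cyl g' n' \<subseteq> cyl g n \<and> cyl g' n' \<inter> D \<sigma> = {}"
    proof (cases "cyl g n \<inter> U \<sigma> = {}")
      case True then show ?thesis using g unfolding D_def by blast
    next
      case False
      then obtain h g1 n1 where h: "h \<in> cyl g n" "h \<in> cyl g1 n1" "thick (A \<sigma>) g1 n1" by (auto simp: U_def)
      define m where "m = max n n1"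
      have hm: "cyl h m \<subseteq> cyl g n" "thick (A \<sigma>) h m"
        using cyl_mono[OF h(1)] thick_mono[OF h(3) subset_refl h(2)] by (auto simp: m_def)
      \<comment> \<open>The countably many successors cover \<open>A \<sigma>\<close>, so one of
        them is nonmeagre in \<open>cyl h m\<close>, hence thick in some smaller cylinder.\<close>
      have "\<exists>i. \<not> meagre (A (\<sigma> @ [i]) \<inter> cyl h m)"
      proof (rule ccontr)
        assume "\<nexists>i. \<not> meagre (A (\<sigma> @ [i]) \<inter> cyl h m)"
        then have "meagre (\<Union>i. A (\<sigma> @ [i]) \<inter> cyl h m)" by (intro meagre_UN) blast
        then have "meagre (A \<sigma> \<inter> cyl h m)" by (rule meagre_subset) (use sub in blast)
        then show False using thickD[OF hm(2)] by blast
      qed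
      then obtain i g2 n2 where g2: "thick (A (\<sigma> @ [i]) \<inter> cyl h m) g2 n2" using ex_thick by metis
      then obtain h2 where h2: "h2 \<in> cyl h m" "h2 \<in> cyl g2 n2" using thickD[OF g2] meagre_empty by (metis IntE equals0I)
      define k where "k = max m n2"
      have "thick (A (\<sigma> @ [i])) h2 k" by (rule thick_mono[OF g2 _ h2(2)]) (auto simp: k_def)
      then have "cyl h2 k \<inter> D \<sigma> = {}" using Ucyl unfolding D_def by blast
      moreover have "cyl h2 k \<subseteq> cyl g n" using cyl_mono[OF h2(1), of k] hm(1) by (auto simp: k_def)
      moreover have "h2 \<in> G" using h2 by (simp add: cyl_def)
      ultimately show ?thesis by blast
    qed
  qed
  have "meagre (\<Union>\<sigma>. D \<sigma>)" by (rule meagre_UN) (rule nowhere_dense_meagre[OF nd])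
  moreover have "cyl g n - A [] \<subseteq> (\<Union>\<sigma>. D \<sigma>)"
  proof (rule subsetI, rule ccontr)
    fix h assume h: "h \<in> cyl g n - A []" "h \<notin> (\<Union>\<sigma>. D \<sigma>)"
    \<comment> \<open>As \<open>h\<close> lies in no \<open>D \<sigma>\<close>, membership in
      \<open>U \<sigma>\<close> passes to a successor. Along the resulting branch every
      \<open>A\<close> has elements arbitrarily close to \<open>h\<close>.\<close>
    have step: "\<exists>\<sigma>'. h \<in> U \<sigma>' \<and> (\<exists>i. \<sigma>' = \<sigma> @ [i]) \<and> True" if "h \<in> U \<sigma>" for \<sigma> and n :: nat
      using that h(2) unfolding D_def by blast
    have "h \<in> U []" using h th Ucyl by blast
    then obtain s where s: "s 0 = []" "\<And>n. h \<in> U (s n)" "\<And>n. \<exists>i. s (Suc n) = s n @ [i]"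
      using descending_sequence[of "\<lambda>\<sigma>. h \<in> U \<sigma>" "[]" "\<lambda>\<sigma> \<sigma>'. \<exists>i. \<sigma>' = \<sigma> @ [i]" "\<lambda>_ _. True"] step
      by (metis (mono_tags, lifting))
    define \<beta> where "\<beta> n = last (s (Suc n))" for n
    have sn: "s n = map \<beta> [0..<n]" for n
    proof (induction n)
      case (Suc n)
      obtain i where "s (Suc n) = s n @ [i]" using s(3) by blast
      then show ?case using Suc by (simp add: \<beta>_def)
    qed (simp add: s)
    have "h \<in> A []"
    proof (rule closed)
      fix n
      obtain g1 n1 where g1: "h \<in> cyl g1 n1" "thick (A (s n)) g1 n1" using s(2)[of n] by (auto simp: U_def)
      have "thick (A (s n)) h (max n1 n)" by (rule thick_mono[OF g1(2) subset_refl g1(1)]) simp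
      then obtain a where "a \<in> A (s n)" "a \<in> cyl h (max n1 n)"
        using thickD meagre_empty by (metis IntE equals0I)
      then show "\<exists>a\<in>A (map \<beta> [0..<n]). \<forall>x<n. a x = h x"
        unfolding sn by (intro bexI[of _ a]) (simp_all add: cyl_def)
    qed (use h in \<open>simp add: cyl_def\<close>)
    then show False using h by blast
  qed
  ultimately show ?thesis using meagre_subset by blast
qed

section \<open>Analytic subgroups of countable index are open\<close>

definition psubgroup :: "(nat \<Rightarrow> nat) set \<Rightarrow> bool" where
  "psubgroup H \<longleftrightarrow> H \<subseteq> G \<and> id \<in> H \<and> (\<forall>g\<in>H. inv' g \<in> H \<and> (\<forall>h\<in>H. g \<circ> h \<in> H))"

definition pfix :: "nat set \<Rightarrow> (nat \<Rightarrow> nat) set" where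
  "pfix F = {g \<in> G. \<forall>x\<in>F. g x = x}"

text \<open>Countable index makes \<open>H\<close> nonmeagre, and the Baire property makes it
  comeagre in some \<open>cyl g n\<close>. If \<open>f\<close> fixes the values of \<open>g\<close>
  below \<open>n\<close>, left translation by \<open>f\<close> preserves this cylinder, so the coset
  of \<open>H\<close> by \<open>f\<close> is comeagre in it too. The two sets meet, and
  \<open>f \<in> H\<close>.\<close>

lemma analytic_subgroup_open:
  assumes H: "psubgroup H"
    and index: "\<And>i. k i \<in> G" "G \<subseteq> (\<Union>i::nat. (\<circ>) (k i) ` H)"
    and A: "A [] = H" "\<And>\<sigma>. A \<sigma> \<subseteq> (\<Union>i::nat. A (\<sigma> @ [i]))"
      "\<And>h \<beta>. h \<in> G \<Longrightarrow> (\<And>n. \<exists>a\<in>A (map \<beta> [0..<n]). \<forall>x<n. a x = h x) \<Longrightarrow> h \<in> H"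
  obtains F where "finite F" "pfix F \<subseteq> H"
proof -
  have "\<not> meagre H"
  proof
    assume "meagre H"
    then have "meagre (\<Union>i. (\<circ>) (k i) ` H)" using meagre_translate index(1) by (intro meagre_UN) blast
    then have "meagre (cyl id 0)" by (rule meagre_subset) (use index(2) in \<open>auto simp: cyl_def\<close>)
    then show False using Baire by simp
  qed
  then obtain g n where gn: "thick H g n" by (rule ex_thick)
  then have g: "g \<in> G" by (simp add: thick_def)
  have m: "meagre (cyl g n - H)"
    by (rule Nikodym[of A g n, unfolded A(1), OF A(2,3) gn])
  have "pfix (g ` {..<n}) \<subseteq> H"
  proof
    fix f assume "f \<in> pfix (g ` {..<n})"
    then have f: "f \<in> G" "\<And>x. x < n \<Longrightarrow> f (g x) = g x" by (auto simp: pfix_def)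
    have "cyl g n - (\<circ>) f ` H \<subseteq> (\<circ>) f ` (cyl g n - H)"
    proof
      fix h assume h: "h \<in> cyl g n - (\<circ>) f ` H"
      have *: "f \<circ> (inv' f \<circ> h) = h" using G_f_inv[OF f(1)] by (simp add: fun_eq_iff)
      have "inv' f (g x) = g x" if "x < n" for x using f(2)[OF that] G_inv_f[OF f(1)] by metis
      then have "inv' f \<circ> h \<in> cyl g n" using h G_comp G_inv f(1) by (simp add: cyl_def)
      moreover have "inv' f \<circ> h \<notin> H" using h * by (metis DiffE imageI)
      ultimately show "h \<in> (\<circ>) f ` (cyl g n - H)" using * by (metis DiffI imageI)
    qed
    then have "meagre (cyl g n - (\<circ>) f ` H)" using meagre_subset meagre_translate[OF m f(1)] by blast
    then have "\<not> cyl g n \<subseteq> (cyl g n - H) \<union> (cyl g n - (\<circ>) f ` H)"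
      using Baire[OF g] meagre_Un[OF m] meagre_subset by blast
    then obtain h h' where h: "h \<in> H" "h' \<in> H" "h = f \<circ> h'" by blast
    then have "h' \<in> G" using H by (auto simp: psubgroup_def)
    then have "f = h \<circ> inv' h'" using h(3) by (simp add: fun_eq_iff G_f_inv)
    then show "f \<in> H" using h(1,2) H unfolding psubgroup_def by metis
  qed
  then show ?thesis using that by blast
qed

section \<open>Pointwise limits of chains\<close>

definition pconv :: "(nat \<Rightarrow> nat \<Rightarrow> nat) \<Rightarrow> (nat \<Rightarrow> nat) \<Rightarrow> bool" where
  "pconv V v \<longleftrightarrow> (\<forall>x. \<forall>\<^sub>F n in sequentially. V n x = v x)"

lemma pconv_const: "pconv (\<lambda>_. v) v"
  by (simp add: pconv_def)

lemma pconv_comp: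
  assumes "pconv V v" "pconv W w"
  shows "pconv (\<lambda>n. V n \<circ> W n) (v \<circ> w)"
  unfolding pconv_def
proof
  fix x
  have "\<forall>\<^sub>F n in sequentially. W n x = w x" "\<forall>\<^sub>F n in sequentially. V n (w x) = v (w x)"
    using assms unfolding pconv_def by blast+
  then show "\<forall>\<^sub>F n in sequentially. (V n \<circ> W n) x = (v \<circ> w) x"
    by eventually_elim simp
qed

lemma pconv_unique:
  assumes "pconv V v" "pconv V w"
  shows "v = w"
proof
  fix x
  have "\<forall>\<^sub>F n in sequentially. V n x = v x" "\<forall>\<^sub>F n in sequentially. V n x = w x"
    using assms unfolding pconv_def by blast+
  then have "\<forall>\<^sub>F n in sequentially. v x = w x" by eventually_elim simp
  then show "v x = w x" by simp
qed

lemma pconv_eventually: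
  assumes "pconv V v" "\<forall>\<^sub>F n in sequentially. V n = W n"
  shows "pconv W v"
  unfolding pconv_def
proof
  fix x
  have "\<forall>\<^sub>F n in sequentially. V n x = v x" using assms(1) unfolding pconv_def by blast
  then show "\<forall>\<^sub>F n in sequentially. W n x = v x" using assms(2) by eventually_elim simp
qed

text \<open>Convergence of the inverses rules out a limit that is not surjective:
  \<open>v \<circ> w\<close> and \<open>w \<circ> v\<close> are limits of the constant
  \<open>id\<close>.\<close>

lemma pconv_G:
  assumes V: "\<And>n. V n \<in> G" and v: "pconv V v" "pconv (\<lambda>n. inv' (V n)) w"
  shows "v \<in> G" "w = inv' v"
proof -
  have "pconv (\<lambda>n. id) (v \<circ> w)" "pconv (\<lambda>n. id) (w \<circ> v)"
    using pconv_comp[OF v] pconv_comp[OF v(2,1)] unfolding G_comp_inv[OF V] by blast+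
  then have vw: "v \<circ> w = id" "w \<circ> v = id"
    by (blast intro: pconv_unique pconv_const)+
  then have "bij v" using o_bij by blast
  moreover have "c (v x) (v y) = c x y" for x y
  proof -
    have "\<forall>\<^sub>F n in sequentially. V n x = v x" "\<forall>\<^sub>F n in sequentially. V n y = v y"
      using v unfolding pconv_def by blast+
    then have "\<forall>\<^sub>F n in sequentially. c (v x) (v y) = c x y"
      by eventually_elim (use G_c[OF V] in metis)
    then show ?thesis by simp
  qed
  ultimately show "v \<in> G" by (simp add: col_aut_def)
  show "w = inv' v" using vw by (metis inv_unique_comp)
qed

lemma link_closed:
  assumes V: "\<And>n. V n \<in> G" "pconv V v" "pconv (\<lambda>n. inv' (V n)) (inv' v)" "v \<in> G"
    and W: "\<And>n. W n \<in> G" "pconv W w" "pconv (\<lambda>n. inv' (W n)) (inv' w)" "w \<in> G"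
    and link: "\<forall>\<^sub>F n in sequentially. (V n, W n) \<in> link b"
  shows "(v, w) \<in> link b"
proof -
  have cV: "pconv (\<lambda>n. conjug (V n) b) (conjug v b)" and cW: "pconv (\<lambda>n. conjug (W n) b) (conjug w b)"
    unfolding conjug_def by (intro pconv_comp pconv_const V W)+
  have "\<forall>\<^sub>F n in sequentially. conjug (V n) b \<circ> conjug (W n) b = conjug (W n) b \<circ> conjug (V n) b"
    using link by eventually_elim (simp add: link_def)
  then have "pconv (\<lambda>n. conjug (W n) b \<circ> conjug (V n) b) (conjug v b \<circ> conjug w b)"
    by (rule pconv_eventually[OF pconv_comp[OF cV cW]])
  then have "conjug v b \<circ> conjug w b = conjug w b \<circ> conjug v b"
    using pconv_comp[OF cW cV] pconv_unique by blast
  then show ?thesis using V(4) W(4) by (simp add: link_def)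
qed

text \<open>The sequence is total and stays in \<open>G\<close> beyond the length \<open>m\<close>
  as well, so limits can be taken at every index alike.\<close>

definition chains :: "(nat \<Rightarrow> nat) \<Rightarrow> (nat \<times> (nat \<Rightarrow> nat \<Rightarrow> nat)) set" where
  "chains b = {(m, v). v 0 = id \<and> (\<forall>i. v i \<in> G) \<and> (\<forall>i<m. (v i, v (Suc i)) \<in> link b)}"

text \<open>The codes of a chain record longer and longer initial segments of its permutations and of
  their inverses; the inverses make limits of chains bijective.\<close>

definition chain_code :: "nat \<Rightarrow> nat \<times> (nat \<Rightarrow> nat \<Rightarrow> nat) \<Rightarrow> nat" where
  "chain_code j = (\<lambda>(m, v). to_nat (m, map (\<lambda>i. map (\<lambda>x. (v i x, inv' (v i) x)) [0..<Suc j]) [0..<Suc j]))"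

lemma chain_code_eqD:
  assumes "chain_code j (m, v) = chain_code j (m', v')"
  shows "m = m'" and "i \<le> j \<Longrightarrow> x \<le> j \<Longrightarrow> v i x = v' i x \<and> inv' (v i) x = inv' (v' i) x"
proof -
  have *: "m = m'" "map (\<lambda>i. map (\<lambda>x. (v i x, inv' (v i) x)) [0..<Suc j]) [0..<Suc j]
    = map (\<lambda>i. map (\<lambda>x. (v' i x, inv' (v' i) x)) [0..<Suc j]) [0..<Suc j]"
    using assms unfolding chain_code_def by (simp_all del: upt_Suc)
  show "m = m'" by (rule *)
  assume "i \<le> j" "x \<le> j"
  then have ij: "i < Suc j" "x < Suc j" by auto
  have "\<forall>i\<in>set [0..<Suc j]. \<forall>x\<in>set [0..<Suc j]. (v i x, inv' (v i) x) = (v' i x, inv' (v' i) x)"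
    using *(2) unfolding map_eq_conv by blast
  then have "(v i x, inv' (v i) x) = (v' i x, inv' (v' i) x)" using ij by (metis atLeastLessThan_iff le0 set_upt)
  then show "v i x = v' i x \<and> inv' (v i) x = inv' (v' i) x" by simp
qed

lemma link_rtrancl_chains:
  assumes "b \<in> G"
  shows "(id, h) \<in> (link b)\<^sup>* \<longleftrightarrow> (\<exists>m v. (m, v) \<in> chains b \<and> v m = h)"
proof
  assume "(id, h) \<in> (link b)\<^sup>*"
  then obtain m where "(id, h) \<in> link b ^^ m" using rtrancl_imp_UN_relpow by blast
  then obtain f where f: "f 0 = id" "f m = h" "\<forall>i<m. (f i, f (Suc i)) \<in> link b"
    unfolding relpow_fun_conv by blast
  define v where "v i = (if i \<le> m then f i else id)" for i
  have "v i \<in> G" for i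
  proof (cases "i \<le> m \<and> i \<noteq> 0")
    case True
    then obtain i' where i': "i = Suc i'" "i' < m" by (cases i) auto
    then have "(f i', f i) \<in> link b" using f(3) by simp
    then show ?thesis using True by (auto simp: v_def link_def)
  qed (auto simp: v_def f(1))
  then have "(m, v) \<in> chains b" using f by (auto simp: chains_def v_def)
  moreover have "v m = h" using f(2) by (simp add: v_def)
  ultimately show "\<exists>m v. (m, v) \<in> chains b \<and> v m = h" by blast
next
  assume "\<exists>m v. (m, v) \<in> chains b \<and> v m = h"
  then obtain m v where v: "v 0 = id" "\<forall>i<m. (v i, v (Suc i)) \<in> link b" "v m = h"
    by (auto simp: chains_def)
  then have "(id, h) \<in> link b ^^ m" unfolding relpow_fun_conv by blast
  then show "(id, h) \<in> (link b)\<^sup>*" by (rule relpow_imp_rtrancl)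
qed

lemma link_class_open:
  assumes b: "b \<in> G" and H: "H = {h. (id, h) \<in> (link b)\<^sup>*}" "psubgroup H"
    and index: "\<And>i. k i \<in> G" "G \<subseteq> (\<Union>i::nat. (\<circ>) (k i) ` H)"
  obtains F where "finite F" "pfix F \<subseteq> H"
proof -
  \<comment> \<open>The Suslin scheme: \<open>A \<sigma>\<close> collects the ends of the chains
    whose first codes are listed in \<sigma>. The length of the chain is part of each code, hence
    constant along a branch.\<close>
  define A where "A \<sigma> = {h. \<exists>m v. (m, v) \<in> chains b \<and> v m = h \<and> (\<forall>j<length \<sigma>. chain_code j (m, v) = \<sigma> ! j)}" for \<sigma>
  have A0: "A [] = H" unfolding H A_def by (simp add: link_rtrancl_chains[OF b])
  have A1: "A \<sigma> \<subseteq> (\<Union>i. A (\<sigma> @ [i]))" for \<sigma>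
  proof
    fix h assume "h \<in> A \<sigma>"
    then obtain m v where v: "(m, v) \<in> chains b" "v m = h" "\<forall>j<length \<sigma>. chain_code j (m, v) = \<sigma> ! j" by (auto simp: A_def)
    then have "\<forall>j<length (\<sigma> @ [chain_code (length \<sigma>) (m, v)]). chain_code j (m, v) = (\<sigma> @ [chain_code (length \<sigma>) (m, v)]) ! j"
      by (auto simp: nth_append less_Suc_eq)
    then have "h \<in> A (\<sigma> @ [chain_code (length \<sigma>) (m, v)])" unfolding A_def using v by blast
    then show "h \<in> (\<Union>i. A (\<sigma> @ [i]))" by blast
  qed
  have A2: "h \<in> H" if h: "h \<in> G" and \<beta>: "\<And>n. \<exists>a\<in>A (map \<beta> [0..<n]). \<forall>x<n. a x = h x" for h \<beta>
  proof -
    have "\<exists>m v. (m, v) \<in> chains b \<and> (\<forall>j<n. chain_code j (m, v) = \<beta> j) \<and> (\<forall>x<n. v m x = h x)" for n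
      using \<beta>[of n] by (fastforce simp: A_def)
    then obtain M V where MV: "\<And>n. (M n, V n) \<in> chains b" "\<And>n j. j < n \<Longrightarrow> chain_code j (M n, V n) = \<beta> j"
      "\<And>n x. x < n \<Longrightarrow> V n (M n) x = h x" by metis
    have VG: "V n i \<in> G" "V n 0 = id" "i < M n \<Longrightarrow> (V n i, V n (Suc i)) \<in> link b" for n i
      using MV(1)[of n] by (auto simp: chains_def)
    \<comment> \<open>Stage \<open>0\<close> matches no code, so the length is first known at stage
      \<open>1\<close>.\<close>
    define m where "m = M 1"
    have Mm: "M n = m" if "n \<ge> 1" for n
      unfolding m_def by (rule chain_code_eqD(1)[of 0 _ "V n" _ "V 1"]) (use MV(2)[of 0 n] MV(2)[of 0 1] that in simp)
    \<comment> \<open>Code number \<open>max i x\<close> records this entry, and stage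
      \<open>n\<close> matches the codes below \<open>n\<close>; hence the stage
      \<open>Suc (max i x)\<close>.\<close>
    define v where "v i x = V (Suc (max i x)) i x" for i x
    define w where "w i x = inv' (V (Suc (max i x)) i) x" for i x
    have agree: "V n i x = v i x \<and> inv' (V n i) x = w i x" if "n > max i x" for n i x
      unfolding v_def w_def
      by (rule chain_code_eqD(2)[of "max i x" "M n" "V n" "M (Suc (max i x))" "V (Suc (max i x))"]) (use MV(2)[of "max i x" n] MV(2)[of "max i x" "Suc (max i x)"] that in auto)
    have cv: "pconv (\<lambda>n. V n i) (v i)" "pconv (\<lambda>n. inv' (V n i)) (w i)" for i
    proof -
      have "\<forall>\<^sub>F n in sequentially. V n i x = v i x \<and> inv' (V n i) x = w i x" for x
        by (rule eventually_mono[OF eventually_gt_at_top[of "max i x"]]) (rule agree)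
      then show "pconv (\<lambda>n. V n i) (v i)" "pconv (\<lambda>n. inv' (V n i)) (w i)"
        unfolding pconv_def by (blast intro: eventually_mono)+
    qed
    have v: "v i \<in> G" "w i = inv' (v i)" for i using pconv_G[OF VG(1) cv] by auto
    have "(v i, v (Suc i)) \<in> link b" if "i < m" for i
    proof (rule link_closed[where V = "\<lambda>n. V n i" and W = "\<lambda>n. V n (Suc i)"])
      show "\<forall>\<^sub>F n in sequentially. (V n i, V n (Suc i)) \<in> link b"
        using eventually_ge_at_top[of 1] by eventually_elim (use VG(3) Mm that in simp)
    qed (use VG(1) cv v in simp_all)
    moreover have "v 0 = id"
      by (rule pconv_unique[OF cv(1)]) (simp add: VG(2) pconv_const)
    ultimately have "(m, v) \<in> chains b" using v by (auto simp: chains_def)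
    moreover have "v m = h"
    proof (rule pconv_unique[OF cv(1)], unfold pconv_def, rule)
      fix x
      show "\<forall>\<^sub>F n in sequentially. V n m x = h x"
        using eventually_gt_at_top[of x] by eventually_elim (use MV(3) Mm in \<open>metis One_nat_def Suc_leI gr_zeroI not_less_zero\<close>)
    qed
    ultimately show "h \<in> H" unfolding H using link_rtrancl_chains[OF b] by blast
  qed
  show ?thesis
    by (rule analytic_subgroup_open[of H k A, OF H(2) index A0 A1]) (rule A2, assumption+, rule that)
qed

section \<open>Automorphisms are induced by permutations of the points\<close>

lemma psubgroupD:
  assumes "psubgroup H"
  shows "g \<in> H \<Longrightarrow> g \<in> G" "g \<in> H \<Longrightarrow> inv' g \<in> H" "g \<in> H \<Longrightarrow> h \<in> H \<Longrightarrow> g \<circ> h \<in> H"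
  using assms unfolding psubgroup_def by blast+

lemma psubgroup_cancel:
  assumes "psubgroup H" "t \<in> H"
  shows "inv' t \<circ> h \<in> H \<Longrightarrow> h \<in> H" "inv' t \<circ> h \<circ> t \<in> H \<Longrightarrow> h \<in> H"
proof -
  note HD = psubgroupD[OF assms(1)]
  have *: "t (inv' t z) = z" for z using G_f_inv[OF HD(1)[OF assms(2)]] .
  show 1: "h \<in> H" if "inv' t \<circ> h \<in> H" for h
    using HD(3)[OF assms(2) that] * by (simp add: comp_def)
  assume "inv' t \<circ> h \<circ> t \<in> H"
  then have "inv' t \<circ> h \<circ> t \<circ> inv' t \<in> H" using HD(3) HD(2)[OF assms(2)] by blast
  then show "h \<in> H" using 1[of h] * by (simp add: comp_def)
qed

lemma pfixD: "g \<in> pfix F \<Longrightarrow> g \<in> G" "g \<in> pfix F \<Longrightarrow> x \<in> F \<Longrightarrow> g x = x"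
  by (auto simp: pfix_def)

text \<open>The points of \<open>Y\<close> outside \<open>B\<close> are moved one at a time, each to
  a copy that is free over the images of \<open>B\<close> and of the earlier points.\<close>

lemma pfix_move_free:
  assumes "finite B" "finite Y" "finite W"
  shows "\<exists>t\<in>pfix B. \<forall>y\<in>Y - B. \<forall>z\<in>W - B. c (t y) z = 1"
  using assms(2)
proof (induction Y rule: finite_induct)
  case empty
  then show ?case by (intro bexI[of _ id]) (auto simp: pfix_def)
next
  case (insert y Y)
  then obtain t where t: "t \<in> pfix B" "\<And>y z. y \<in> Y - B \<Longrightarrow> z \<in> W - B \<Longrightarrow> c (t y) z = 1" by blast
  note tG = pfixD(1)[OF t(1)]
  show ?case
  proof (cases "y \<in> B")
    case True
    then show ?thesis using t by (intro bexI[of _ t]) auto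
  next
    case False
    have "t y \<notin> t ` (B \<union> Y)" using False insert.hyps(2) G_eq_iff[OF tG] by auto
    moreover have "finite (t ` (B \<union> Y))" using assms(1) insert.hyps(1) by simp
    ultimately obtain y' where y': "\<And>z. z \<in> t ` (B \<union> Y) \<Longrightarrow> c y' z = c (t y) z" "\<And>z. z \<in> W - t ` (B \<union> Y) \<Longrightarrow> c y' z = 1"
      using free_extension[of "t ` (B \<union> Y)" W "t y"] assms(3) by blast
    have A: "c y' (t d) = c y d" if "d \<in> B \<union> Y" for d
      using y'(1)[of "t d"] that G_c[OF tG, of y d] by auto
    have "\<exists>g\<in>G. \<forall>z\<in>insert y (B \<union> Y). g z = (t(y := y')) z"
    proof (rule homogeneous)
      fix a b assume ab: "a \<in> insert y (B \<union> Y)" "b \<in> insert y (B \<union> Y)"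
      have n: "d \<noteq> y" if "d \<in> B \<union> Y" for d using that False insert.hyps(2) by auto
      consider "a = y" "b = y" | "a = y" "b \<in> B \<union> Y" | "a \<in> B \<union> Y" "b = y" | "a \<in> B \<union> Y" "b \<in> B \<union> Y"
        using ab by blast
      then show "c ((t(y := y')) a) ((t(y := y')) b) = c a b"
      proof cases
        case 1 then show ?thesis using c_zero by metis
      next
        case 2 then show ?thesis using A n by simp
      next
        case 3 then show ?thesis using A n c_sym[of a b] c_sym[of "t a" y'] by simp
      next
        case 4 then show ?thesis using n G_c[OF tG] by simp
      qed
    qed (use assms insert.hyps in simp)
    then obtain g where g: "g \<in> G" "\<And>z. z \<in> insert y (B \<union> Y) \<Longrightarrow> g z = (t(y := y')) z" by blast
    have gt: "g y = y'" "\<And>z. z \<in> B \<union> Y \<Longrightarrow> g z = t z" using g(2) False insert.hyps(2) by auto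
    have "g \<in> pfix B" using gt(2) pfixD(2)[OF t(1)] g(1) by (auto simp: pfix_def)
    moreover have "c y' z = 1" if z: "z \<in> W - B" for z
    proof -
      \<comment> \<open>A point of \<open>W - B\<close> in this image would be in color
        \<open>1\<close> to itself. So the freeness of \<open>y'\<close> covers all of
        \<open>W - B\<close>.\<close>
      have "z \<notin> t ` (B \<union> Y)"
      proof
        assume "z \<in> t ` (B \<union> Y)"
        then obtain d where d: "d \<in> B \<union> Y" "z = t d" by blast
        then have "d \<notin> B" using pfixD(2)[OF t(1)] z by auto
        then show False using t(2)[of d z] d z one_neq by blast
      qed
      then show ?thesis using y'(2) z by blast
    qed
    ultimately show ?thesis using t(2) gt by (intro bexI[of _ g]) auto
  qed
qed

text \<open>For \<open>x \<noteq> y\<close> some element fixing \<open>x\<close> sends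
  \<open>y\<close> to a point in color \<open>1\<close> to \<open>y\<close>, hence different from
  it.\<close>

lemma pfix_moves:
  assumes "pfix {x} \<subseteq> pfix {y}"
  shows "x = y"
proof (rule ccontr)
  assume "x \<noteq> y"
  obtain t where "t \<in> pfix {x}" "\<forall>b\<in>{y} - {x}. \<forall>z\<in>{y} - {x}. c (t b) z = 1"
    using pfix_move_free[of "{x}" "{y}" "{y}"] by auto
  then have "c (t y) y = 1" "t y = y" using \<open>x \<noteq> y\<close> assms pfixD(2)[of t "{y}" y] by auto
  then show False using one_neq by blast
qed

text \<open>After a correction by \<open>k \<in> pfix A\<close>, the image of \<open>A\<close> under
  \<open>g\<close> meets \<open>B\<close> only in \<open>A \<inter> B\<close>. A copy of
  \<open>A\<close> over \<open>B\<close>, obtained by \<open>t \<in> pfix B\<close> and free from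
  \<open>A\<close> and its image, then admits a single \<open>h \<in> G\<close> that equals
  \<open>g\<close> on \<open>A\<close> and is trivial on the copy. The latter puts \<open>h\<close>
  into \<open>L\<close>, since conjugating by \<open>t\<close> leads into \<open>pfix A\<close>; the
  former puts \<open>g\<close> into \<open>L\<close>.\<close>

lemma pfix_Int:
  assumes L: "psubgroup L" and A: "finite A" "pfix A \<subseteq> L" and B: "finite B" "pfix B \<subseteq> L"
  shows "pfix (A \<inter> B) \<subseteq> L"
proof
  fix g0 assume g0: "g0 \<in> pfix (A \<inter> B)"
  note g0G = pfixD(1)[OF g0]
  obtain k where k: "k \<in> pfix A" "\<And>y z. y \<in> g0 ` A - A \<Longrightarrow> z \<in> (A \<union> B) - A \<Longrightarrow> c (k y) z = 1"
    using pfix_move_free[of A "g0 ` A" "A \<union> B"] A(1) B(1) by auto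
  note kG = pfixD(1)[OF k(1)]
  define g where "g = k \<circ> g0"
  have gG: "g \<in> G" using kG g0G G_comp by (simp add: g_def)
  have gC: "g z = z" if "z \<in> A" "z \<in> B" for z
    using that pfixD(2)[OF g0] pfixD(2)[OF k(1)] by (simp add: g_def)
  have gAB: "g a \<in> A" if "a \<in> A" "g a \<in> B" for a
  proof (rule ccontr)
    assume *: "g a \<notin> A"
    then have "g0 a \<notin> A" using pfixD(2)[OF k(1), of "g0 a"] by (auto simp: g_def)
    then have "c (k (g0 a)) (g a) = 1" using k(2)[of "g0 a" "g a"] that * by auto
    then show False using one_neq by (auto simp: g_def)
  qed
  have gAB': "g a \<notin> B" if "a \<in> A" "a \<notin> B" for a
  proof
    assume "g a \<in> B"
    then have "g (g a) = g a" using gC gAB that by blast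
    then have "g a = a" using G_eq_iff[OF gG] by blast
    then show False using \<open>g a \<in> B\<close> that by simp
  qed
  obtain t where t: "t \<in> pfix B" "\<And>y z. y \<in> A - B \<Longrightarrow> z \<in> (A \<union> g ` A) - B \<Longrightarrow> c (t y) z = 1"
    using pfix_move_free[of B A "A \<union> g ` A"] A(1) B(1) by auto
  note tG = pfixD(1)[OF t(1)]
  have tC: "t z = z" if "z \<in> B" for z using that pfixD(2)[OF t(1)] by blast
  \<comment> \<open>\<open>f\<close> agrees with \<open>g\<close> on \<open>A\<close> and is the identity on the copy \<open>t A\<close> of \<open>A\<close> over \<open>B\<close>\<close>
  define f where "f z = (if z \<in> A then g z else z)" for z
  have ft: "f (t a) = t a" if a: "a \<in> A" for a
  proof (cases "t a \<in> A")
    case True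
    have "t a \<in> B"
    proof (rule ccontr)
      assume "t a \<notin> B"
      then have "a \<notin> B" using tC by auto
      then have "c (t a) (t a) = 1" using t(2)[of a "t a"] a True \<open>t a \<notin> B\<close> by blast
      then show False using one_neq by blast
    qed
    then show ?thesis using gC True by (simp add: f_def)
  qed (simp add: f_def)
  obtain h where h: "h \<in> G" "\<And>z. z \<in> A \<union> t ` A \<union> {} \<Longrightarrow> h z = f z"
  proof (rule partial_isoI[of A "t ` A" "{}" f])
    show "c (f a) (f b) = c a b" if "a \<in> A" "b \<in> A" for a b using that G_c[OF gG] by (simp add: f_def)
    show "c (f a) (f b) = c a b" if ab: "a \<in> A" "b \<in> t ` A" for a b
    proof -
      obtain a1 where a1: "a1 \<in> A" "b = t a1" using ab(2) by blast
      have fb: "f b = b" using ft a1 by simp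
      have fa: "f a = g a" using ab(1) by (simp add: f_def)
      show ?thesis
      proof (cases "a \<in> B")
        case True then show ?thesis using gC ab(1) fa fb by simp
      next
        case aB: False
        show ?thesis
        proof (cases "a1 \<in> B")
          case True
          then have "b = a1" "g a1 = a1" using tC gC a1 by auto
          then show ?thesis using fa fb G_c[OF gG, of a a1] by simp
        next
          case False
          \<comment> \<open>The copy of a point outside \<open>B\<close> is in color
            \<open>1\<close> to both \<open>a\<close> and \<open>g a\<close>; \<open>gAB'\<close>
            keeps \<open>g a\<close> out of \<open>B\<close>.\<close>
          then have "c b (g a) = 1" "c b a = 1" using t(2)[of a1 a] t(2)[of a1 "g a"] a1 ab(1) aB gAB' by auto
          then show ?thesis using fa fb c_sym by metis
        qed
      qed
    qed
    show "c (f a) (f b) = c a b" if "a \<in> t ` A" "b \<in> t ` A" for a b using that ft by auto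
  qed (use A in auto)
  have hA: "h a = g a" "h (t a) = t a" if "a \<in> A" for a using h(2)[of a] h(2)[of "t a"] ft that by (auto simp: f_def)
  note LD = psubgroupD[OF L]
  have tL: "t \<in> L" using t(1) B(2) by blast
  have "inv' t \<circ> h \<circ> t \<in> pfix A"
    using hA(2) G_inv_f[OF tG] G_comp G_inv tG h(1) by (simp add: pfix_def)
  then have hL: "h \<in> L" using psubgroup_cancel(2)[OF L tL] A(2) by (meson subsetD)
  have "inv' h (g a) = a" if "a \<in> A" for a using hA(1)[OF that] G_inv_f[OF h(1)] by metis
  then have "inv' h \<circ> g \<in> pfix A" using G_comp G_inv h(1) gG by (simp add: pfix_def)
  then have "g \<in> L" using psubgroup_cancel(1)[OF L hL] A(2) by (meson subsetD)
  moreover have "inv' k \<in> L" using LD(2) k(1) A(2) by (meson subsetD)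
  ultimately have "inv' k \<circ> g \<in> L" using LD(3) by (meson subsetD)
  moreover have "inv' k \<circ> g = g0" using G_inv_f[OF kG] by (simp add: fun_eq_iff g_def)
  ultimately show "g0 \<in> L" by simp
qed

text \<open>For \<open>g \<in> L\<close> the image of a support \<open>A\<close> is again a support,
  and by \<open>pfix_Int\<close> so is its intersection with \<open>A\<close>. Minimal cardinality
  of \<open>A\<close> forces equality.\<close>

lemma open_psubgroup_support:
  assumes L: "psubgroup L" and F: "finite F" "pfix F \<subseteq> L"
  obtains A where "finite A" "pfix A \<subseteq> L" "\<And>g. g \<in> L \<Longrightarrow> g ` A = A"
proof -
  note LD = psubgroupD[OF L]
  have "\<exists>A. (finite A \<and> pfix A \<subseteq> L) \<and> (\<forall>B. finite B \<and> pfix B \<subseteq> L \<longrightarrow> card A \<le> card B)"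
    using ex_has_least_nat[of "\<lambda>A. finite A \<and> pfix A \<subseteq> L" F card] F by simp
  then obtain A where A: "finite A" "pfix A \<subseteq> L" and least: "\<And>B. finite B \<Longrightarrow> pfix B \<subseteq> L \<Longrightarrow> card A \<le> card B"
    by auto
  have "g ` A = A" if g: "g \<in> L" for g
  proof -
    note gG = LD(1)[OF g]
    have "pfix (g ` A) \<subseteq> L"
    proof
      fix h assume h: "h \<in> pfix (g ` A)"
      have "inv' g \<circ> h \<circ> g \<in> pfix A"
        using pfixD[OF h] G_inv_f[OF gG] G_comp G_inv gG by (simp add: pfix_def)
      then show "h \<in> L" using psubgroup_cancel(2)[OF L g] A(2) by (meson subsetD)
    qed
    then have "pfix (A \<inter> g ` A) \<subseteq> L" using pfix_Int[OF L A(1,2)] A(1) by blast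
    then have "card A \<le> card (A \<inter> g ` A)" using A(1) by (intro least) simp
    then have "A \<inter> g ` A = A" using A(1) by (metis Int_lower1 card_seteq)
    moreover have "card (g ` A) = card A" using G_eq_iff[OF gG] by (intro card_image inj_onI) blast
    ultimately show ?thesis using A(1) by (metis Int_lower2 card_seteq finite_imageI order_refl)
  qed
  then show ?thesis using A that by blast
qed

section \<open>Abstract automorphisms and point stabilizers\<close>

definition is_aut :: "((nat \<Rightarrow> nat) \<Rightarrow> (nat \<Rightarrow> nat)) \<Rightarrow> bool" where
  "is_aut \<phi> \<longleftrightarrow> bij_betw \<phi> G G \<and> (\<forall>g\<in>G. \<forall>h\<in>G. \<phi> (g \<circ> h) = \<phi> g \<circ> \<phi> h)"

lemma is_autD:
  assumes "is_aut \<phi>"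
  shows "g \<in> G \<Longrightarrow> \<phi> g \<in> G" "g \<in> G \<Longrightarrow> h \<in> G \<Longrightarrow> \<phi> (g \<circ> h) = \<phi> g \<circ> \<phi> h"
    "g \<in> G \<Longrightarrow> h \<in> G \<Longrightarrow> \<phi> g = \<phi> h \<longleftrightarrow> g = h" "\<phi> ` G = G" "\<phi> id = id"
    "g \<in> G \<Longrightarrow> \<phi> (inv' g) = inv' (\<phi> g)"
proof -
  show *: "g \<in> G \<Longrightarrow> \<phi> g \<in> G" "g \<in> G \<Longrightarrow> h \<in> G \<Longrightarrow> \<phi> (g \<circ> h) = \<phi> g \<circ> \<phi> h"
    "g \<in> G \<Longrightarrow> h \<in> G \<Longrightarrow> \<phi> g = \<phi> h \<longleftrightarrow> g = h" "\<phi> ` G = G" for g h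
    using assms unfolding is_aut_def by (auto simp: bij_betw_def inj_on_def)
  have "\<phi> id \<circ> \<phi> id = \<phi> id" using *(2)[of id id] by simp
  then have "\<phi> id (\<phi> id x) = \<phi> id x" for x by (metis comp_apply)
  then show 1: "\<phi> id = id" using G_eq_iff[OF *(1)[OF G_id(1)]] by (metis eq_id_iff)
  show "\<phi> (inv' g) = inv' (\<phi> g)" if g: "g \<in> G"
  proof -
    have "\<phi> g \<circ> \<phi> (inv' g) = id" "\<phi> (inv' g) \<circ> \<phi> g = id"
      using *(2)[OF g G_inv[OF g]] *(2)[OF G_inv[OF g] g] G_comp_inv[OF g] 1 by simp_all
    then show ?thesis by (metis inv_unique_comp)
  qed
qed

lemma is_aut_inv:
  assumes "is_aut \<phi>"
  shows "is_aut (inv_into G \<phi>)"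
proof -
  have b: "bij_betw \<phi> G G" using assms by (simp add: is_aut_def)
  have b': "bij_betw (inv_into G \<phi>) G G" using b by (rule bij_betw_inv_into)
  have "inv_into G \<phi> (g \<circ> h) = inv_into G \<phi> g \<circ> inv_into G \<phi> h" if "g \<in> G" "h \<in> G" for g h
  proof -
    let ?g = "inv_into G \<phi> g" and ?h = "inv_into G \<phi> h"
    have "?g \<in> G" "?h \<in> G" "\<phi> ?g = g" "\<phi> ?h = h"
      using that b b' by (auto simp: bij_betw_inv_into_right bij_betwE)
    then have "\<phi> (?g \<circ> ?h) = g \<circ> h" "?g \<circ> ?h \<in> G" using is_autD(2)[OF assms] G_comp by auto
    then show ?thesis using bij_betw_inv_into_left[OF b] by metis
  qed
  then show ?thesis using b' by (simp add: is_aut_def)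
qed

lemma psubgroup_pfix: "psubgroup (pfix F)"
proof -
  have "inv' g x = x" if "g \<in> G" "g x = x" for g x using G_inv_f[OF that(1)] that(2) by metis
  then show ?thesis using G_comp G_inv by (auto simp: psubgroup_def pfix_def)
qed

lemma psubgroup_image:
  assumes \<phi>: "is_aut \<phi>" and H: "psubgroup H"
  shows "psubgroup (\<phi> ` H)"
proof -
  note P = is_autD[OF \<phi>] note HD = psubgroupD[OF H]
  have id: "id \<in> H" using H by (simp add: psubgroup_def)
  show ?thesis unfolding psubgroup_def
  proof (intro conjI ballI)
    show "\<phi> ` H \<subseteq> G" using HD(1) P(1) by blast
    show "id \<in> \<phi> ` H" using id P(5) by (metis imageI)
    fix g' assume "g' \<in> \<phi> ` H"
    then obtain g where g: "g \<in> H" "g' = \<phi> g" by blast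
    then show "inv' g' \<in> \<phi> ` H" using P(6)[OF HD(1)] HD(2) by (metis imageI)
    fix h' assume "h' \<in> \<phi> ` H"
    then obtain h where h: "h \<in> H" "h' = \<phi> h" by blast
    then show "g' \<circ> h' \<in> \<phi> ` H" using P(2)[OF HD(1) HD(1)] HD(3) g by (metis imageI)
  qed
qed

lemma is_aut_link:
  assumes \<phi>: "is_aut \<phi>" and a: "a \<in> G" and gh: "g \<in> G" "h \<in> G"
  shows "(\<phi> g, \<phi> h) \<in> link (\<phi> a) \<longleftrightarrow> (g, h) \<in> link a"
proof -
  note P = is_autD[OF \<phi>]
  have cG: "conjug g a \<in> G" if "g \<in> G" for g using that a G_comp G_inv by (simp add: conjug_def)
  have cj: "\<phi> (conjug g a) = conjug (\<phi> g) (\<phi> a)" if "g \<in> G" for g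
    using that a P(2,6) G_comp G_inv by (simp add: conjug_def)
  have "conjug (\<phi> g) (\<phi> a) \<circ> conjug (\<phi> h) (\<phi> a) = \<phi> (conjug g a \<circ> conjug h a)"
    "conjug (\<phi> h) (\<phi> a) \<circ> conjug (\<phi> g) (\<phi> a) = \<phi> (conjug h a \<circ> conjug g a)"
    using P(2)[OF cG cG] gh cj by simp_all
  then show ?thesis using gh P(1) P(3)[OF G_comp G_comp] cG unfolding link_def by simp
qed

text \<open>In the description by chains, \<open>a\<close> is replaced by \<open>\<phi> a\<close>.
  As \<open>G\<close> is transitive, the cosets of the stabilizer are indexed by the image of
  \<open>x\<close>, a natural number; this gives countable index, also after applying
  \<phi>.\<close>

lemma image_point_stabilizer_open:
  assumes \<phi>: "is_aut \<phi>"
  obtains F where "finite F" "pfix F \<subseteq> \<phi> ` pfix {x}"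
proof -
  note P = is_autD[OF \<phi>]
  obtain a where a: "a \<in> Invol x" by (rule ex_Invol_gen_pos[OF G_id(1) G_id(1)])
  note aG = InvolD(1)[OF a]
  have stab: "pfix {x} = {h. (id, h) \<in> (link a)\<^sup>*}" using stabilizer_eq_link[OF a] by (simp add: pfix_def)
  have eq: "\<phi> ` pfix {x} = {h. (id, h) \<in> (link (\<phi> a))\<^sup>*}"
  proof (intro equalityI subsetI)
    fix h' assume "h' \<in> \<phi> ` pfix {x}"
    then obtain h where h: "h' = \<phi> h" "(id, h) \<in> (link a)\<^sup>*" unfolding stab by blast
    from h(2) have "(id, \<phi> h) \<in> (link (\<phi> a))\<^sup>*"
    proof (induction rule: rtrancl_induct)
      case base then show ?case unfolding P(5) by (rule rtrancl.rtrancl_refl)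
    next
      case (step g k)
      then have "(\<phi> g, \<phi> k) \<in> link (\<phi> a)" using is_aut_link[OF \<phi> aG, of g k] by (auto simp: link_def)
      then show ?case using step.IH by simp
    qed
    then show "h' \<in> {h. (id, h) \<in> (link (\<phi> a))\<^sup>*}" using h(1) by simp
  next
    fix h assume "h \<in> {h. (id, h) \<in> (link (\<phi> a))\<^sup>*}"
    then have "(id, h) \<in> (link (\<phi> a))\<^sup>*" by simp
    then show "h \<in> \<phi> ` pfix {x}"
    proof (induction rule: rtrancl_induct)
      case base then show ?case using P(5) unfolding stab by (metis CollectI imageI rtrancl.rtrancl_refl)
    next
      case (step g k)
      obtain g' where g': "g' \<in> pfix {x}" "g = \<phi> g'" using step.IH by blast
      have "k \<in> G" using step.hyps by (simp add: link_def)
      then obtain k' where k': "k' \<in> G" "k = \<phi> k'" using P(4) by blast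
      have "(g', k') \<in> link a" using step.hyps(2) is_aut_link[OF \<phi> aG pfixD(1)[OF g'(1)] k'(1)] g' k' by simp
      then have "k' \<in> pfix {x}" using g'(1) unfolding stab by (simp add: rtrancl.rtrancl_into_rtrancl)
      then show ?case using k'(2) by blast
    qed
  qed
  have "\<exists>g\<in>G. g x = i" for i
    using homogeneous[of "{x}" "\<lambda>_. i"] c_zero by (metis finite.emptyI finite.insertI singletonD singletonI)
  then obtain k where k: "\<And>i. k i \<in> G" "\<And>i. k i x = i" by metis
  have index: "G \<subseteq> (\<Union>i. (\<circ>) (\<phi> (k i)) ` \<phi> ` pfix {x})"
  proof
    fix h assume "h \<in> G"
    then obtain g where g: "g \<in> G" "h = \<phi> g" using P(4) by blast
    define i where "i = g x"
    have "inv' (k i) i = x" using k(2)[of i] G_inv_f[OF k(1)[of i]] by metis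
    then have "inv' (k i) \<circ> g \<in> pfix {x}" using G_comp[OF G_inv[OF k(1)] g(1)] by (simp add: pfix_def i_def)
    moreover have "\<phi> (k i) \<circ> \<phi> (inv' (k i) \<circ> g) = h"
    proof -
      have "k i \<circ> (inv' (k i) \<circ> g) = g" using G_f_inv[OF k(1)] by (simp add: fun_eq_iff)
      then show ?thesis using P(2)[OF k(1) G_comp[OF G_inv[OF k(1)] g(1)], of i i] g(2) by simp
    qed
    ultimately show "h \<in> (\<Union>i. (\<circ>) (\<phi> (k i)) ` \<phi> ` pfix {x})" by blast
  qed
  show ?thesis
    by (rule link_class_open[where k = "\<lambda>i. \<phi> (k i)", OF P(1)[OF aG] eq psubgroup_image[OF \<phi> psubgroup_pfix] P(1)[OF k(1)] index])
      (rule that)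
qed

text \<open>Otherwise, by injectivity of \<phi>, the stabilizer of \<open>x\<close> would be all of
  \<open>G\<close> and contain that of the different point \<open>Suc x\<close>.\<close>

lemma image_point_stabilizer_proper:
  assumes \<phi>: "is_aut \<phi>"
  shows "\<not> G \<subseteq> \<phi> ` pfix {x}"
proof
  assume *: "G \<subseteq> \<phi> ` pfix {x}"
  note P = is_autD[OF \<phi>]
  have "pfix {Suc x} \<subseteq> pfix {x}"
  proof
    fix g assume "g \<in> pfix {Suc x}"
    then have g: "g \<in> G" by (rule pfixD)
    then obtain h where "h \<in> pfix {x}" "\<phi> g = \<phi> h" using * P(1)[OF g] by blast
    then show "g \<in> pfix {x}" using P(3)[OF g, of h] pfixD(1)[of h] by simp
  qed
  then show False using pfix_moves[of "Suc x" x] by simp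
qed

text \<open>Write \<open>A\<close> for the support of \<open>\<phi> (pfix {x})\<close> and let \<open>a \<in> A\<close>. Modulo \<open>V = \<psi> (pfix {a})\<close> the
  stabilizer of \<open>x\<close> has finitely many cosets, as \<open>a\<close> moves only within \<open>A\<close>. So the support \<open>B\<close> of \<open>V\<close>
  has a finite orbit under the stabilizer of \<open>x\<close>, which forces \<open>B = {x}\<close>.\<close>

lemma image_point_stabilizer:
  assumes \<phi>: "is_aut \<phi>"
  obtains a where "\<phi> ` pfix {x} = pfix {a}"
proof -
  note P = is_autD[OF \<phi>]
  define \<psi> where "\<psi> = inv_into G \<phi>"
  have \<psi>: "is_aut \<psi>" using is_aut_inv[OF \<phi>] by (simp add: \<psi>_def)
  note Q = is_autD[OF \<psi>]
  have bij: "bij_betw \<phi> G G" using \<phi> by (simp add: is_aut_def)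
  have \<psi>\<phi>: "\<psi> (\<phi> g) = g" "\<phi> (\<psi> g) = g" if "g \<in> G" for g
    using bij_betw_inv_into_left[OF bij that] bij_betw_inv_into_right[OF bij that] by (simp_all add: \<psi>_def)
  obtain F where "finite F" "pfix F \<subseteq> \<phi> ` pfix {x}" by (rule image_point_stabilizer_open[OF \<phi>])
  then obtain A where A: "finite A" "pfix A \<subseteq> \<phi> ` pfix {x}" "\<And>g. g \<in> \<phi> ` pfix {x} \<Longrightarrow> g ` A = A"
    using open_psubgroup_support[OF psubgroup_image[OF \<phi> psubgroup_pfix]] by metis
  have "A \<noteq> {}"
  proof
    assume "A = {}"
    then show False using A(2) image_point_stabilizer_proper[OF \<phi>] by (simp add: pfix_def)
  qed
  then obtain a where a: "a \<in> A" by blast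
  define V where "V = \<psi> ` pfix {a}"
  obtain F' where "finite F'" "pfix F' \<subseteq> V" unfolding V_def by (rule image_point_stabilizer_open[OF \<psi>])
  then obtain B where B: "finite B" "pfix B \<subseteq> V" "\<And>g. g \<in> V \<Longrightarrow> g ` B = B"
    using open_psubgroup_support[OF psubgroup_image[OF \<psi> psubgroup_pfix]] unfolding V_def by metis
  define Z where "Z = (\<Union>g\<in>pfix {x}. g ` B)"
  \<comment> \<open>The image of \<open>B\<close> under \<open>g\<close> depends only on
    \<open>\<phi> g a\<close>, a point of the finite set \<open>A\<close>; this bounds the number of
    images.\<close>
  have BZ: "g ` B = g' ` B" if g: "g \<in> pfix {x}" "g' \<in> pfix {x}" "\<phi> g a = \<phi> g' a" for g g'
  proof -
    note gG = pfixD(1)[OF g(1)] pfixD(1)[OF g(2)]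
    have *: "inv' g \<circ> g' \<in> G" using gG G_comp G_inv by blast
    have "\<phi> (inv' g \<circ> g') = inv' (\<phi> g) \<circ> \<phi> g'" using P(2)[OF G_inv[OF gG(1)] gG(2)] P(6)[OF gG(1)] by simp
    then have "\<phi> (inv' g \<circ> g') a = a" using g(3) G_inv_f[OF P(1)[OF gG(1)]] by (metis comp_apply)
    then have "\<phi> (inv' g \<circ> g') \<in> pfix {a}" using P(1)[OF *] by (simp add: pfix_def)
    then have "inv' g \<circ> g' \<in> V" unfolding V_def using \<psi>\<phi>(1)[OF *] by (metis imageI)
    then have "(inv' g \<circ> g') ` B = B" by (rule B(3))
    then have "g ` (inv' g \<circ> g') ` B = g ` B" by simp
    then show ?thesis using G_f_inv[OF gG(1)] by (simp add: image_comp o_def)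
  qed
  have "finite Z"
  proof -
    have "finite ((\<lambda>g. g ` B) ` pfix {x})"
    proof -
      define r where "r y = (SOME S. \<exists>g\<in>pfix {x}. \<phi> g a = y \<and> S = g ` B)" for y
      have "g ` B = r (\<phi> g a)" if "g \<in> pfix {x}" for g
        unfolding r_def by (rule someI2[of _ "g ` B"]) (use that BZ in blast)+
      moreover have "\<phi> g a \<in> A" if "g \<in> pfix {x}" for g using A(3)[of "\<phi> g"] that a by blast
      ultimately have "(\<lambda>g. g ` B) ` pfix {x} \<subseteq> r ` A" by blast
      then show ?thesis using A(1) finite_subset by blast
    qed
    then show ?thesis unfolding Z_def using B(1) by blast
  qed
  \<comment> \<open>A point of \<open>B\<close> other than \<open>x\<close> could be moved, with
    \<open>x\<close> fixed, into color \<open>1\<close> to all of \<open>Z - {x}\<close>, yet its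
    image lies in that set.\<close>
  have "B \<subseteq> {x}"
  proof
    fix b assume b: "b \<in> B"
    show "b \<in> {x}"
    proof (rule ccontr)
      assume bx: "b \<notin> {x}"
      obtain t where t: "t \<in> pfix {x}" "\<forall>y\<in>{b} - {x}. \<forall>z\<in>Z - {x}. c (t y) z = 1"
        using pfix_move_free[of "{x}" "{b}" Z] \<open>finite Z\<close> by auto
      have "t b \<in> Z" using t(1) b unfolding Z_def by blast
      moreover have "t b \<noteq> x" using pfixD[OF t(1)] bx G_eq_iff[OF pfixD(1)[OF t(1)], of b x] by auto
      ultimately have "c (t b) (t b) = 1" using t(2) bx by blast
      then show False using one_neq by blast
    qed
  qed
  moreover have "B \<noteq> {}"
  proof
    assume "B = {}"
    then show False using B(2) image_point_stabilizer_proper[OF \<psi>] by (simp add: pfix_def V_def)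
  qed
  ultimately have B_eq: "B = {x}" by blast
  have VG: "V \<subseteq> G" unfolding V_def using Q(1) pfixD(1) by blast
  have "V = pfix {x}" using B(2,3) VG unfolding B_eq by (auto simp: pfix_def)
  then have "\<phi> ` pfix {x} = \<phi> ` \<psi> ` pfix {a}" by (simp add: V_def)
  also have "\<dots> = pfix {a}" using \<psi>\<phi>(2) pfixD(1) by (force simp: image_iff)
  finally show ?thesis by (rule that)
qed

text \<open>\<open>f x\<close> is the point whose stabilizer is the image of that of
  \<open>x\<close>. Conjugating stabilizers gives \<open>f (g x) = \<phi> g (f x)\<close>, and the
  inverse automorphism supplies surjectivity.\<close>

lemma automorphism_induced:
  assumes \<phi>: "is_aut \<phi>"
  obtains f where "bij f" "\<And>g. g \<in> G \<Longrightarrow> \<phi> g = f \<circ> g \<circ> inv' f"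
proof -
  note P = is_autD[OF \<phi>]
  have "\<exists>a. \<phi> ` pfix {x} = pfix {a}" for x by (rule image_point_stabilizer[OF \<phi>]) blast
  then obtain f where f: "\<And>x. \<phi> ` pfix {x} = pfix {f x}" by metis
  have fg: "f (g x) = \<phi> g (f x)" if g: "g \<in> G" for g x
  proof (rule pfix_moves, rule subsetI)
    fix k assume "k \<in> pfix {f (g x)}"
    then obtain h where h: "h \<in> pfix {g x}" "k = \<phi> h" using f by blast
    note hG = pfixD(1)[OF h(1)]
    have "h (g x) = g x" using pfixD(2)[OF h(1)] by simp
    then have i: "inv' g \<circ> (h \<circ> g) \<in> pfix {x}"
      using G_inv_f[OF g] G_comp[OF G_inv[OF g] G_comp[OF hG g]] by (simp add: pfix_def)
    have "\<phi> (inv' g \<circ> (h \<circ> g)) = inv' (\<phi> g) \<circ> (k \<circ> \<phi> g)"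
      using P(2)[OF G_inv[OF g] G_comp[OF hG g]] P(2)[OF hG g] P(6)[OF g] h(2) by simp
    then have "inv' (\<phi> g) \<circ> (k \<circ> \<phi> g) \<in> pfix {f x}" using i f by (metis imageI)
    then have "inv' (\<phi> g) (k (\<phi> g (f x))) = f x" using pfixD(2) by fastforce
    then have "k (\<phi> g (f x)) = \<phi> g (f x)" using G_f_inv[OF P(1)[OF g]] by metis
    then show "k \<in> pfix {\<phi> g (f x)}" using P(1)[OF hG] h(2) by (simp add: pfix_def)
  qed
  have "inj f"
  proof (rule injI)
    fix x y assume "f x = f y"
    then have "\<phi> ` pfix {x} = \<phi> ` pfix {y}" using f by simp
    moreover have "inj_on \<phi> G" using P(3) by (auto intro: inj_onI)
    ultimately have "pfix {x} = pfix {y}"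
      using inj_on_image_eq_iff[of \<phi> G "pfix {x}" "pfix {y}"] pfixD(1) by blast
    then show "x = y" using pfix_moves by blast
  qed
  moreover have "surj f"
    unfolding surj_def
  proof
    fix a
    have bij: "bij_betw \<phi> G G" using \<phi> by (simp add: is_aut_def)
    obtain x where x: "inv_into G \<phi> ` pfix {a} = pfix {x}" by (rule image_point_stabilizer[OF is_aut_inv[OF \<phi>]])
    have "\<phi> ` inv_into G \<phi> ` pfix {a} = pfix {a}"
      using bij_betw_inv_into_right[OF bij] pfixD(1) by (force simp: image_iff)
    then have "pfix {f x} = pfix {a}" using x f by simp
    then show "\<exists>x. a = f x" using pfix_moves by blast
  qed
  ultimately have bf: "bij f" by (simp add: bij_def)
  have "\<phi> g = f \<circ> g \<circ> inv' f" if "g \<in> G" for g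
    using fg[OF that] bf by (simp add: fun_eq_iff bij_is_surj surj_f_inv_f)
  then show ?thesis using bf that by blast
qed

text \<open>\<open>inv' f' \<circ> f\<close> commutes with \<open>G\<close>, so the stabilizer of
  \<open>x\<close> fixes the image of \<open>x\<close> under it; but that stabilizer fixes no point
  other than \<open>x\<close>.\<close>

lemma induced_unique:
  fixes f f' :: "nat \<Rightarrow> nat"
  assumes "bij f" "bij f'" "\<And>g. g \<in> G \<Longrightarrow> f \<circ> g \<circ> inv' f = f' \<circ> g \<circ> inv' f'"
  shows "f = f'"
proof -
  define k where "k = inv' f' \<circ> f"
  have i: "inv' f (f x) = x" "inv' f' (f' x) = x" "f' (inv' f' x) = x" for x
    using assms(1,2) by (simp_all add: bij_is_inj bij_is_surj surj_f_inv_f)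
  have kg: "k (g x) = g (k x)" if "g \<in> G" for g x
    using fun_cong[OF assms(3)[OF that], of "f x"] i by (simp add: k_def)
  have "k x = x" for x
  proof -
    have "pfix {x} \<subseteq> pfix {k x}" using kg by (auto simp: pfix_def) metis
    then show ?thesis using pfix_moves by metis
  qed
  then show ?thesis using i(3) by (metis comp_apply ext k_def)
qed

text \<open>Pairs of equal color are carried to each other by some \<open>g \<in> G\<close>; the
  conjugate of \<open>g\<close> by \<open>f\<close> carries one image pair to the other and
  preserves \<open>c\<close>.\<close>

lemma normalizer_colors:
  assumes f: "bij f" "\<And>g. g \<in> G \<Longrightarrow> f \<circ> g \<circ> inv' f \<in> G" and eq: "c x y = c x' y'"
  shows "c (f x) (f y) = c (f x') (f y')"
proof -
  have xy: "x = y \<longleftrightarrow> x' = y'" using eq c_zero by metis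
  have zz: "c z z = 0" for z by simp
  have "\<exists>g\<in>G. \<forall>z\<in>{x, y}. g z = (if z = x then x' else y')"
  proof (rule homogeneous)
    fix a b assume "a \<in> {x, y}" "b \<in> {x, y}"
    then show "c (if a = x then x' else y') (if b = x then x' else y') = c a b"
      using eq xy zz c_sym[of x y] c_sym[of x' y'] by (cases "x = y") (auto simp del: c_zero)
  qed simp
  then obtain g where g: "g \<in> G" "g x = x'" "g y = y'" using xy by auto
  have i: "inv' f (f x) = x" for x using f(1) by (simp add: bij_is_inj)
  have "c ((f \<circ> g \<circ> inv' f) (f x)) ((f \<circ> g \<circ> inv' f) (f y)) = c (f x) (f y)"
    using G_c[OF f(2)[OF g(1)]] by blast
  then show ?thesis using g i by simp
qed

section \<open>Outer automorphisms as permutations of colors\<close>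

text \<open>Both conjugations are demanded, so that \<open>f\<close> normalizes \<open>G\<close> and
  does not merely conjugate it into itself.\<close>

definition perm_normalizer :: "(nat \<Rightarrow> nat) set" where
  "perm_normalizer = {f. bij f \<and> (\<forall>g\<in>G. f \<circ> g \<circ> inv' f \<in> G \<and> inv' f \<circ> g \<circ> f \<in> G)}"

lemma bij_inv_simps:
  assumes "bij (f :: nat \<Rightarrow> nat)"
  shows "inv' f (f x) = x" "f (inv' f x) = x"
  using assms by (simp_all add: bij_is_inj bij_is_surj surj_f_inv_f)

lemma normalizer_color_eq:
  assumes f: "f \<in> perm_normalizer"
  shows "c (f x) (f y) = c (f x') (f y') \<longleftrightarrow> c x y = c x' y'"
proof
  have b: "bij f" using f by (simp add: perm_normalizer_def)
  show "c (f x) (f y) = c (f x') (f y')" if "c x y = c x' y'"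
    by (rule normalizer_colors[OF b _ that]) (use f in \<open>simp add: perm_normalizer_def\<close>)
  assume eq: "c (f x) (f y) = c (f x') (f y')"
  have "c (inv' f (f x)) (inv' f (f y)) = c (inv' f (f x')) (inv' f (f y'))"
  proof (rule normalizer_colors[OF bij_imp_bij_inv[OF b] _ eq])
    fix g assume "g \<in> G"
    then show "inv' f \<circ> g \<circ> inv' (inv' f) \<in> G" using f b by (simp add: perm_normalizer_def inv_inv_eq)
  qed
  then show "c x y = c x' y'" by (simp add: bij_inv_simps[OF b])
qed

lemma G_normalizer: "g \<in> G \<Longrightarrow> g \<in> perm_normalizer"
  using G_comp G_inv G_bij by (simp add: perm_normalizer_def)

lemma perm_normalizer_comp:
  assumes "f \<in> perm_normalizer" "f' \<in> perm_normalizer"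
  shows "f \<circ> f' \<in> perm_normalizer"
proof -
  have b: "bij f" "bij f'" using assms by (auto simp: perm_normalizer_def)
  have "f \<circ> (f' \<circ> g \<circ> inv' f') \<circ> inv' f \<in> G" "inv' f' \<circ> (inv' f \<circ> g \<circ> f) \<circ> f' \<in> G" if "g \<in> G" for g
    using that assms unfolding perm_normalizer_def by blast+
  then show ?thesis using b by (simp add: perm_normalizer_def bij_comp o_inv_distrib comp_assoc)
qed

end

text \<open>\<open>H\<close> will be \<open>Aut_str\<close>, whose elements are extensional maps on
  an arbitrary universe; \<theta> identifies it with a group of permutations of the natural
  numbers.\<close>

locale group_of_coloring = free_homogeneous c + group H
  for c and H :: "('h, 'm) monoid_scheme" (structure) +
  fixes \<theta> :: "'h \<Rightarrow> nat \<Rightarrow> nat"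
  assumes \<theta>_bij: "bij_betw \<theta> (carrier H) (col_aut c)"
    and \<theta>_mult: "x \<in> carrier H \<Longrightarrow> y \<in> carrier H \<Longrightarrow> \<theta> (x \<otimes> y) = \<theta> x \<circ> \<theta> y"
begin

definition \<theta>' :: "(nat \<Rightarrow> nat) \<Rightarrow> 'h" where "\<theta>' = inv_into (carrier H) \<theta>"

lemma \<theta>_inverse:
  "x \<in> carrier H \<Longrightarrow> \<theta> x \<in> G" "g \<in> G \<Longrightarrow> \<theta>' g \<in> carrier H" "x \<in> carrier H \<Longrightarrow> \<theta>' (\<theta> x) = x" "g \<in> G \<Longrightarrow> \<theta> (\<theta>' g) = g"
  using \<theta>_bij bij_betw_inv_into[OF \<theta>_bij] unfolding \<theta>'_def
  by (auto simp: bij_betw_inv_into_left bij_betw_inv_into_right dest: bij_betwE)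

lemma \<theta>'_mult: "g \<in> G \<Longrightarrow> h \<in> G \<Longrightarrow> \<theta>' (g \<circ> h) = \<theta>' g \<otimes> \<theta>' h"
  by (metis \<theta>_inverse \<theta>_mult m_closed)

lemma \<theta>_m_inv: 
  assumes x: "x \<in> carrier H" 
  shows "\<theta> (inv x) = inv' (\<theta> x)"
proof -
  have "\<theta> \<one> \<circ> \<theta> \<one> = \<theta> \<one>" using \<theta>_mult[of \<one> \<one>] by simp
  then have "\<theta> \<one> (\<theta> \<one> z) = \<theta> \<one> z" for z by (metis comp_apply)
  then have 1: "\<theta> \<one> = id" using G_eq_iff[OF \<theta>_inverse(1)[OF one_closed]] by (metis eq_id_iff)
  have "\<theta> x \<circ> \<theta> (inv x) = id" "\<theta> (inv x) \<circ> \<theta> x = id"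
    using \<theta>_mult[of x "inv x"] \<theta>_mult[of "inv x" x] x 1 by simp_all
  then show ?thesis by (metis inv_unique_comp)
qed

definition induces :: "(nat \<Rightarrow> nat) \<Rightarrow> ('h \<Rightarrow> 'h) \<Rightarrow> bool" where
  "induces f \<phi> \<longleftrightarrow> f \<in> perm_normalizer \<and> (\<forall>x\<in>carrier H. \<theta> (\<phi> x) = f \<circ> \<theta> x \<circ> inv' f)"

lemma autoD:
  assumes "\<phi> \<in> auto H"
  shows "x \<in> carrier H \<Longrightarrow> \<phi> x \<in> carrier H" "x \<in> carrier H \<Longrightarrow> y \<in> carrier H \<Longrightarrow> \<phi> (x \<otimes> y) = \<phi> x \<otimes> \<phi> y"
    "bij_betw \<phi> (carrier H) (carrier H)" "\<phi> \<in> extensional (carrier H)"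
  using assms by (auto simp: auto_def hom_def Bij_def)

lemma ex_induces:
  assumes \<phi>: "\<phi> \<in> auto H"
  obtains f where "induces f \<phi>"
proof -
  note A = autoD[OF \<phi>]
  define \<psi> where "\<psi> g = \<theta> (\<phi> (\<theta>' g))" for g
  have "bij_betw (\<theta> \<circ> \<phi> \<circ> \<theta>') G G"
    using bij_betw_inv_into[OF \<theta>_bij] A(3) \<theta>_bij unfolding \<theta>'_def by (blast intro: bij_betw_trans)
  then have bij: "bij_betw \<psi> G G" by (simp add: \<psi>_def[abs_def] comp_def)
  moreover have "\<psi> (g \<circ> h) = \<psi> g \<circ> \<psi> h" if "g \<in> G" "h \<in> G" for g h
    using that \<theta>'_mult \<theta>_mult A(1,2) \<theta>_inverse(2) by (simp add: \<psi>_def)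
  ultimately have "is_aut \<psi>" by (simp add: is_aut_def)
  then obtain f where f: "bij f" "\<And>g. g \<in> G \<Longrightarrow> \<psi> g = f \<circ> g \<circ> inv' f" by (rule automorphism_induced) (rule that)
  have "f \<in> perm_normalizer" unfolding perm_normalizer_def
  proof (intro CollectI conjI ballI)
    fix g assume g: "g \<in> G"
    show "f \<circ> g \<circ> inv' f \<in> G" using f(2)[OF g] bij g by (metis bij_betwE)
    obtain g' where g': "g' \<in> G" "g = \<psi> g'" using bij g by (metis bij_betw_imp_surj_on imageE)
    have "inv' f \<circ> g \<circ> f = g'" using g' f(2) by (simp add: fun_eq_iff bij_inv_simps[OF f(1)])
    then show "inv' f \<circ> g \<circ> f \<in> G" using g' by simp
  qed (rule f)
  moreover have "\<theta> (\<phi> x) = f \<circ> \<theta> x \<circ> inv' f" if "x \<in> carrier H" for x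
    using f(2)[OF \<theta>_inverse(1)[OF that]] \<theta>_inverse(3)[OF that] by (simp add: \<psi>_def)
  ultimately have "induces f \<phi>" by (simp add: induces_def)
  then show ?thesis by (rule that)
qed

lemma induces_unique:
  assumes "induces f \<phi>" "induces f' \<phi>"
  shows "f = f'"
proof (rule induced_unique)
  show "bij f" "bij f'" using assms by (auto simp: induces_def perm_normalizer_def)
  fix g assume "g \<in> G"
  then have "\<theta>' g \<in> carrier H" "\<theta> (\<theta>' g) = g" using \<theta>_inverse by auto
  then show "f \<circ> g \<circ> inv' f = f' \<circ> g \<circ> inv' f'" using assms unfolding induces_def by metis
qed

lemma ex_auto_induced:
  assumes f: "f \<in> perm_normalizer"
  obtains \<phi> where "\<phi> \<in> auto H" "induces f \<phi>"
proof -
  have b: "bij f" using f by (simp add: perm_normalizer_def)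
  define T where "T g = f \<circ> g \<circ> inv' f" for g
  define T' where "T' g = inv' f \<circ> g \<circ> f" for g
  have TG: "T g \<in> G" "T' g \<in> G" if "g \<in> G" for g using f that by (simp_all add: perm_normalizer_def T_def T'_def)
  have TT: "T' (T g) = g" "T (T' g) = g" "T (g \<circ> h) = T g \<circ> T h" for g h
    by (simp_all add: T_def T'_def fun_eq_iff bij_inv_simps[OF b])
  define \<phi> where "\<phi> = (\<lambda>x\<in>carrier H. \<theta>' (T (\<theta> x)))"
  have \<phi>H: "\<phi> x \<in> carrier H" if "x \<in> carrier H" for x using that TG \<theta>_inverse by (simp add: \<phi>_def)
  have "bij_betw \<phi> (carrier H) (carrier H)"
  proof (rule bij_betw_byWitness[where f' = "\<lambda>x. \<theta>' (T' (\<theta> x))"])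
    show "\<forall>x\<in>carrier H. \<theta>' (T' (\<theta> (\<phi> x))) = x" "\<forall>x\<in>carrier H. \<phi> (\<theta>' (T' (\<theta> x))) = x"
      using TG TT \<theta>_inverse by (simp_all add: \<phi>_def)
    show "\<phi> ` carrier H \<subseteq> carrier H" using \<phi>H by blast
    show "(\<lambda>x. \<theta>' (T' (\<theta> x))) ` carrier H \<subseteq> carrier H" using TG \<theta>_inverse by auto
  qed
  moreover have "\<phi> (x \<otimes> y) = \<phi> x \<otimes> \<phi> y" if "x \<in> carrier H" "y \<in> carrier H" for x y
    using that TG TT(3) \<theta>_inverse \<theta>_mult \<theta>'_mult by (simp add: \<phi>_def)
  ultimately have "\<phi> \<in> auto H" using \<phi>H by (auto simp: auto_def hom_def Bij_def \<phi>_def)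
  moreover have "induces f \<phi>" using f TG \<theta>_inverse by (simp add: induces_def \<phi>_def T_def)
  ultimately show ?thesis by (rule that)
qed

text \<open>The inner automorphism of \<open>g\<close> is induced by \<open>\<theta> g\<close>, and
  the inducing permutation is unique, so no permutation outside \<open>G\<close> induces an inner
  one.\<close>

lemma induces_inner:
  assumes \<phi>: "\<phi> \<in> auto H" and f: "induces f \<phi>"
  shows "f \<in> G \<longleftrightarrow> \<phi> \<in> Inn H"
proof
  assume fG: "f \<in> G"
  define g where "g = \<theta>' f"
  have g: "g \<in> carrier H" "\<theta> g = f" using \<theta>_inverse fG by (auto simp: g_def)
  have "\<phi> = (\<lambda>x\<in>carrier H. g \<otimes> x \<otimes> inv g)"
  proof (rule extensionalityI[OF autoD(4)[OF \<phi>] restrict_extensional])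
    fix x assume x: "x \<in> carrier H"
    have "\<theta> (\<phi> x) = \<theta> (g \<otimes> x \<otimes> inv g)"
      using f x g \<theta>_mult \<theta>_m_inv by (simp add: induces_def)
    then have "\<phi> x = g \<otimes> x \<otimes> inv g" using autoD(1)[OF \<phi> x] x g \<theta>_inverse(3) by (metis inv_closed m_closed)
    then show "\<phi> x = (\<lambda>x\<in>carrier H. g \<otimes> x \<otimes> inv g) x" using x by simp
  qed
  then show "\<phi> \<in> Inn H" using g(1) by (auto simp: Inn_def)
next
  assume "\<phi> \<in> Inn H"
  then obtain g where g: "g \<in> carrier H" "\<phi> = (\<lambda>x\<in>carrier H. g \<otimes> x \<otimes> inv g)" by (auto simp: Inn_def)
  have "induces (\<theta> g) \<phi>"
    using g \<theta>_mult \<theta>_m_inv G_normalizer[OF \<theta>_inverse(1)] by (simp add: induces_def)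
  then have "f = \<theta> g" using f induces_unique by blast
  then show "f \<in> G" using \<theta>_inverse(1) g(1) by simp
qed

text \<open>\<open>I \<phi>\<close> is the unique permutation inducing \<phi>, so composing
  \<open>I\<close> with \<kappa> gives a homomorphism onto \<open>K\<close>. Its kernel is
  \<open>Inn H\<close>, and the first isomorphism theorem applies. The parameter \<kappa> stands for
  the action of the normalizer on colors.\<close>

lemma Out_iso_normalizer:
  fixes K (structure)
  assumes K: "group K"
    and mult: "\<And>f f'. f \<in> perm_normalizer \<Longrightarrow> f' \<in> perm_normalizer \<Longrightarrow> \<kappa> (f \<circ> f') = \<kappa> f \<otimes>\<^bsub>K\<^esub> \<kappa> f'"
    and range: "\<kappa> ` perm_normalizer = carrier K"
    and ker: "\<And>f. f \<in> perm_normalizer \<Longrightarrow> \<kappa> f = \<one>\<^bsub>K\<^esub> \<longleftrightarrow> f \<in> G"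
  shows "Out H \<cong> K"
proof -
  define I where "I \<phi> = (THE f. induces f \<phi>)" for \<phi>
  have I_eq: "I \<phi> = f" if "induces f \<phi>" for f \<phi>
    unfolding I_def using that induces_unique by blast
  have I: "induces (I \<phi>) \<phi>" if "\<phi> \<in> auto H" for \<phi>
    using ex_induces[OF that] I_eq by metis
  have IN: "I \<phi> \<in> perm_normalizer" if "\<phi> \<in> auto H" for \<phi> using I[OF that] by (simp add: induces_def)
  have aut: "carrier (AutoGroup H) = auto H" by (simp add: AutoGroup_def)
  have am: "\<phi> \<otimes>\<^bsub>AutoGroup H\<^esub> \<psi> = compose (carrier H) \<phi> \<psi>" if "\<phi> \<in> auto H" "\<psi> \<in> auto H" for \<phi> \<psi>
    using that by (simp add: AutoGroup_def BijGroup_def auto_def)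
  have Im: "I (\<phi> \<otimes>\<^bsub>AutoGroup H\<^esub> \<psi>) = I \<phi> \<circ> I \<psi>" if "\<phi> \<in> auto H" "\<psi> \<in> auto H" for \<phi> \<psi>
  proof (rule I_eq)
    have b: "bij (I \<phi>)" "bij (I \<psi>)" using IN that by (auto simp: perm_normalizer_def)
    have "\<theta> (\<phi> (\<psi> x)) = I \<phi> \<circ> I \<psi> \<circ> \<theta> x \<circ> inv' (I \<phi> \<circ> I \<psi>)" if x: "x \<in> carrier H" for x
      using I[OF \<open>\<phi> \<in> auto H\<close>] I[OF \<open>\<psi> \<in> auto H\<close>] autoD(1)[OF \<open>\<psi> \<in> auto H\<close> x] x b
      by (simp add: induces_def o_inv_distrib comp_assoc)
    then show "induces (I \<phi> \<circ> I \<psi>) (\<phi> \<otimes>\<^bsub>AutoGroup H\<^esub> \<psi>)"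
      using am that perm_normalizer_comp IN by (simp add: induces_def compose_eq)
  qed
  have hom: "(\<lambda>\<phi>. \<kappa> (I \<phi>)) \<in> hom (AutoGroup H) K"
    using Im mult IN range unfolding hom_def aut by auto
  interpret gh: group_hom "AutoGroup H" K "\<lambda>\<phi>. \<kappa> (I \<phi>)"
    using hom K AutoGroup by (simp add: group_hom_def group_hom_axioms_def)
  have "(\<lambda>\<phi>. \<kappa> (I \<phi>)) ` carrier (AutoGroup H) = carrier K"
  proof -
    have "I ` auto H = perm_normalizer"
    proof
      show "perm_normalizer \<subseteq> I ` auto H"
      proof
        fix f assume "f \<in> perm_normalizer"
        then obtain \<phi> where "\<phi> \<in> auto H" "induces f \<phi>" by (rule ex_auto_induced)
        then show "f \<in> I ` auto H" using I_eq by (metis imageI)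
      qed
    qed (use IN in blast)
    then show ?thesis using range aut by (metis image_image)
  qed
  moreover have "kernel (AutoGroup H) K (\<lambda>\<phi>. \<kappa> (I \<phi>)) = Inn H"
  proof -
    have "Inn H \<subseteq> auto H"
    proof
      fix \<phi> assume "\<phi> \<in> Inn H"
      then obtain g where g: "g \<in> carrier H" "\<phi> = (\<lambda>x\<in>carrier H. g \<otimes> x \<otimes> inv g)" by (auto simp: Inn_def)
      have ind: "induces (\<theta> g) \<phi>"
        using g \<theta>_mult \<theta>_m_inv G_normalizer[OF \<theta>_inverse(1)] by (simp add: induces_def)
      \<comment> \<open>An inner map is shown to equal the automorphism that
        \<open>\<theta> g\<close> induces, which yields its membership in
        \<open>auto H\<close>.\<close>
      then obtain \<psi> where \<psi>: "\<psi> \<in> auto H" "induces (\<theta> g) \<psi>" using ex_auto_induced unfolding induces_def by metis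
      have "\<phi> = \<psi>"
      proof (rule extensionalityI[OF _ autoD(4)[OF \<psi>(1)]])
        fix x assume x: "x \<in> carrier H"
        have "\<theta> (\<phi> x) = \<theta> (\<psi> x)" using ind \<psi>(2) x by (simp add: induces_def)
        moreover have "\<phi> x \<in> carrier H" using g x by simp
        ultimately show "\<phi> x = \<psi> x" using autoD(1)[OF \<psi>(1) x] \<theta>_inverse(3) by metis
      qed (simp add: g)
      then show "\<phi> \<in> auto H" using \<psi>(1) by simp
    qed
    then show ?thesis using ker IN I induces_inner unfolding kernel_def aut by blast
  qed
  ultimately show ?thesis using gh.FactGroup_iso by (simp add: Out_def)
qed

end

section \<open>Transport along isomorphisms\<close>

lemma str_embedding_comp:
  "str_embedding L A B f \<Longrightarrow> str_embedding L B C g \<Longrightarrow> str_embedding L A C (g \<circ> f)"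
  unfolding str_embedding_def by (auto intro!: comp_inj_on intro: inj_on_subset simp: image_subset_iff)

lemma str_iso_comp: "str_iso L A B f \<Longrightarrow> str_iso L B C g \<Longrightarrow> str_iso L A C (g \<circ> f)"
  unfolding str_iso_def using str_embedding_comp bij_betw_trans by blast

lemma str_isoI:
  "bij_betw f (univ A) (univ B) \<Longrightarrow>
   (\<And>s x y. s \<in> L \<Longrightarrow> x \<in> univ A \<Longrightarrow> y \<in> univ A \<Longrightarrow> rel A s x y \<longleftrightarrow> rel B s (f x) (f y)) \<Longrightarrow> str_iso L A B f"
  by (auto simp: str_iso_def str_embedding_def bij_betw_def)

lemma str_isoD:
  assumes "str_iso L A B f"
  shows "bij_betw f (univ A) (univ B)"
    "s \<in> L \<Longrightarrow> x \<in> univ A \<Longrightarrow> y \<in> univ A \<Longrightarrow> rel A s x y \<longleftrightarrow> rel B s (f x) (f y)"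
    "str_embedding L A B f"
  using assms by (auto simp: str_iso_def str_embedding_def)

lemma str_iso_cong:
  assumes f: "str_iso L A B f" and eq: "\<And>x. x \<in> univ A \<Longrightarrow> f x = g x"
  shows "str_iso L A B g"
proof (rule str_isoI)
  show "bij_betw g (univ A) (univ B)" using str_isoD(1)[OF f] bij_betw_cong[of "univ A" f g] eq by blast
  show "rel A s x y \<longleftrightarrow> rel B s (g x) (g y)" if "s \<in> L" "x \<in> univ A" "y \<in> univ A" for s x y
    using str_isoD(2)[OF f that] eq that by simp
qed

lemma str_iso_inv_into:
  assumes "str_iso L A B f"
  shows "str_iso L B A (inv_into (univ A) f)"
proof (rule str_isoI)
  note F = str_isoD[OF assms]
  show b: "bij_betw (inv_into (univ A) f) (univ B) (univ A)" using F(1) by (rule bij_betw_inv_into)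
  fix s x y assume "s \<in> L" "x \<in> univ B" "y \<in> univ B"
  then show "rel B s x y \<longleftrightarrow> rel A s (inv_into (univ A) f x) (inv_into (univ A) f y)"
    using F(2)[of s "inv_into (univ A) f x" "inv_into (univ A) f y"] bij_betw_inv_into_right[OF F(1)] bij_betwE[OF b]
    by simp
qed

lemma univ_substr [simp]: "univ (substr M S) = S" and rel_substr [simp]: "rel (substr M S) = rel M"
  by (simp_all add: substr_def)

lemma str_iso_substr:
  assumes "str_iso L A B f" "S \<subseteq> univ A" "T = f ` S"
  shows "str_iso L (substr A S) (substr B T) f"
  using str_isoD[OF assms(1)] assms(2,3) by (intro str_isoI) (auto intro: bij_betw_subset)

lemma fraisse_limit_extend:
  assumes "fraisse_limit L K M" "str_iso L (substr M S) (substr M T) f"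
    and "finite S" "S \<subseteq> univ M" "finite T" "T \<subseteq> univ M"
  obtains g where "str_iso L M M g" "\<And>x. x \<in> S \<Longrightarrow> g x = f x"
proof -
  have "\<forall>S T f. finite S \<and> S \<subseteq> univ M \<and> finite T \<and> T \<subseteq> univ M \<and> str_iso L (substr M S) (substr M T) f \<longrightarrow>
      (\<exists>g. str_iso L M M g \<and> (\<forall>x\<in>S. g x = f x))"
    using assms(1) unfolding fraisse_limit_def ultrahomogeneous_def by (elim conjE)
  from this[rule_format, of S T f] show ?thesis using assms(2-6) that by auto
qed

lemma fraisse_limit_iso:
  fixes R :: "('c, 'a) binstr" and M :: "('c, 'b) binstr"
  assumes R: "fraisse_limit L K R" and e: "str_iso L R M e"
  shows "fraisse_limit L K M"
proof -
  define d where "d = inv_into (univ R) e"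
  have d: "str_iso L M R d" unfolding d_def by (rule str_iso_inv_into[OF e])
  note E = str_isoD[OF e] note D = str_isoD[OF d]
  have ed: "e (d x) = x" if "x \<in> univ M" for x using that bij_betw_inv_into_right[OF E(1)] by (simp add: d_def)
  have "countable (univ M)"
    using R E(1) unfolding fraisse_limit_def by (metis bij_betw_def countable_image)
  moreover have "(\<exists>f. str_embedding L A M f) \<longleftrightarrow> (\<exists>f. str_embedding L A R f)" for A :: "('c, nat) binstr"
    using str_embedding_comp[OF _ E(3)] str_embedding_comp[OF _ D(3)] by metis
  then have "age L M = age L R" by (simp add: age_def)
  moreover have "ultrahomogeneous L M"
    unfolding ultrahomogeneous_def
  proof (intro allI impI, elim conjE)
    fix S T f assume S: "finite S" "S \<subseteq> univ M" and T: "finite T" "T \<subseteq> univ M"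
      and f: "str_iso L (substr M S) (substr M T) f"
    have "S = e ` d ` S" using ed S(2) by (force simp: image_iff)
    moreover have dS: "d ` S \<subseteq> univ R" "d ` T \<subseteq> univ R" using D(1) S(2) T(2) by (auto dest: bij_betwE)
    ultimately have i1: "str_iso L (substr R (d ` S)) (substr M S) e" using str_iso_substr[OF e] by blast
    have i2: "str_iso L (substr M T) (substr R (d ` T)) d" using str_iso_substr[OF d T(2)] by blast
    obtain g where g: "str_iso L R R g" "\<And>x. x \<in> d ` S \<Longrightarrow> g x = (d \<circ> (f \<circ> e)) x"
      using fraisse_limit_extend[OF R str_iso_comp[OF str_iso_comp[OF i1 f] i2]] S(1) T(1) dS by blast
    have fS: "f x \<in> univ M" if "x \<in> S" for x using str_isoD(1)[OF f] that T(2) by (auto dest: bij_betwE)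
    have "str_iso L M M (e \<circ> g \<circ> d)" using str_iso_comp[OF d] str_iso_comp[OF g(1) e] by blast
    moreover have "\<forall>x\<in>S. (e \<circ> g \<circ> d) x = f x" using g(2) S(2) fS ed by auto
    ultimately show "\<exists>g. str_iso L M M g \<and> (\<forall>x\<in>S. g x = f x)" by blast
  qed
  ultimately show ?thesis using R by (simp add: fraisse_limit_def)
qed

lemma fraisse_limit_infinite:
  assumes R: "fraisse_limit L K R" and K: "\<And>n. \<exists>A\<in>K. card (univ A) = n"
  shows "infinite (univ R)"
proof
  assume fin: "finite (univ R)"
  obtain A where A: "A \<in> K" "card (univ A) = Suc (card (univ R))" using K by blast
  then obtain f where "str_embedding L A R f" using R by (auto simp: fraisse_limit_def age_def)
  then have "card (univ A) \<le> card (univ R)"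
    using fin card_inj_on_le unfolding str_embedding_def by blast
  then show False using A by simp
qed

lemma group_Aut_str: "group (Aut_str L R)"
proof -
  let ?A = "{f \<in> Bij (univ R). str_iso L R R f}"
  have "subgroup ?A (BijGroup (univ R))"
  proof (rule subgroup.intro)
    show "?A \<subseteq> carrier (BijGroup (univ R))" by (auto simp: BijGroup_def)
    have "str_iso L R R (\<lambda>x\<in>univ R. x)" by (rule str_isoI) (simp_all add: bij_betw_def inj_on_def)
    then show "\<one>\<^bsub>BijGroup (univ R)\<^esub> \<in> ?A" by (simp add: BijGroup_def id_Bij)
  next
    fix f g assume fg: "f \<in> ?A" "g \<in> ?A"
    have "str_iso L R R (compose (univ R) f g)"
      by (rule str_iso_cong[OF str_iso_comp[of L R R g R f]]) (use fg in \<open>auto simp: compose_eq\<close>)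
    then show "f \<otimes>\<^bsub>BijGroup (univ R)\<^esub> g \<in> ?A" using fg compose_Bij by (auto simp: BijGroup_def)
  next
    fix f assume f: "f \<in> ?A"
    have "str_iso L R R (\<lambda>x\<in>univ R. inv_into (univ R) f x)"
      by (rule str_iso_cong[OF str_iso_inv_into[of L R R f]]) (use f in auto)
    then show "inv\<^bsub>BijGroup (univ R)\<^esub> f \<in> ?A" 
      using f inv_BijGroup[of f "univ R"] restrict_inv_into_Bij[of f "univ R"] by simp
  qed
  then show ?thesis unfolding Aut_str_def by (rule subgroup.subgroup_is_group[OF _ group_BijGroup])
qed

text \<open>Members of the carrier are extensional, so the inverse of \<theta> has to restrict to
  the universe.\<close>

lemma Aut_str_transport:
  assumes e: "str_iso L R M e" and M: "univ M = UNIV"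
  defines "\<theta> \<equiv> \<lambda>f. e \<circ> f \<circ> inv_into (univ R) e"
  shows "bij_betw \<theta> (carrier (Aut_str L R)) {g. str_iso L M M g}"
    and "f \<in> carrier (Aut_str L R) \<Longrightarrow> g \<in> carrier (Aut_str L R) \<Longrightarrow>
      \<theta> (f \<otimes>\<^bsub>Aut_str L R\<^esub> g) = \<theta> f \<circ> \<theta> g"
proof -
  define d where "d = inv_into (univ R) e"
  have d: "str_iso L M R d" unfolding d_def by (rule str_iso_inv_into[OF e])
  note E = str_isoD[OF e] note D = str_isoD[OF d]
  have ed: "e (d x) = x" for x using M bij_betw_inv_into_right[OF E(1)] by (simp add: d_def)
  have de: "d (e x) = x" if "x \<in> univ R" for x using that bij_betw_inv_into_left[OF E(1)] by (simp add: d_def)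
  have dR: "d x \<in> univ R" for x using D(1) M by (auto dest: bij_betwE)
  have car: "carrier (Aut_str L R) = {f \<in> Bij (univ R). str_iso L R R f}" by (simp add: Aut_str_def)
  have \<theta>: "\<theta> f = e \<circ> f \<circ> d" for f by (simp add: \<theta>_def d_def)
  have BR: "f x \<in> univ R" if "f \<in> Bij (univ R)" "x \<in> univ R" for f x
    using Bij_imp_funcset[OF that(1)] that(2) by auto
  show "bij_betw \<theta> (carrier (Aut_str L R)) {g. str_iso L M M g}"
  proof (rule bij_betw_byWitness[where f' = "\<lambda>g. restrict (d \<circ> g \<circ> e) (univ R)"])
    show "\<forall>f\<in>carrier (Aut_str L R). restrict (d \<circ> \<theta> f \<circ> e) (univ R) = f"
    proof
      fix f assume f: "f \<in> carrier (Aut_str L R)"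
      then have fB: "f \<in> Bij (univ R)" by (simp add: car)
      show "restrict (d \<circ> \<theta> f \<circ> e) (univ R) = f"
        by (rule extensionalityI[OF restrict_extensional Bij_imp_extensional[OF fB]]) (simp add: \<theta> de BR[OF fB])
    qed
    show "\<forall>g\<in>{g. str_iso L M M g}. \<theta> (restrict (d \<circ> g \<circ> e) (univ R)) = g"
      by (auto simp: \<theta> fun_eq_iff ed dR)
    show "\<theta> ` carrier (Aut_str L R) \<subseteq> {g. str_iso L M M g}"
      using str_iso_comp[OF d str_iso_comp[OF _ e]] by (auto simp: car \<theta>)
    show "(\<lambda>g. restrict (d \<circ> g \<circ> e) (univ R)) ` {g. str_iso L M M g} \<subseteq> carrier (Aut_str L R)"
    proof (rule image_subsetI)
      fix g assume "g \<in> {g. str_iso L M M g}"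
      then have "str_iso L R R (d \<circ> g \<circ> e)" using str_iso_comp[OF e str_iso_comp[OF _ d]] by auto
      then have *: "str_iso L R R (restrict (d \<circ> g \<circ> e) (univ R))" by (rule str_iso_cong) simp
      then show "restrict (d \<circ> g \<circ> e) (univ R) \<in> carrier (Aut_str L R)"
        using str_isoD(1)[OF *] unfolding car Bij_def by blast
    qed
  qed
  assume "f \<in> carrier (Aut_str L R)" "g \<in> carrier (Aut_str L R)"
  then have fg: "f \<in> Bij (univ R)" "g \<in> Bij (univ R)" by (auto simp: car)
  have "f \<otimes>\<^bsub>Aut_str L R\<^esub> g = compose (univ R) f g" using fg by (simp add: Aut_str_def BijGroup_def)
  then show "\<theta> (f \<otimes>\<^bsub>Aut_str L R\<^esub> g) = \<theta> f \<circ> \<theta> g"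
    by (simp add: \<theta> fun_eq_iff compose_eq dR de BR[OF fg(2)])
qed

section \<open>Copies on the natural numbers and the coding of pairs\<close>

lemma ex_nat_copy:
  assumes R: "fraisse_limit L K R" and inf: "infinite (univ R)"
  obtains e M where "str_iso L R M e" "univ M = (UNIV :: nat set)"
proof -
  define e where "e = to_nat_on (univ R)"
  have e: "bij_betw e (univ R) UNIV" unfolding e_def
    by (rule to_nat_on_infinite) (use R inf in \<open>auto simp: fraisse_limit_def\<close>)
  define M where "M = \<lparr>univ = UNIV, rel = \<lambda>s x y. rel R s (inv_into (univ R) e x) (inv_into (univ R) e y)\<rparr>"
  have "str_iso L R M e"
    using e by (intro str_isoI) (simp_all add: M_def bij_betw_inv_into_left[OF e])
  then show ?thesis using that[of M e] by (simp add: M_def)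
qed

text \<open>In \<open>E\<close>, \<open>Suc a\<close> stands for \<open>a\<close> and
  \<open>0\<close> for a further point. Ultrahomogeneity moves an embedded copy of \<open>E\<close>
  so that the copy of \<open>A\<close> returns to \<open>A\<close>; the image of \<open>0\<close> is
  the point sought.\<close>

lemma one_point_extension:
  assumes M: "fraisse_limit L K M" "univ M = UNIV" and A: "finite A"
    and E: "E \<in> K" "univ E = insert 0 (Suc ` A)"
      "\<And>s a b. s \<in> L \<Longrightarrow> a \<in> A \<Longrightarrow> b \<in> A \<Longrightarrow> rel E s (Suc a) (Suc b) \<longleftrightarrow> rel M s a b"
  obtains y where "y \<notin> A" "\<And>s a. s \<in> L \<Longrightarrow> a \<in> A \<Longrightarrow> rel M s y a \<longleftrightarrow> rel E s 0 (Suc a)"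
proof -
  have "E \<in> age L M" using E(1) M(1) by (simp add: fraisse_limit_def)
  then obtain f where "str_embedding L E M f" by (auto simp: age_def)
  then have inj: "inj_on f (univ E)"
    and f: "\<And>s x y. s \<in> L \<Longrightarrow> x \<in> univ E \<Longrightarrow> y \<in> univ E \<Longrightarrow> rel E s x y \<longleftrightarrow> rel M s (f x) (f y)"
    by (auto simp: str_embedding_def)
  have f_eq: "f x = f y \<longleftrightarrow> x = y" if "x \<in> univ E" "y \<in> univ E" for x y
    using inj that by (simp add: inj_on_eq_iff)
  define h where "h = inv_into A (\<lambda>a. f (Suc a))"
  have bij: "bij_betw (\<lambda>a. f (Suc a)) A (f ` Suc ` A)"
    using f_eq E(2) by (auto simp: bij_betw_def inj_on_def image_image)
  have h: "h (f (Suc a)) = a" if "a \<in> A" for a using bij_betw_inv_into_left[OF bij that] by (simp add: h_def)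
  have "str_iso L (substr M (f ` Suc ` A)) (substr M A) h"
  proof (rule str_isoI)
    show "bij_betw h (univ (substr M (f ` Suc ` A))) (univ (substr M A))"
      using bij_betw_inv_into[OF bij] by (simp add: h_def)
    fix s x y assume s: "s \<in> L" and "x \<in> univ (substr M (f ` Suc ` A))" "y \<in> univ (substr M (f ` Suc ` A))"
    then obtain a b where ab: "a \<in> A" "b \<in> A" "x = f (Suc a)" "y = f (Suc b)" by auto
    then have "rel E s (Suc a) (Suc b) \<longleftrightarrow> rel M s x y" using f[OF s, of "Suc a" "Suc b"] E(2) by auto
    then show "rel (substr M (f ` Suc ` A)) s x y \<longleftrightarrow> rel (substr M A) s (h x) (h y)"
      using E(3)[OF s ab(1,2)] h ab by simp
  qed
  from fraisse_limit_extend[OF M(1) this]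
  obtain g where g: "str_iso L M M g" "\<And>x. x \<in> f ` Suc ` A \<Longrightarrow> g x = h x"
    using A M(2) by auto
  note Gd = str_isoD[OF g(1)]
  have gf: "g (f (Suc a)) = a" if "a \<in> A" for a using g(2) h that by simp
  show ?thesis
  proof (rule that[of "g (f 0)"])
    show "g (f 0) \<notin> A"
    proof
      assume *: "g (f 0) \<in> A"
      then have "g (f (Suc (g (f 0)))) = g (f 0)" by (rule gf)
      then have "f (Suc (g (f 0))) = f 0" using Gd(1) M(2) by (auto simp: bij_betw_def inj_def)
      then show False using f_eq[of "Suc (g (f 0))" 0] E(2) * by simp
    qed
    fix s a assume s: "s \<in> L" and a: "a \<in> A"
    have "rel M s (g (f 0)) a \<longleftrightarrow> rel M s (g (f 0)) (g (f (Suc a)))" using gf a by simp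
    also have "\<dots> \<longleftrightarrow> rel M s (f 0) (f (Suc a))" using Gd(2)[OF s] M(2) by simp
    also have "\<dots> \<longleftrightarrow> rel E s 0 (Suc a)" using f[OF s, of 0 "Suc a"] E(2) a by simp
    finally show "rel M s (g (f 0)) a \<longleftrightarrow> rel E s 0 (Suc a)" .
  qed
qed

lemma substr_in_class:
  assumes "fraisse_limit L K M" "univ M = UNIV" "finite C"
  shows "substr M C \<in> K"
proof -
  have "str_embedding L (substr M C) M id" using assms(2) by (auto simp: str_embedding_def)
  then have "substr M C \<in> age L M" using assms(3) by (auto simp: age_def)
  then show ?thesis using assms(1) by (simp add: fraisse_limit_def)
qed

text \<open>By \<open>code\<close>, \<open>c\<close> names the isomorphism type of an ordered pair.
  As all symbols are binary, these types determine a finite substructure.\<close>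

lemma coloring_of_structure:
  fixes M :: "('s, nat) binstr"
  assumes M: "fraisse_limit L K M" "univ M = UNIV"
    and code: "\<And>x y x' y'. c x y = c x' y' \<longleftrightarrow>
      (x = y \<longleftrightarrow> x' = y') \<and> (\<forall>s\<in>L. rel M s x y \<longleftrightarrow> rel M s x' y')"
  shows "col_aut c = {g. str_iso L M M g}"
    and "finite F \<Longrightarrow> (\<And>x y. x \<in> F \<Longrightarrow> y \<in> F \<Longrightarrow> c (f x) (f y) = c x y) \<Longrightarrow> \<exists>g\<in>col_aut c. \<forall>x\<in>F. g x = f x"
proof -
  show 1: "col_aut c = {g. str_iso L M M g}"
  proof (intro equalityI subsetI)
    fix g assume "g \<in> col_aut c"
    then have g: "bij g" "\<And>x y. c (g x) (g y) = c x y" by (auto simp: col_aut_def)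
    show "g \<in> {g. str_iso L M M g}"
      using g M(2) code[of "g _" "g _"] by (auto intro!: str_isoI)
  next
    fix g assume "g \<in> {g. str_iso L M M g}"
    then have g: "str_iso L M M g" by simp
    note Gd = str_isoD[OF g]
    have "bij g" using Gd(1) M(2) by simp
    then have "c (g x) (g y) = c x y" for x y
      using code[of "g x" "g y" x y] Gd(2)[of _ x y] M(2) by (auto simp: bij_def inj_eq)
    then show "g \<in> col_aut c" using \<open>bij g\<close> by (simp add: col_aut_def)
  qed
  assume F: "finite F" and f: "\<And>x y. x \<in> F \<Longrightarrow> y \<in> F \<Longrightarrow> c (f x) (f y) = c x y"
  have "str_iso L (substr M F) (substr M (f ` F)) f"
  proof (rule str_isoI)
    show "bij_betw f (univ (substr M F)) (univ (substr M (f ` F)))"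
      using f code[of "f _" "f _"] by (auto simp: bij_betw_def inj_on_def)
    show "rel (substr M F) s x y \<longleftrightarrow> rel (substr M (f ` F)) s (f x) (f y)"
      if "s \<in> L" "x \<in> univ (substr M F)" "y \<in> univ (substr M F)" for s x y
      using f[of x y] code[of "f x" "f y" x y] that by auto
  qed
  from fraisse_limit_extend[OF M(1) this]
  obtain g where "str_iso L M M g" "\<And>x. x \<in> F \<Longrightarrow> g x = f x"
    using F M(2) by auto
  then show "\<exists>g\<in>col_aut c. \<forall>x\<in>F. g x = f x" using 1 by blast
qed

lemma Out_Aut_str_iso:
  fixes c :: "nat \<Rightarrow> nat \<Rightarrow> nat" and M :: "('s, nat) binstr"
  assumes e: "str_iso L R M e" "univ M = UNIV"
    and c: "free_homogeneous c" "col_aut c = {g. str_iso L M M g}"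
    and K: "group K"
    and mult: "\<And>f f'. f \<in> free_homogeneous.perm_normalizer c \<Longrightarrow> f' \<in> free_homogeneous.perm_normalizer c \<Longrightarrow>
      \<kappa> (f \<circ> f') = \<kappa> f \<otimes>\<^bsub>K\<^esub> \<kappa> f'"
    and range: "\<kappa> ` free_homogeneous.perm_normalizer c = carrier K"
    and ker: "\<And>f. f \<in> free_homogeneous.perm_normalizer c \<Longrightarrow> \<kappa> f = \<one>\<^bsub>K\<^esub> \<longleftrightarrow> f \<in> col_aut c"
  shows "Out (Aut_str L R) \<cong> K"
proof -
  interpret free_homogeneous c by (rule c)
  interpret group "Aut_str L R" by (rule group_Aut_str)
  interpret group_of_coloring c "Aut_str L R" "\<lambda>f. e \<circ> f \<circ> inv_into (univ R) e"
    by unfold_locales (use Aut_str_transport[OF e] c(2) in auto)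
  show ?thesis by (rule Out_iso_normalizer[of K \<kappa>, OF K mult range ker])
qed

section \<open>Clique-free random graphs\<close>

lemma edgeless_clique_free:
  assumes "3 \<le> m" "finite V"
  shows "\<lparr>univ = V, rel = \<lambda>_ _ _. False\<rparr> \<in> clique_free_graphs m"
proof -
  have "card S \<noteq> m" if "pairwise (\<lambda>_ _. False) S" "finite S" for S :: "nat set"
  proof -
    have "card S \<le> Suc 0" using that by (auto simp: card_le_Suc0_iff_eq pairwise_def)
    then show ?thesis using assms(1) by simp
  qed
  then show ?thesis
    using assms(2) by (auto simp: clique_free_graphs_def is_graph_def has_clique_def symp_on_def irreflp_on_def)
qed

locale nat_clique_free_random_graph =
  fixes m :: nat and M :: "(unit, nat) binstr"
  assumes m: "3 \<le> m" and fraisse: "fraisse_limit {()} (clique_free_graphs m) M" and univ: "univ M = UNIV"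
begin

abbreviation adj :: "nat \<Rightarrow> nat \<Rightarrow> bool" where "adj \<equiv> rel M ()"

lemma substr_clique_free: "finite C \<Longrightarrow> substr M C \<in> clique_free_graphs m"
  by (rule substr_in_class[OF fraisse univ])

lemma adj_sym: "adj x y \<longleftrightarrow> adj y x" and adj_irrefl: "\<not> adj x x"
proof -
  have "is_graph (substr M {x, y})" using substr_clique_free[of "{x, y}"] by (simp add: clique_free_graphs_def)
  then show "adj x y \<longleftrightarrow> adj y x" "\<not> adj x x" by (auto simp: is_graph_def symp_on_def irreflp_on_def)
qed

lemma no_clique: "finite C \<Longrightarrow> card C = m \<Longrightarrow> \<not> pairwise adj C"
  using substr_clique_free[of C] by (auto simp: clique_free_graphs_def has_clique_def)

text \<open>Non-adjacency gets the value \<open>1\<close> because free amalgamation of graphs adds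
  no edges.\<close>

definition c :: "nat \<Rightarrow> nat \<Rightarrow> nat" where
  "c x y = (if x = y then 0 else if adj x y then 2 else 1)"

lemma c_simps: "c x y = 0 \<longleftrightarrow> x = y" "c x y = 2 \<longleftrightarrow> adj x y" "c x y = 1 \<longleftrightarrow> x \<noteq> y \<and> \<not> adj x y"
  using adj_irrefl by (auto simp: c_def)

lemma c_code: "c x y = c x' y' \<longleftrightarrow> (x = y \<longleftrightarrow> x' = y') \<and> (\<forall>s\<in>{()}. rel M s x y \<longleftrightarrow> rel M s x' y')"
  using adj_irrefl by (auto simp: c_def)

text \<open>The new vertex has only the edges that \<open>y\<close> has to \<open>F\<close>.
  Replacing it by \<open>y\<close> maps a clique of the extended graph injectively to a clique of
  \<open>M\<close>, so no clique of size \<open>m\<close> arises.\<close>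

lemma neighbour_extension:
  assumes "finite F" "finite N" "y \<notin> F"
  obtains y' where "y' \<notin> F \<union> N" "\<And>z. z \<in> F \<union> N \<Longrightarrow> adj y' z \<longleftrightarrow> z \<in> F \<and> adj y z"
proof -
  define r where "r u v = (case u of 0 \<Rightarrow> (case v of 0 \<Rightarrow> False | Suc b \<Rightarrow> b \<in> F \<and> adj y b)
    | Suc a \<Rightarrow> (case v of 0 \<Rightarrow> a \<in> F \<and> adj y a | Suc b \<Rightarrow> adj a b))" for u v
  define E :: "(unit, nat) binstr" where "E = \<lparr>univ = insert 0 (Suc ` (F \<union> N)), rel = \<lambda>_. r\<rparr>"
  have "E \<in> clique_free_graphs m"
    unfolding clique_free_graphs_def
  proof (intro CollectI conjI notI)
    show "finite (univ E)" using assms by (simp add: E_def)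
    show "is_graph E"
      unfolding is_graph_def symp_on_def irreflp_on_def
      using adj_sym adj_irrefl by (auto simp: E_def r_def split: nat.split)
    assume "has_clique m E"
    then obtain S where S: "finite S" "card S = m" "pairwise r S" by (auto simp: has_clique_def E_def)
    define q where "q u = (case u of 0 \<Rightarrow> y | Suc a \<Rightarrow> a)" for u
    have q: "adj (q u) (q v)" if "r u v" for u v
      using that adj_sym by (auto simp: r_def q_def split: nat.splits)
    have "inj_on q S" by (rule inj_onI) (metis S(3) pairwiseD adj_irrefl q)
    moreover have "pairwise adj (q ` S)" using S(3) q unfolding pairwise_def by fast
    ultimately show False using no_clique[of "q ` S"] S by (simp add: card_image)
  qed
  then show ?thesis
    using one_point_extension[OF fraisse univ, of "F \<union> N" E] assms(1,2) that
    by (auto simp: E_def r_def)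
qed

lemma independent_set:
  obtains f :: "nat \<Rightarrow> nat" where "inj_on f {..<m}" "\<And>i j. i < m \<Longrightarrow> j < m \<Longrightarrow> \<not> adj (f i) (f j)"
proof -
  define E :: "(unit, nat) binstr" where "E = \<lparr>univ = {..<m}, rel = \<lambda>_ _ _. False\<rparr>"
  have "E \<in> clique_free_graphs m" unfolding E_def by (rule edgeless_clique_free[OF m]) simp
  then have "E \<in> age {()} M" using fraisse by (simp add: fraisse_limit_def)
  then show ?thesis using that by (auto simp: age_def str_embedding_def E_def)
qed

lemma ex_edge: obtains x y where "adj x y"
proof -
  define E :: "(unit, nat) binstr" where "E = \<lparr>univ = {0, 1}, rel = \<lambda>_ x y. x \<noteq> y\<rparr>"
  have "card S \<noteq> m" if "S \<subseteq> {0, 1::nat}" for S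
    using card_mono[OF _ that] m by simp
  then have "\<not> has_clique m E" by (auto simp: has_clique_def E_def)
  then have "E \<in> clique_free_graphs m"
    by (simp add: clique_free_graphs_def is_graph_def E_def symp_on_def irreflp_on_def)
  then have "E \<in> age {()} M" using fraisse by (simp add: fraisse_limit_def)
  then show ?thesis using that by (auto simp: age_def str_embedding_def E_def)
qed

sublocale free_homogeneous c
proof
  show "c x y = c y x" for x y using adj_sym by (simp add: c_def)
  show "c x y = 0 \<longleftrightarrow> x = y" for x y by (rule c_simps)
  show "\<exists>g\<in>col_aut c. \<forall>x\<in>F. g x = f x"
    if "finite F" "\<And>x y. x \<in> F \<Longrightarrow> y \<in> F \<Longrightarrow> c (f x) (f y) = c x y" for F f
    using coloring_of_structure(2)[OF fraisse univ c_code that] .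
  show "\<exists>y'. (\<forall>z\<in>F. c y' z = c y z) \<and> (\<forall>z\<in>N - F. c y' z = 1)" if F: "finite F" "finite N" "y \<notin> F" for F N y
  proof -
    obtain y' where y': "y' \<notin> F \<union> N" "\<And>z. z \<in> F \<union> N \<Longrightarrow> adj y' z \<longleftrightarrow> z \<in> F \<and> adj y z"
      by (rule neighbour_extension[OF F]) (rule that)
    then show ?thesis using F(3) by (intro exI[of _ y']) (auto simp: c_def)
  qed
qed

text \<open>If one non-edge became an edge, all would, and an independent set of size
  \<open>m\<close> would become a forbidden clique. Hence every edge is the image of an edge, and as
  edges form one color class, they go to edges.\<close>

lemma normalizer_eq: "perm_normalizer = col_aut c"
proof (intro equalityI subsetI)
  fix f assume f: "f \<in> perm_normalizer"
  note eq = normalizer_color_eq[OF f]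
  have b: "bij f" using f by (simp add: perm_normalizer_def)
  obtain i where i: "inj_on i {..<m}" "\<And>j k. j < m \<Longrightarrow> k < m \<Longrightarrow> \<not> adj (i j) (i k)" by (rule independent_set) (rule that)
  have "adj (f x) (f y) \<longleftrightarrow> adj x y" for x y
  proof -
    have non: "\<not> adj (f x) (f y)" if xy: "\<not> adj x y" for x y
    proof
      assume a: "adj (f x) (f y)"
      then have "x \<noteq> y" using adj_irrefl by auto
      then have c1: "c x y = 1" using xy c_simps by blast
      have "adj (f (i j)) (f (i k))" if "j < m" "k < m" "j \<noteq> k" for j k
      proof -
        have "c (i j) (i k) = 1" using i that c_simps(3) by (simp add: inj_on_eq_iff)
        then have "c (f (i j)) (f (i k)) = c (f x) (f y)" using eq c1 by metis
        then show ?thesis using a c_simps(2) by metis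
      qed
      then have "pairwise adj ((f \<circ> i) ` {..<m})" by (auto simp: pairwise_def)
      moreover have "inj_on (f \<circ> i) {..<m}" using i(1) b by (meson bij_is_inj comp_inj_on inj_on_subset subset_UNIV)
      then have "card ((f \<circ> i) ` {..<m}) = m" using card_image by fastforce
      ultimately show False using no_clique[of "(f \<circ> i) ` {..<m}"] by (meson finite_imageI finite_lessThan)
    qed
    moreover have "adj (f x) (f y)" if xy: "adj x y" for x y
    proof (rule ccontr)
      assume n: "\<not> adj (f x) (f y)"
      obtain u v where uv: "adj u v" by (rule ex_edge)
      define u' v' where "u' = inv' f u" and "v' = inv' f v"
      have fu: "f u' = u" "f v' = v" by (simp_all add: u'_def v'_def bij_inv_simps[OF b])
      have "adj u' v'" using non[of u' v'] fu uv by auto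
      then have "c u' v' = c x y" using xy c_simps(2) by metis
      then have "c u v = c (f x) (f y)" using eq fu by metis
      then show False using n uv c_simps(2) by metis
    qed
    ultimately show ?thesis by blast
  qed
  then show "f \<in> col_aut c" using b by (simp add: col_aut_def c_def bij_is_inj inj_eq)
qed (rule G_normalizer)

end

lemma clique_free_random_graph_infinite:
  assumes m: "3 \<le> m" and R: "clique_free_random_graph m R"
  shows "infinite (univ R)"
proof (rule fraisse_limit_infinite)
  show "fraisse_limit {()} (clique_free_graphs m) R" using R by (simp add: clique_free_random_graph_def)
  fix n
  define E :: "(unit, nat) binstr" where "E = \<lparr>univ = {..<n}, rel = \<lambda>_ _ _. False\<rparr>"
  have "E \<in> clique_free_graphs m" unfolding E_def by (rule edgeless_clique_free[OF m]) simp
  then show "\<exists>A\<in>clique_free_graphs m. card (univ A) = n" by (intro bexI[of _ E]) (simp_all add: E_def)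
qed

theorem Out_clique_free_random_graph:
  assumes m: "3 \<le> m" and R: "clique_free_random_graph m R"
  shows "Out (Aut_str {()} R) \<cong> singleton_group ()"
proof -
  have F: "fraisse_limit {()} (clique_free_graphs m) R" using R by (simp add: clique_free_random_graph_def)
  obtain e M where e: "str_iso {()} R M e" "univ M = (UNIV :: nat set)"
    by (rule ex_nat_copy[OF F clique_free_random_graph_infinite[OF m R]])
  interpret nat_clique_free_random_graph m M
    by unfold_locales (rule m, rule fraisse_limit_iso[OF F e(1)], rule e(2))
  show ?thesis
  \<comment> \<open>The normalizer is \<open>G\<close> itself, so the trivial map has the right
    kernel.\<close>
  proof (rule Out_Aut_str_iso[OF e free_homogeneous_axioms coloring_of_structure(1)[OF fraisse univ c_code], where \<kappa> = "\<lambda>_. ()"])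
    show "(\<lambda>_. ()) ` perm_normalizer = carrier (singleton_group ())"
      using G_normalizer[OF G_id(1)] by auto
    show "() = \<one>\<^bsub>singleton_group ()\<^esub> \<longleftrightarrow> f \<in> col_aut c" if "f \<in> perm_normalizer" for f
      using that by (simp add: normalizer_eq)
  qed simp_all
qed

section \<open>Colored random graphs\<close>

locale nat_colored_random_graph =
  fixes k :: nat and M :: "(nat, nat) binstr"
  assumes k: "2 \<le> k" and fraisse: "fraisse_limit {1..k} (colored_graphs k) M" and univ: "univ M = UNIV"
begin

lemma graph: "i \<in> {1..k} \<Longrightarrow> rel M i x y \<longleftrightarrow> rel M i y x" "i \<in> {1..k} \<Longrightarrow> \<not> rel M i x x"
  "x \<noteq> y \<Longrightarrow> \<exists>!i. i \<in> {1..k} \<and> rel M i x y"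
proof -
  have *: "is_colored_graph k (substr M {x, y})"
    using substr_in_class[OF fraisse univ, of "{x, y}"] by (simp add: colored_graphs_def)
  show "rel M i x y \<longleftrightarrow> rel M i y x" "\<not> rel M i x x" if "i \<in> {1..k}" for i
  proof -
    have s: "symp_on {x, y} (rel M i)" "irreflp_on {x, y} (rel M i)"
      using * that by (simp_all add: is_colored_graph_def)
    show "rel M i x y \<longleftrightarrow> rel M i y x"
      using symp_onD[OF s(1), of x y] symp_onD[OF s(1), of y x] by blast
    show "\<not> rel M i x x" using irreflp_onD[OF s(2), of x] by simp
  qed
  show "\<exists>!i. i \<in> {1..k} \<and> rel M i x y" if "x \<noteq> y" 
  proof -
    have "\<forall>u\<in>{x, y}. \<forall>v\<in>{x, y}. u \<noteq> v \<longrightarrow> (\<exists>!i. i \<in> {1..k} \<and> rel M i u v)"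
      using * unfolding is_colored_graph_def univ_substr rel_substr by (rule conjunct2)
    then show ?thesis using that by blast
  qed
qed

definition c :: "nat \<Rightarrow> nat \<Rightarrow> nat" where
  "c x y = (if x = y then 0 else THE i. i \<in> {1..k} \<and> rel M i x y)"

lemma c_range: "x \<noteq> y \<Longrightarrow> c x y \<in> {1..k}"
  and rel_c: "i \<in> {1..k} \<Longrightarrow> rel M i x y \<longleftrightarrow> c x y = i"
proof -
  have *: "c x y \<in> {1..k} \<and> rel M (c x y) x y" if "x \<noteq> y"
    using theI'[OF graph(3)[OF that]] that by (simp add: c_def)
  then show "x \<noteq> y \<Longrightarrow> c x y \<in> {1..k}" by blast
  show "rel M i x y \<longleftrightarrow> c x y = i" if "i \<in> {1..k}"
  proof (cases "x = y")
    case True then show ?thesis using graph(2)[OF that] that by (auto simp: c_def)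
  next
    case False then show ?thesis using * graph(3)[OF False] that by blast
  qed
qed

lemma c_zero: "c x y = 0 \<longleftrightarrow> x = y"
  using c_range[of x y] by (cases "x = y") (auto simp: c_def)

lemma c_code: "c x y = c x' y' \<longleftrightarrow> (x = y \<longleftrightarrow> x' = y') \<and> (\<forall>i\<in>{1..k}. rel M i x y \<longleftrightarrow> rel M i x' y')"
proof
  assume "c x y = c x' y'"
  then show "(x = y \<longleftrightarrow> x' = y') \<and> (\<forall>i\<in>{1..k}. rel M i x y \<longleftrightarrow> rel M i x' y')"
    using rel_c c_zero by metis
next
  assume *: "(x = y \<longleftrightarrow> x' = y') \<and> (\<forall>i\<in>{1..k}. rel M i x y \<longleftrightarrow> rel M i x' y')"
  show "c x y = c x' y'"
  proof (cases "x = y")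
    case True then show ?thesis using * by (simp add: c_def)
  next
    case False
    note r = c_range[OF False]
    have "rel M (c x y) x' y'" using * rel_c[OF r, of x y] r by blast
    then show ?thesis using rel_c[OF r, of x' y'] by simp
  qed
qed

text \<open>No pattern of colors is forbidden in the class, so any assignment of colors to the
  points of \<open>A\<close> defines a one-point extension in it.\<close>

lemma type_realized:
  assumes A: "finite A" and p: "\<And>a. a \<in> A \<Longrightarrow> p a \<in> {1..k}"
  obtains y where "y \<notin> A" "\<And>a. a \<in> A \<Longrightarrow> c y a = p a"
proof -
  define r where "r i u v = (case u of 0 \<Rightarrow> (case v of 0 \<Rightarrow> False | Suc b \<Rightarrow> p b = i)
    | Suc a \<Rightarrow> (case v of 0 \<Rightarrow> p a = i | Suc b \<Rightarrow> rel M i a b))" for i u v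
  define E :: "(nat, nat) binstr" where "E = \<lparr>univ = insert 0 (Suc ` A), rel = r\<rparr>"
  have "E \<in> colored_graphs k"
    unfolding colored_graphs_def is_colored_graph_def
  proof (intro CollectI conjI ballI impI)
    show "finite (univ E)" using A by (simp add: E_def)
    fix i assume i: "i \<in> {1..k}"
    show "symp_on (univ E) (rel E i)"
      unfolding symp_on_def using graph(1)[OF i] by (auto simp: E_def r_def split: nat.split)
    show "irreflp_on (univ E) (rel E i)"
      unfolding irreflp_on_def using graph(2)[OF i] by (auto simp: E_def r_def split: nat.split)
  next
    fix u v assume uv: "u \<in> univ E" "v \<in> univ E" "u \<noteq> v"
    then consider b where "u = 0" "v = Suc b" "b \<in> A" | a where "u = Suc a" "v = 0" "a \<in> A"
      | a b where "u = Suc a" "v = Suc b" "a \<noteq> b" by (auto simp: E_def)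
    then show "\<exists>!i. i \<in> {1..k} \<and> rel E i u v"
    proof cases
      case 1 then show ?thesis using p[of b] by (auto simp: E_def r_def)
    next
      case 2 then show ?thesis using p[of a] by (auto simp: E_def r_def)
    next
      case 3 then show ?thesis using graph(3)[of a b] by (simp add: E_def r_def)
    qed
  qed
  then obtain y where y: "y \<notin> A" "\<And>i a. i \<in> {1..k} \<Longrightarrow> a \<in> A \<Longrightarrow> rel M i y a \<longleftrightarrow> rel E i 0 (Suc a)"
    using one_point_extension[OF fraisse univ A, of E] by (auto simp: E_def r_def)
  have "c y a = p a" if "a \<in> A" for a
    using y(2)[OF p[OF that] that] rel_c[OF p[OF that], of y a] by (simp add: E_def r_def)
  then show ?thesis using y(1) that by blast
qed

lemma c_sym: "c x y = c y x"
  by (cases "x = y") (simp, metis c_range graph(1) rel_c)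

sublocale free_homogeneous c
proof
  show "c x y = c y x" for x y by (rule c_sym)
  show "c x y = 0 \<longleftrightarrow> x = y" for x y by (rule c_zero)
  show "\<exists>g\<in>col_aut c. \<forall>x\<in>F. g x = f x"
    if "finite F" "\<And>x y. x \<in> F \<Longrightarrow> y \<in> F \<Longrightarrow> c (f x) (f y) = c x y" for F f
    using coloring_of_structure(2)[OF fraisse univ c_code that] .
  show "\<exists>y'. (\<forall>z\<in>F. c y' z = c y z) \<and> (\<forall>z\<in>N - F. c y' z = 1)" if F: "finite F" "finite N" "y \<notin> F" for F N y
  proof -
    have p: "(if z \<in> F then c y z else 1) \<in> {1..k}" for z
      using F(3) c_range[of y z] k by auto
    have "finite (F \<union> N)" using F by simp
    then obtain y' where "\<And>z. z \<in> F \<union> N \<Longrightarrow> c y' z = (if z \<in> F then c y z else 1)"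
      by (rule type_realized[OF _ p]) (rule that)
    then show ?thesis by (intro exI[of _ y']) auto
  qed
qed

lemma color_realized:
  assumes "i \<in> {1..k}"
  obtains x y where "c x y = i"
  using type_realized[of "{0}" "\<lambda>_. i"] assms by (metis finite.emptyI finite.insertI insertI1)

text \<open>The value is independent of the pair by \<open>normalizer_color_eq\<close>. Being the
  identity outside \<open>{1..k}\<close> makes it a permutation in the sense of
  \<open>permutes\<close> and fixes the code \<open>0\<close> of the diagonal.\<close>

definition recoloring :: "(nat \<Rightarrow> nat) \<Rightarrow> nat \<Rightarrow> nat" where
  "recoloring f i = (if i \<in> {1..k} then (THE j. \<exists>x y. c x y = i \<and> c (f x) (f y) = j) else i)"

lemma recoloring:
  assumes f: "f \<in> perm_normalizer"
  shows "c (f x) (f y) = recoloring f (c x y)"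
proof (cases "x = y")
  case True
  then have z: "c x y = 0" "c (f x) (f y) = 0" using c_zero by auto
  show ?thesis unfolding z by (simp add: recoloring_def)
next
  case False
  have "(THE j. \<exists>x' y'. c x' y' = c x y \<and> c (f x') (f y') = j) = c (f x) (f y)"
  proof (rule the_equality)
    show "\<exists>x' y'. c x' y' = c x y \<and> c (f x') (f y') = c (f x) (f y)" by blast
    fix j assume "\<exists>x' y'. c x' y' = c x y \<and> c (f x') (f y') = j"
    then show "j = c (f x) (f y)" using normalizer_color_eq[OF f] by metis
  qed
  then show ?thesis using c_range[OF False] by (simp add: recoloring_def)
qed

lemma recoloring_eqI:
  assumes "f \<in> perm_normalizer" "\<And>x y. c (f x) (f y) = \<pi> (c x y)" "\<And>i. i \<notin> {1..k} \<Longrightarrow> \<pi> i = i"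
  shows "recoloring f = \<pi>"
proof
  fix i
  show "recoloring f i = \<pi> i"
  proof (cases "i \<in> {1..k}")
    case True
    then obtain x y where "c x y = i" by (rule color_realized)
    then show ?thesis using recoloring[OF assms(1)] assms(2) by metis
  next
    case False
    then have "recoloring f i = i" unfolding recoloring_def by (rule if_not_P)
    then show ?thesis using assms(3)[OF False] by simp
  qed
qed

lemma recoloring_comp:
  assumes "f \<in> perm_normalizer" "f' \<in> perm_normalizer" "f \<circ> f' \<in> perm_normalizer"
  shows "recoloring (f \<circ> f') = recoloring f \<circ> recoloring f'"
proof (rule recoloring_eqI[OF assms(3)])
  show "c ((f \<circ> f') x) ((f \<circ> f') y) = (recoloring f \<circ> recoloring f') (c x y)" for x y
    using recoloring assms by simp
  show "(recoloring f \<circ> recoloring f') i = i" if "i \<notin> {1..k}" for i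
  proof -
    have "recoloring g i = i" for g unfolding recoloring_def using that by (rule if_not_P)
    then show ?thesis by simp
  qed
qed

lemma recoloring_permutes:
  assumes f: "f \<in> perm_normalizer"
  shows "recoloring f permutes {1..k}"
proof -
  have b: "bij f" using f by (simp add: perm_normalizer_def)
  have into: "recoloring f i \<in> {1..k}" if i: "i \<in> {1..k}" for i
  proof -
    obtain x y where xy: "c x y = i" using i by (rule color_realized)
    then have "x \<noteq> y" using i c_zero[of x y] by auto
    then have "f x \<noteq> f y" using b by (simp add: bij_is_inj inj_eq)
    then show ?thesis using c_range recoloring[OF f, of x y] xy by metis
  qed
  have "inj_on (recoloring f) {1..k}"
  proof (rule inj_onI)
    fix i j assume "i \<in> {1..k}" "j \<in> {1..k}" and eq: "recoloring f i = recoloring f j"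
    then obtain x y x' y' where "c x y = i" "c x' y' = j" using color_realized by metis
    then show "i = j" using eq recoloring[OF f] normalizer_color_eq[OF f] by metis
  qed
  then have "bij_betw (recoloring f) {1..k} {1..k}"
    using into by (simp add: bij_betw_def endo_inj_surj image_subset_iff)
  then show ?thesis by (rule bij_imp_permutes) (simp only: recoloring_def if_False)
qed

text \<open>A back-and-forth between the colored graph and its recoloring by \<pi>;
  \<open>type_realized\<close> serves both directions, with \<pi> for the domain and its inverse for
  the range. The approximations change \<open>c\<close>, so they are functions with a finite domain
  instead of elements of \<open>G\<close>.\<close>

lemma ex_recoloring:
  assumes \<pi>: "\<pi> permutes {1..k}"
  obtains f where "bij f" "\<And>x y. c (f x) (f y) = \<pi> (c x y)"
proof -
  have \<pi>0: "\<pi> 0 = 0" using permutes_not_in[OF \<pi>] by simp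
  have \<pi>i: "inv' \<pi> (\<pi> i) = i" "\<pi> (inv' \<pi> i) = i" for i using permutes_inverses[OF \<pi>] by simp_all
  have \<pi>r: "\<pi> i \<in> {1..k} \<longleftrightarrow> i \<in> {1..k}" "inv' \<pi> i \<in> {1..k} \<longleftrightarrow> i \<in> {1..k}" for i
    using permutes_in_image[OF \<pi>] permutes_in_image[OF permutes_inv[OF \<pi>]] by simp_all
  define P where "P = (\<lambda>(f, F). finite F \<and> (\<forall>x\<in>F. \<forall>y\<in>F. c (f x) (f y) = \<pi> (c x y)))"
  define E where "E = (\<lambda>(f::nat\<Rightarrow>nat, F) (f', F'). F \<subseteq> F' \<and> (\<forall>x\<in>F. f' x = f x))"
  have inj: "f x \<noteq> f y" if "P (f, F)" "x \<in> F" "y \<in> F" "x \<noteq> y" for f F x y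
  proof
    assume "f x = f y"
    moreover have "c (f x) (f y) = \<pi> (c x y)" using that by (simp add: P_def)
    ultimately have "\<pi> (c x y) = 0" using c_zero[of "f x" "f y"] by metis
    then have "c x y = 0" using \<pi>i(1)[of "c x y"] \<pi>i(1)[of 0] \<pi>0 by simp
    then show False using that c_zero by blast
  qed
  have ext: "P (f(y := y'), insert y F) \<and> E (f, F) (f(y := y'), insert y F)"
    if "P (f, F)" "y \<notin> F" "\<And>x. x \<in> F \<Longrightarrow> c y' (f x) = \<pi> (c y x)" for f F y y'
  proof -
    have "c (f x) y' = \<pi> (c x y)" if "x \<in> F" for x using \<open>\<And>x. x \<in> F \<Longrightarrow> c y' (f x) = \<pi> (c y x)\<close>[OF that] c_sym by metis
    moreover have "c y' y' = \<pi> (c y y)" using \<pi>0 c_zero by metis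
    ultimately show ?thesis using that by (auto simp: P_def E_def)
  qed
  have dom: "\<exists>q. P q \<and> E (f, F) q \<and> y \<in> snd q" if f: "P (f, F)" for f F y
  proof (cases "y \<in> F")
    case True then show ?thesis using f by (intro exI[of _ "(f, F)"]) (auto simp: E_def)
  next
    case False
    have fin: "finite (f ` F)" using f by (simp add: P_def)
    define g where "g = inv_into F f"
    have g: "g (f x) = x" if "x \<in> F" for x
      unfolding g_def by (rule inv_into_f_f[OF _ that]) (use inj[OF f] in \<open>auto simp: inj_on_def\<close>)
    have "\<pi> (c y (g z)) \<in> {1..k}" if "z \<in> f ` F" for z
    proof -
      have "g z \<noteq> y" using that g False by auto
      then show ?thesis using c_range[of y "g z"] \<pi>r(1) by blast
    qed
    from type_realized[of _ "\<lambda>z. \<pi> (c y (g z))", OF fin this]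
    obtain y' where y': "\<And>z. z \<in> f ` F \<Longrightarrow> c y' z = \<pi> (c y (g z))" by metis
    have "c y' (f x) = \<pi> (c y x)" if "x \<in> F" for x using y'[of "f x"] g[OF that] that by simp
    from ext[OF f False this] show ?thesis by (metis insertI1 snd_conv)
  qed
  have ran: "\<exists>q. P q \<and> E (f, F) q \<and> z \<in> fst q ` snd q" if f: "P (f, F)" for f F z
  proof (cases "z \<in> f ` F")
    case True then show ?thesis using f by (intro exI[of _ "(f, F)"]) (auto simp: E_def)
  next
    case False
    have "inv' \<pi> (c z (f x)) \<in> {1..k}" if "x \<in> F" for x
    proof -
      have "z \<noteq> f x" using that False by auto
      then show ?thesis using c_range[of z "f x"] \<pi>r(2) by blast
    qed
    moreover have "finite F" using f by (simp add: P_def)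
    ultimately obtain y where y: "y \<notin> F" "\<And>x. x \<in> F \<Longrightarrow> c y x = inv' \<pi> (c z (f x))"
      using type_realized[of F "\<lambda>x. inv' \<pi> (c z (f x))"] by metis
    have "c z (f x) = \<pi> (c y x)" if "x \<in> F" for x using y(2)[OF that] \<pi>i by simp
    from ext[OF f y(1) this] show ?thesis by (intro exI[of _ "(f(y := z), insert y F)"]) auto
  qed
  have step: "\<exists>q. P q \<and> E p q \<and> (n \<in> snd q \<and> n \<in> fst q ` snd q)" if p: "P p" for p n
  proof -
    obtain f F where fF: "p = (f, F)" by force
    obtain g H where g: "P (g, H)" "E p (g, H)" "n \<in> H" using dom[of f F n] p fF by auto
    obtain q where q: "P q" "E (g, H) q" "n \<in> fst q ` snd q" using ran[OF g(1)] by blast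
    have "E p q" "n \<in> snd q" using g q(2) fF by (auto simp: E_def split: prod.splits)
    then show ?thesis using q by blast
  qed
  have "P (id, {})" by (simp add: P_def)
  then obtain s where s0: "s 0 = (id, {})" and s: "\<And>n. P (s n)" "\<And>n. E (s n) (s (Suc n))"
    "\<And>n. n \<in> snd (s (Suc n)) \<and> n \<in> fst (s (Suc n)) ` snd (s (Suc n))"
    by (rule descending_sequence[of P "(id, {})" E "\<lambda>n q. n \<in> snd q \<and> n \<in> fst q ` snd q"])
      (erule step | rule that)+
  obtain f where f: "\<And>n x. x \<in> snd (s n) \<Longrightarrow> f x = fst (s n) x"
  proof (rule limit_fun[of "\<lambda>n. snd (s n)" "\<lambda>n. fst (s n)"])
    show "snd (s n) \<subseteq> snd (s (Suc n))" for n using s(2)[of n] by (auto simp: E_def split: prod.splits)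
    show "fst (s (Suc n)) y = fst (s n) y" if "y \<in> snd (s n)" for n y 
      using s(2)[of n] that by (auto simp: E_def split: prod.splits)
  qed (rule that)
  have "snd (s n) \<subseteq> snd (s (Suc n))" for n using s(2)[of n] by (auto simp: E_def split: prod.splits)
  then have mono: "snd (s i) \<subseteq> snd (s j)" if "i \<le> j" for i j
    using lift_Suc_mono_le[of "\<lambda>n. snd (s n)", OF _ that] by blast
  have fc: "c (f x) (f y) = \<pi> (c x y)" for x y
  proof -
    define n where "n = Suc (max x y)"
    have "x \<in> snd (s n)" "y \<in> snd (s n)"
      using s(3)[of x] s(3)[of y] mono[of "Suc x" n] mono[of "Suc y" n] by (auto simp: n_def)
    then show ?thesis using s(1)[of n] f by (auto simp: P_def split: prod.splits)
  qed
  have "inj f"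
  proof (rule injI)
    fix x y assume "f x = f y"
    then have "\<pi> (c x y) = 0" using fc c_zero by metis
    then have "c x y = 0" using \<pi>i(1)[of "c x y"] \<pi>i(1)[of 0] \<pi>0 by simp
    then show "x = y" using c_zero by blast
  qed
  moreover have "surj f" unfolding surj_def using s(3) f by (metis imageE)
  ultimately show ?thesis using fc that by (simp add: bij_def)
qed

text \<open>A permutation that acts on colors by \<pi> normalizes \<open>G\<close>, because in a
  conjugate of \<open>g\<close> the recolorings by \<pi> and by its inverse cancel.\<close>

lemma recoloring_surj: "recoloring ` perm_normalizer = {\<pi>. \<pi> permutes {1..k}}"
proof (intro equalityI subsetI)
  fix \<pi> assume "\<pi> \<in> {\<pi>. \<pi> permutes {1..k}}"
  then have \<pi>: "\<pi> permutes {1..k}" by simp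
  obtain f where f: "bij f" "\<And>x y. c (f x) (f y) = \<pi> (c x y)" by (rule ex_recoloring[OF \<pi>]) (rule that)
  have i: "inv' f (f x) = x" "f (inv' f x) = x" for x using bij_inv_simps[OF f(1)] by auto
  have fi: "c (inv' f x) (inv' f y) = inv' \<pi> (c x y)" for x y
    using f(2)[of "inv' f x" "inv' f y"] i permutes_inverses(2)[OF \<pi>] by metis
  have "f \<in> perm_normalizer" unfolding perm_normalizer_def
  proof (intro CollectI conjI ballI)
    fix g assume g: "g \<in> col_aut c"
    have b: "bij (inv' f)" "bij g" using f(1) g by (simp_all add: bij_imp_bij_inv G_bij)
    show "f \<circ> g \<circ> inv' f \<in> col_aut c" "inv' f \<circ> g \<circ> f \<in> col_aut c"
      using f b fi G_c[OF g] permutes_inverses[OF \<pi>] unfolding col_aut_def by (auto intro!: bij_comp)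
  qed (rule f)
  moreover from this have "recoloring f = \<pi>"
    by (rule recoloring_eqI) (use f(2) permutes_not_in[OF \<pi>] in auto)
  ultimately show "\<pi> \<in> recoloring ` perm_normalizer" by blast
qed (use recoloring_permutes in auto)

lemma recoloring_id: 
  assumes "f \<in> perm_normalizer"
  shows "recoloring f = id \<longleftrightarrow> f \<in> col_aut c"
proof
  assume "recoloring f = id"
  then show "f \<in> col_aut c" using recoloring[OF assms] assms by (simp add: col_aut_def perm_normalizer_def)
next
  assume "f \<in> col_aut c"
  then show "recoloring f = id" by (intro recoloring_eqI[OF assms]) (simp_all add: G_c)
qed

end

lemma colored_random_graph_infinite:
  assumes k: "2 \<le> k" and R: "colored_random_graph k R"
  shows "infinite (univ R)"
proof (rule fraisse_limit_infinite)
  show "fraisse_limit {1..k} (colored_graphs k) R" using R by (simp add: colored_random_graph_def)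
  fix n
  define E :: "(nat, nat) binstr" where "E = \<lparr>univ = {..<n}, rel = \<lambda>i x y. i = 1 \<and> x \<noteq> y\<rparr>"
  have "E \<in> colored_graphs k"
    using k by (auto simp: colored_graphs_def is_colored_graph_def E_def symp_on_def irreflp_on_def)
  then show "\<exists>A\<in>colored_graphs k. card (univ A) = n" by (intro bexI[of _ E]) (simp_all add: E_def)
qed

theorem Out_colored_random_graph:
  assumes k: "2 \<le> k" and R: "colored_random_graph k R"
  shows "Out (Aut_str {1..k} R) \<cong> sym_group k"
proof -
  have F: "fraisse_limit {1..k} (colored_graphs k) R" using R by (simp add: colored_random_graph_def)
  obtain e M where e: "str_iso {1..k} R M e" "univ M = (UNIV :: nat set)"
    by (rule ex_nat_copy[OF F colored_random_graph_infinite[OF k R]])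
  interpret nat_colored_random_graph k M
    by unfold_locales (rule k, rule fraisse_limit_iso[OF F e(1)], rule e(2))
  show ?thesis
  proof (rule Out_Aut_str_iso[OF e free_homogeneous_axioms coloring_of_structure(1)[OF fraisse univ c_code], where \<kappa> = recoloring])
    show "group (sym_group k)" by (rule sym_group_is_group)
    show "recoloring (f \<circ> f') = recoloring f \<otimes>\<^bsub>sym_group k\<^esub> recoloring f'"
      if "f \<in> perm_normalizer" "f' \<in> perm_normalizer" for f f'
      using recoloring_comp[OF that perm_normalizer_comp[OF that]] by (simp add: sym_group_mult)
    show "recoloring ` perm_normalizer = carrier (sym_group k)"
      using recoloring_surj by (auto simp: sym_group_carrier)
    show "recoloring f = \<one>\<^bsub>sym_group k\<^esub> \<longleftrightarrow> f \<in> col_aut c" if "f \<in> perm_normalizer" for f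
      using recoloring_id[OF that] by (simp add: sym_group_one)
  qed
qed

theorem corollary1p7:
  shows "(\<forall>m\<ge>3. \<forall>R :: (unit, 'a) binstr. clique_free_random_graph m R \<longrightarrow>
            Out (Aut_str {()} R) \<cong> singleton_group ()) \<and>
         (\<forall>k\<ge>2. \<forall>R :: (nat, 'b) binstr. colored_random_graph k R \<longrightarrow>
            Out (Aut_str {1..k} R) \<cong> sym_group k)"
  using Out_clique_free_random_graph Out_colored_random_graph by blast

end
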